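(* Let $\mathcal F$ be a self-dual variation of biextension type over a curve $S$, with local normal form $F(s)=e^{\Gamma(s)}\cdot F$ ($F=F(0)$, $\Gamma$ holomorphic with values in $\mathfrak q_F$, $\Gamma(0)=0$) on a disk $(\Delta,s)$ centred at $s_0\in S$, and let $h$ be the Hodge metric on $\operatorname{gr}^W_{-1}$. Choose a lift $e(0)\in I^{0,0}_F$ of $1\in\mathbb Z(0)$, let $\gamma=\Gamma'(0)$, let $\gamma^{-1,0}$ be its Hodge component of type $(-1,0)$, and put $t=\gamma^{-1,0}(e(0))\in I^{-1,0}_F$. Let $\nu\in\operatorname{Ext}^1_{\rm VMHS}(\mathbb Z(0),\operatorname{gr}^W_{-1}\mathcal F)$ and its dual be the two normal functions associated to the biextension and let $\delta(s)$ be the Deligne $\delta$-splitting of $\mathcal F_s$. Then: 1. The value of the infinitesimal invariant $\partial\nu$ of the normal function $\nu$ at $s_0$ is identified with $t$. 2. $\displaystyle\left.\frac{\partial^2}{\partial s\,\partial\bar s}\delta(s)\right|_0(e(0))=h(t,t)\in\mathbb R_{\ge0}.$ 3. The Chern form $\frac1{2\pi\mathrm i}\partial\bar\partial\log h_{\rm biext}$ of the biextension metric $h_{\rm biext}(s)=e^{-2\pi\delta(s)}$ is semi-positive.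
   Context: Biextension type: mixed Hodge structures with $\operatorname{gr}^W_0=\mathbb Z(0)$, $\operatorname{gr}^W_{-1}=H$ a pure Hodge structure of weight $-1$ polarized by the alternating form $Q$, $\operatorname{gr}^W_{-2}=\mathbb Z(1)$. A variation of biextension type is a graded-polarized variation of mixed Hodge structure with such fibres $(F_s,W)$. It gives two normal functions: $\nu$, the class of $0\to\operatorname{gr}^W_{-1}\to W_0/W_{-2}\to\mathbb Z(0)\to0$, and the one given by the dual (twisted into $\mathbb Z(1)$) of $0\to\mathbb Z(1)\to W_{-1}\to\operatorname{gr}^W_{-1}\to0$. Self-dual means that these correspond to each other under the isomorphism $H\cong\operatorname{Hom}(H,\mathbb Z(1))$ given by $Q$; infinitesimally (Tate twists suppressed) this says that, on $H=\operatorname{gr}^W_{-1}$, $\gamma^{-1,0}$ is the functional $\beta\mapsto-Q(\beta,t)$ with values in $\operatorname{gr}^W_{-2}$. Let $V_{\mathbb C}=(W_0)_{\mathbb C}=\bigoplus I^{p,q}$ be the Deligne bigrading of $(F,W)$: the unique functorial bigrading with $F^p=\bigoplus_{a\ge p}I^{a,b}$, $W_k=\bigoplus_{a+b\le k}I^{a,b}$, $\overline{I^{p,q}}\equiv I^{q,p}$ mod $\bigoplus_{a<q,b<p}I^{a,b}$. $\mathfrak g_{\mathbb C}$ (real form $\mathfrak g_{\mathbb R}$) is the Lie algebra of the group of complex automorphisms of $V_{\mathbb C}$ preserving $W$ and the graded polarizations; $\mathfrak g^{r,s}$ (type $(r,s)$) consists of the elements mapping each $I^{p,q}$ to $I^{p+r,q+s}$;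 $\mathfrak q_F=\bigoplus_{r<0}\mathfrak g^{r,s}$. The tangent of the period map is horizontal, i.e. in $\bigoplus_s\mathfrak g^{-1,s}$. Deligne splitting: $\delta_{F,W}\in\mathfrak g^{-1,-1}\cap\mathfrak g_{\mathbb R}$, $\mathfrak g^{-1,-1}=\operatorname{Hom}(\operatorname{gr}^W_0,\operatorname{gr}^W_{-2})_{\mathbb C}$, is the unique element with $(e^{-\mathrm i\delta_{F,W}}F,W)$ split over $\mathbb R$; equivalently $\delta_{F,W}=\frac1{4\mathrm i}(Y-\overline Y)$, $Y$ acting on $I^{p,q}$ as $p+q$. Using fixed real bases of $\operatorname{gr}^W_0$, $\operatorname{gr}^W_{-2}$ (and a normalization constant depending only on $W$) it is viewed as a real number $\delta(s)$ for $F=F_s$; in 2, evaluation on $e(0)$ gives a multiple of the basis vector of $\operatorname{gr}^W_{-2}$, regarded as a number. The Hodge metric on $\operatorname{gr}^W_{-1}$ is $h(x,y)=Q(Cx,\bar y)$, $C=\mathrm i^{p-q}$ on $H^{p,q}$; thus $h(t,t)=-\mathrm i\,Q(t,\bar t)$ on $H^{-1,0}\cong I^{-1,0}_F$. Infinitesimal invariant of $\nu$ at $s_0$: here it means the Hodge component in $\operatorname{Hom}(I^{0,0}_F,I^{-1,0}_F)$ of the derivative at $s_0$ of the period map of $\nu$, identified with an element of $I^{-1,0}_F$ by evaluation on $e(0)$. *)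

theory Defs
  imports "HOL-Analysis.Analysis" "HOL-Library.Set_Algebras" "HOL-Library.Nonpos_Ints"
begin

section \<open>Lattices of biextension type\<close>

text \<open>
  The underlying integral structure is \<open>V\<^sub>\<int> = \<int>\<^sup>n\<close> inside \<open>V\<^sub>\<complex> = \<complex>\<^sup>n\<close>, so that the real structure is
  \<open>\<real>\<^sup>n\<close>, complex conjugation is componentwise, and endomorphisms are matrices. Complex linear
  algebra is that of the scalar multiplication \<open>*s\<close>.

  A lattice of biextension type is given by \<open>gr0 : W\<^sub>0 \<rightarrow> gr\<^sub>0 = \<int>(0)\<close>, with kernel \<open>W\<^sub>-\<^sub>1\<close>, by a
  generator \<open>gen\<close> of the rank one lattice \<open>gr\<^sub>-\<^sub>2 = \<int>(1)\<close>, and by the polarization \<open>pol = Q\<close>.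
  The form \<open>Q\<close> lives on \<open>gr\<^sub>-\<^sub>1 = W\<^sub>-\<^sub>1 / W\<^sub>-\<^sub>2\<close>; it is written as a form on \<open>W\<^sub>-\<^sub>1\<close> that vanishes on
  \<open>W\<^sub>-\<^sub>2\<close>. Its values in \<open>\<int>(1)\<close> are expressed as multiples of \<open>gen\<close>.
\<close>

record 'n biext_lattice =
  gr0 :: "complex ^ 'n \<Rightarrow> complex"
  gen :: "complex ^ 'n"
  pol :: "complex ^ 'n \<Rightarrow> complex ^ 'n \<Rightarrow> complex"

abbreviation clinear :: "(complex ^ 'n \<Rightarrow> complex) \<Rightarrow> bool" where
  "clinear f \<equiv> Vector_Spaces.linear (*s) (*) f"

definition vcnj :: "complex ^ 'n \<Rightarrow> complex ^ 'n" where
  "vcnj v = (\<chi> i. cnj (v $ i))"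

definition VZ :: "(complex ^ 'n) set" where
  "VZ = {v. \<forall>i. v $ i \<in> \<int>}"

definition W :: "'n biext_lattice \<Rightarrow> int \<Rightarrow> (complex ^ 'n) set" where
  "W B k = (if k \<ge> 0 then UNIV
            else if k = -1 then {v. gr0 B v = 0}
            else if k = -2 then range (\<lambda>c. c *s gen B)
            else {0})"

definition biext_lattice :: "'n::finite biext_lattice \<Rightarrow> bool" where
  "biext_lattice B \<longleftrightarrow>
     clinear (gr0 B) \<and> gr0 B ` VZ = \<int> \<and>
     gr0 B (gen B) = 0 \<and> {c. c *s gen B \<in> VZ} = \<int> \<and>
     (\<forall>x \<in> W B (-1). \<forall>y \<in> W B (-1). \<forall>z \<in> W B (-1). \<forall>a b.
        pol B (a *s x + b *s y) z = a * pol B x z + b * pol B y z \<and>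
        pol B z (a *s x + b *s y) = a * pol B z x + b * pol B z y) \<and>
     (\<forall>x \<in> W B (-1). pol B x x = 0 \<and> pol B (gen B) x = 0) \<and>
     (\<forall>x \<in> W B (-1) \<inter> VZ. \<forall>y \<in> W B (-1) \<inter> VZ. pol B x y \<in> \<int>)"

section \<open>Mixed Hodge structures\<close>

type_synonym 'n filtration = "int \<Rightarrow> (complex ^ 'n) set"

text \<open>The preimage in \<open>W k\<close> of the Hodge filtration induced on \<open>gr\<^sub>k\<close>.\<close>

definition gr_filt :: "'n::finite filtration \<Rightarrow> 'n filtration \<Rightarrow> int \<Rightarrow> 'n filtration" where
  "gr_filt Wt F k p = (F p \<inter> Wt k) + Wt (k - 1)"

text \<open>
  For every \<open>k\<close> the filtration induced on \<open>gr\<^sub>k\<close> is \<open>k\<close>-opposed to its conjugate: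
  \<open>gr\<^sub>k = F\<^sup>p gr\<^sub>k \<oplus> cnj (F\<^sup>k\<^sup>+\<^sup>1\<^sup>-\<^sup>p gr\<^sub>k)\<close>. The weight filtrations used below are stable under conjugation.
\<close>

definition mhs :: "'n::finite filtration \<Rightarrow> 'n filtration \<Rightarrow> bool" where
  "mhs Wt F \<longleftrightarrow>
     (\<forall>p. vec.subspace (F p)) \<and> antimono F \<and> (\<exists>p. F p = UNIV) \<and> (\<exists>p. F p = {0}) \<and>
     (\<forall>k p. gr_filt Wt F k p + vcnj ` gr_filt Wt F k (k + 1 - p) = Wt k \<and>
            gr_filt Wt F k p \<inter> vcnj ` gr_filt Wt F k (k + 1 - p) = Wt (k - 1))"

text \<open>
  The two Riemann bilinear relations for \<open>Q\<close> on \<open>gr\<^sub>-\<^sub>1\<close>, where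
  \<open>H\<^sup>p\<^sup>,\<^sup>q = F\<^sup>p \<inter> cnj F\<^sup>q\<close> for \<open>p + q = -1\<close>.
\<close>

definition polarized :: "'n::finite biext_lattice \<Rightarrow> 'n filtration \<Rightarrow> bool" where
  "polarized B F \<longleftrightarrow>
     (\<forall>p. \<forall>x \<in> gr_filt (W B) F (-1) p. \<forall>y \<in> gr_filt (W B) F (-1) (-p). pol B x y = 0) \<and>
     (\<forall>p q. \<forall>x \<in> gr_filt (W B) F (-1) p \<inter> vcnj ` gr_filt (W B) F (-1) q.
        p + q = -1 \<and> x \<notin> W B (-2) \<longrightarrow>
        \<i> powi (p - q) * pol B x (vcnj x) \<in> \<real> \<and>
        0 < Re (\<i> powi (p - q) * pol B x (vcnj x)))"

text \<open>
  The last four conditions say that \<open>gr\<^sub>0\<close> and \<open>gr\<^sub>-\<^sub>2\<close> have Hodge types \<open>(0,0)\<close> and \<open>(-1,-1)\<close>.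
\<close>

definition biext_mhs :: "'n::finite biext_lattice \<Rightarrow> 'n filtration \<Rightarrow> bool" where
  "biext_mhs B F \<longleftrightarrow> mhs (W B) F \<and> polarized B F \<and>
     gr_filt (W B) F 0 0 = W B 0 \<and> gr_filt (W B) F 0 1 = W B (-1) \<and>
     gr_filt (W B) F (-2) (-1) = W B (-2) \<and> gr_filt (W B) F (-2) 0 = W B (-3)"

section \<open>The Deligne bigrading\<close>

type_synonym 'n bigrading = "int \<Rightarrow> int \<Rightarrow> (complex ^ 'n) set"

definition bigr_decomposes ::
  "'n::finite bigrading \<Rightarrow> (int \<times> int \<Rightarrow> complex ^ 'n) \<Rightarrow> complex ^ 'n \<Rightarrow> bool" where
  "bigr_decomposes I c v \<longleftrightarrow> (\<forall>p q. c (p, q) \<in> I p q) \<and> finite {x. c x \<noteq> 0} \<and>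
     v = (\<Sum>x | c x \<noteq> 0. c x)"

definition is_deligne_bigrading ::
  "'n::finite filtration \<Rightarrow> 'n filtration \<Rightarrow> 'n bigrading \<Rightarrow> bool" where
  "is_deligne_bigrading Wt F I \<longleftrightarrow>
     (\<forall>p q. vec.subspace (I p q)) \<and>
     (\<forall>v. \<exists>!c. bigr_decomposes I c v) \<and>
     (\<forall>p. F p = vec.span (\<Union>{I a b | a b. a \<ge> p})) \<and>
     (\<forall>k. Wt k = vec.span (\<Union>{I a b | a b. a + b \<le> k})) \<and>
     (\<forall>p q. vcnj ` I p q + vec.span (\<Union>{I a b | a b. a < q \<and> b < p}) =
            I q p + vec.span (\<Union>{I a b | a b. a < q \<and> b < p}))"

definition deligne_bigrading :: "'n::finite filtration \<Rightarrow> 'n filtration \<Rightarrow> 'n bigrading" where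
  "deligne_bigrading Wt F = (THE I. is_deligne_bigrading Wt F I)"

definition hproj :: "'n::finite bigrading \<Rightarrow> int \<Rightarrow> int \<Rightarrow> complex ^ 'n \<Rightarrow> complex ^ 'n" where
  "hproj I p q v = (THE c. bigr_decomposes I c v) (p, q)"

definition hodge_component ::
  "'n::finite bigrading \<Rightarrow> int \<Rightarrow> int \<Rightarrow> complex ^ 'n ^ 'n \<Rightarrow> complex ^ 'n \<Rightarrow> complex ^ 'n" where
  "hodge_component I r s X v =
     (\<Sum>(p, q) \<in> {(p, q). I p q \<noteq> {0}}. hproj I (p + r) (q + s) (X *v hproj I p q v))"

text \<open>
  The Weil operator and the Hodge metric of \<open>gr\<^sub>-\<^sub>1\<close>, on representatives in \<open>W\<^sub>-\<^sub>1\<close>: the image of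
  \<open>I\<^sup>p\<^sup>,\<^sup>q\<close> in \<open>gr\<^sub>-\<^sub>1\<close> is \<open>H\<^sup>p\<^sup>,\<^sup>q\<close> for \<open>p + q = -1\<close>.
\<close>

definition weil_op :: "'n::finite bigrading \<Rightarrow> complex ^ 'n \<Rightarrow> complex ^ 'n" where
  "weil_op I x = (\<Sum>(p, q) \<in> {(p, q). p + q = -1 \<and> I p q \<noteq> {0}}. (\<i> powi (p - q)) *s hproj I p q x)"

definition hodge_metric ::
  "'n::finite biext_lattice \<Rightarrow> 'n filtration \<Rightarrow> complex ^ 'n \<Rightarrow> complex ^ 'n \<Rightarrow> complex" where
  "hodge_metric B F x y = pol B (weil_op (deligne_bigrading (W B) F) x) (vcnj y)"

section \<open>The Lie algebra\<close>

definition mat_exp :: "complex ^ 'n ^ 'n \<Rightarrow> complex ^ 'n ^ 'n::finite" where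
  "mat_exp X = (\<Sum>k. ((\<lambda>Y. X ** Y) ^^ k) (mat 1) /\<^sub>R fact k)"

text \<open>The graded polarizations; those of \<open>\<int>(0)\<close> and \<open>\<int>(1)\<close> take the value 1 on the generators.\<close>

definition graded_pol :: "'n::finite biext_lattice \<Rightarrow> int \<Rightarrow> complex ^ 'n \<Rightarrow> complex ^ 'n \<Rightarrow> complex" where
  "graded_pol B k x y =
     (if k = 0 then gr0 B x * gr0 B y
      else if k = -1 then pol B x y
      else if k = -2 then (THE a. x = a *s gen B) * (THE b. y = b *s gen B)
      else 0)"

definition graded_aut :: "'n::finite biext_lattice \<Rightarrow> (complex ^ 'n ^ 'n) set" where
  "graded_aut B = {M. invertible M \<and> (\<forall>k. (\<lambda>v. M *v v) ` W B k = W B k) \<and>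
     (\<forall>k. \<forall>x \<in> W B k. \<forall>y \<in> W B k. graded_pol B k (M *v x) (M *v y) = graded_pol B k x y)}"

definition lie_alg :: "'n::finite biext_lattice \<Rightarrow> (complex ^ 'n ^ 'n) set" where
  "lie_alg B = {X. \<forall>t::real. mat_exp (t *\<^sub>R X) \<in> graded_aut B}"

definition lie_alg_real :: "'n::finite biext_lattice \<Rightarrow> (complex ^ 'n ^ 'n) set" where
  "lie_alg_real B = {X \<in> lie_alg B. \<forall>i j. X $ i $ j \<in> \<real>}"

definition lie_alg_type ::
  "'n::finite biext_lattice \<Rightarrow> 'n filtration \<Rightarrow> int \<Rightarrow> int \<Rightarrow> (complex ^ 'n ^ 'n) set" where
  "lie_alg_type B F r s = {X \<in> lie_alg B. \<forall>p q.
     (\<lambda>v. X *v v) ` deligne_bigrading (W B) F p q \<subseteq> deligne_bigrading (W B) F (p + r) (q + s)}"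

text \<open>
  The pieces \<open>lie_alg_type\<close> are complex subspaces in direct sum, so their real span is
  \<open>\<Oplus>\<^bsub>r<0\<^esub> g\<^sup>r\<^sup>,\<^sup>s\<close>.
\<close>

definition q_alg :: "'n::finite biext_lattice \<Rightarrow> 'n filtration \<Rightarrow> (complex ^ 'n ^ 'n) set" where
  "q_alg B F = span (\<Union>{lie_alg_type B F r s | r s. r < 0})"

definition act :: "complex ^ 'n ^ 'n \<Rightarrow> 'n::finite filtration \<Rightarrow> 'n filtration" where
  "act M F = (\<lambda>p. (\<lambda>v. M *v v) ` F p)"

section \<open>The Deligne splitting\<close>

definition split_over_reals :: "'n::finite filtration \<Rightarrow> 'n filtration \<Rightarrow> bool" where
  "split_over_reals Wt F \<longleftrightarrow>
     (\<forall>p q. vcnj ` deligne_bigrading Wt F p q = deligne_bigrading Wt F q p)"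

definition deligne_delta :: "'n::finite biext_lattice \<Rightarrow> 'n filtration \<Rightarrow> complex ^ 'n ^ 'n" where
  "deligne_delta B F = (THE D. D \<in> lie_alg_type B F (-1) (-1) \<inter> lie_alg_real B \<and>
     split_over_reals (W B) (act (mat_exp (mat (-\<i>) ** D)) F))"

text \<open>
  The real number \<open>\<delta>\<close>, for the basis \<open>1\<close> of \<open>gr\<^sub>0 = \<int>(0)\<close> and the basis \<open>gen\<close> of \<open>gr\<^sub>-\<^sub>2\<close>. With \<open>gen\<close> an
  integral generator the normalization constant is 1. (If \<open>\<int>(1)\<close> is realized as \<open>2\<pi>\<i>\<int>\<close>, with
  \<open>gen = 2\<pi>\<i>\<close>, the extension of \<open>\<int>(0)\<close> by \<open>\<int>(1)\<close> with \<open>F\<^sup>0\<close> spanned by \<open>e\<^sub>0 + c gen\<close>, \<open>e\<^sub>0\<close> integral,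
  has \<open>\<delta> = Im c\<close>, and \<open>exp (-2\<pi>\<delta>) = \<bar>exp (2\<pi>\<i> c)\<bar>\<close>.)
\<close>

definition delta_num :: "'n::finite biext_lattice \<Rightarrow> 'n filtration \<Rightarrow> real" where
  "delta_num B F = (THE d. \<forall>v. deligne_delta B F *v v = (of_real d * gr0 B v) *s gen B)"

section \<open>Curves, local systems and variations\<close>

definition holo_coord ::
  "('s::t2_space set \<times> ('s \<Rightarrow> complex)) set \<Rightarrow> 's set \<Rightarrow> ('s \<Rightarrow> complex) \<Rightarrow> bool" where
  "holo_coord A U \<phi> \<longleftrightarrow> open U \<and> open (\<phi> ` U) \<and> (\<exists>\<psi>. homeomorphism U (\<phi> ` U) \<phi> \<psi>) \<and>
     (\<forall>(U', \<phi>') \<in> A. (\<phi> \<circ> inv_into U' \<phi>') holomorphic_on \<phi>' ` (U \<inter> U'))"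

text \<open>A smooth complex curve is the whole type \<open>'s\<close> with a holomorphic atlas.\<close>

definition complex_curve :: "('s::t2_space set \<times> ('s \<Rightarrow> complex)) set \<Rightarrow> bool" where
  "complex_curve A \<longleftrightarrow> \<Union>(fst ` A) = UNIV \<and> (\<forall>(U, \<phi>) \<in> A. holo_coord A U \<phi>)"

text \<open>Lattice automorphisms that are trivial on \<open>gr\<^sub>0 = \<int>(0)\<close> and \<open>gr\<^sub>-\<^sub>2 = \<int>(1)\<close> and preserve \<open>Q\<close>.\<close>

definition lattice_aut :: "'n::finite biext_lattice \<Rightarrow> (complex ^ 'n ^ 'n) set" where
  "lattice_aut B = {M. (\<forall>i j. M $ i $ j \<in> \<int>) \<and> det M \<in> {1, -1} \<and>
     (\<forall>v. gr0 B (M *v v) = gr0 B v) \<and> M *v gen B = gen B \<and>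
     (\<forall>x \<in> W B (-1). \<forall>y \<in> W B (-1). pol B (M *v x) (M *v y) = pol B x y)}"

text \<open>
  A local system of biextension lattices. Each fibre is identified, in some arbitrary way depending
  on the point, with the lattice \<open>B\<close>; the local system is the collection \<open>\<Phi>\<close> of its local flat
  trivializations \<open>g\<close>, where \<open>g s\<close> maps the fibre at \<open>s\<close> to \<open>B\<close>. Two flat
  trivializations differ by a locally constant automorphism.
\<close>

definition flat_frame ::
  "'n::finite biext_lattice \<Rightarrow> ('s::t2_space set \<times> ('s \<Rightarrow> complex ^ 'n ^ 'n)) set \<Rightarrow>
   's set \<Rightarrow> ('s \<Rightarrow> complex ^ 'n ^ 'n) \<Rightarrow> bool" where
  "flat_frame B \<Phi> U g \<longleftrightarrow> open U \<and> (\<forall>s \<in> U. g s \<in> lattice_aut B) \<and>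
     (\<forall>(U', g') \<in> \<Phi>. \<forall>s \<in> U \<inter> U'. \<exists>N M. open N \<and> s \<in> N \<and> N \<subseteq> U \<inter> U' \<and>
        (\<forall>x \<in> N. g x = M ** g' x))"

definition local_system ::
  "'n::finite biext_lattice \<Rightarrow> ('s::t2_space set \<times> ('s \<Rightarrow> complex ^ 'n ^ 'n)) set \<Rightarrow> bool" where
  "local_system B \<Phi> \<longleftrightarrow> \<Union>(fst ` \<Phi>) = UNIV \<and> (\<forall>(U, g) \<in> \<Phi>. flat_frame B \<Phi> U g)"

text \<open>
  The Hodge filtration of the fibres, transported to \<open>B\<close> by a flat trivialization \<open>g\<close> and written
  in the coordinate \<open>\<phi>\<close>.
\<close>

definition local_period ::
  "('s \<Rightarrow> 'n::finite filtration) \<Rightarrow> 's set \<Rightarrow> ('s \<Rightarrow> complex ^ 'n ^ 'n) \<Rightarrow> ('s \<Rightarrow> complex) \<Rightarrow>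
   complex \<Rightarrow> 'n filtration" where
  "local_period F U g \<phi> w = act (g (inv_into U \<phi> w)) (F (inv_into U \<phi> w))"

definition vholomorphic_on :: "(complex \<Rightarrow> complex ^ 'n::finite) \<Rightarrow> complex set \<Rightarrow> bool" where
  "vholomorphic_on \<sigma> N \<longleftrightarrow> (\<forall>i. (\<lambda>w. \<sigma> w $ i) holomorphic_on N)"

definition vderiv :: "(complex \<Rightarrow> complex ^ 'n::finite) \<Rightarrow> complex \<Rightarrow> complex ^ 'n" where
  "vderiv \<sigma> w = (\<chi> i. deriv (\<lambda>x. \<sigma> x $ i) w)"

text \<open>Each \<open>F\<^sup>p\<close> is a holomorphic subbundle: locally it has a holomorphic frame.\<close>

definition holomorphic_filtration :: "complex set \<Rightarrow> (complex \<Rightarrow> 'n::finite filtration) \<Rightarrow> bool" where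
  "holomorphic_filtration \<Omega> F \<longleftrightarrow>
     (\<forall>z \<in> \<Omega>. \<forall>p. \<exists>N d b. open N \<and> z \<in> N \<and> N \<subseteq> \<Omega> \<and>
        (\<forall>i<d. vholomorphic_on (b i) N) \<and>
        (\<forall>w \<in> N. inj_on (\<lambda>i. b i w) {..<d} \<and> vec.independent ((\<lambda>i. b i w) ` {..<d::nat}) \<and>
           F w p = vec.span ((\<lambda>i. b i w) ` {..<d})))"

definition griffiths_transversal :: "complex set \<Rightarrow> (complex \<Rightarrow> 'n::finite filtration) \<Rightarrow> bool" where
  "griffiths_transversal \<Omega> F \<longleftrightarrow>
     (\<forall>p N \<sigma>. open N \<and> N \<subseteq> \<Omega> \<and> vholomorphic_on \<sigma> N \<and> (\<forall>w \<in> N. \<sigma> w \<in> F w p) \<longrightarrow>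
        (\<forall>w \<in> N. vderiv \<sigma> w \<in> F w (p - 1)))"

definition biext_variation ::
  "('s::t2_space set \<times> ('s \<Rightarrow> complex)) set \<Rightarrow> 'n::finite biext_lattice \<Rightarrow>
   ('s set \<times> ('s \<Rightarrow> complex ^ 'n ^ 'n)) set \<Rightarrow> ('s \<Rightarrow> 'n filtration) \<Rightarrow> bool" where
  "biext_variation A B \<Phi> F \<longleftrightarrow>
     complex_curve A \<and> biext_lattice B \<and> local_system B \<Phi> \<and> (\<forall>s. biext_mhs B (F s)) \<and>
     (\<forall>U \<phi> g. holo_coord A U \<phi> \<and> flat_frame B \<Phi> U g \<longrightarrow>
        holomorphic_filtration (\<phi> ` U) (local_period F U g \<phi>) \<and>
        griffiths_transversal (\<phi> ` U) (local_period F U g \<phi>))"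

section \<open>Normal functions and self-duality\<close>

text \<open>
  The class of \<open>0 \<rightarrow> gr\<^sub>-\<^sub>1 \<rightarrow> W\<^sub>0/W\<^sub>-\<^sub>2 \<rightarrow> \<int>(0) \<rightarrow> 0\<close> in \<open>Ext\<^sup>1(\<int>(0), H) = H\<^sub>\<complex> / (F\<^sup>0 H + H\<^sub>\<int>)\<close>: the
  difference of a Hodge lift and an integral lift of \<open>1\<close>. The value is the whole coset, pulled back to \<open>W\<^sub>-\<^sub>1\<close>.
\<close>

definition normal_fun :: "'n::finite biext_lattice \<Rightarrow> 'n filtration \<Rightarrow> (complex ^ 'n) set" where
  "normal_fun B F = {vF - vZ | vF vZ. vF \<in> F 0 \<and> gr0 B vF = 1 \<and> vZ \<in> VZ \<and> gr0 B vZ = 1} + W B (-2)"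

text \<open>
  The dual of \<open>0 \<rightarrow> \<int>(1) \<rightarrow> W\<^sub>-\<^sub>1 \<rightarrow> H \<rightarrow> 0\<close> is
  \<open>0 \<rightarrow> Hom(H, \<int>(1)) \<rightarrow> Hom(W\<^sub>-\<^sub>1, \<int>(1)) \<rightarrow> \<int>(0) \<rightarrow> 0\<close>. Its class is again the difference of a
  Hodge lift and an integral lift of the identity of \<open>\<int>(1)\<close>, that is, of two retractions of \<open>W\<^sub>-\<^sub>1\<close> to \<open>W\<^sub>-\<^sub>2\<close>
  (with values written as multiples of \<open>gen\<close>). A retraction is in \<open>F\<^sup>0\<close> iff it
  kills \<open>F\<^sup>0 \<inter> W\<^sub>-\<^sub>1\<close>, because \<open>\<int>(1)\<close> has type \<open>(-1,-1)\<close>. Only the restrictions of the functionals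
  to \<open>W\<^sub>-\<^sub>1\<close> matter; every functional there extends to the whole space.
\<close>

definition dual_normal_fun :: "'n::finite biext_lattice \<Rightarrow> 'n filtration \<Rightarrow> (complex ^ 'n \<Rightarrow> complex) set" where
  "dual_normal_fun B F = {f. \<exists>rF rZ.
     clinear rF \<and> rF (gen B) = 1 \<and> (\<forall>x \<in> F 0 \<inter> W B (-1). rF x = 0) \<and>
     clinear rZ \<and> rZ (gen B) = 1 \<and> (\<forall>x \<in> VZ \<inter> W B (-1). rZ x \<in> \<int>) \<and>
     (\<forall>x \<in> W B (-1). f x = rF x - rZ x)}"

text \<open>
  Both classes are cosets, and \<open>x \<mapsto> Q(\<cdot>, x)\<close> respects the subgroups, so the
  classes correspond iff the image of the first coset is contained in the second. With this choice of
  \<open>Q(\<cdot>, x)\<close>, and the same sign convention (Hodge lift minus integral lift) for both classes,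
  differentiation gives \<open>\<gamma>\<^sup>-\<^sup>1\<^sup>,\<^sup>0(\<beta>) = - Q(\<beta>, t)\<close>.
\<close>

definition self_dual :: "'n::finite biext_lattice \<Rightarrow> ('s \<Rightarrow> 'n filtration) \<Rightarrow> bool" where
  "self_dual B F \<longleftrightarrow>
     (\<forall>s. (\<lambda>x. \<lambda>\<beta>. pol B \<beta> x) ` normal_fun B (F s) \<subseteq> dual_normal_fun B (F s))"

text \<open>
  The Hodge filtration of \<open>W\<^sub>0/W\<^sub>-\<^sub>2\<close>, pulled back to \<open>W\<^sub>0\<close>.
\<close>

definition nu_filt :: "'n::finite biext_lattice \<Rightarrow> (complex \<Rightarrow> 'n filtration) \<Rightarrow> complex \<Rightarrow> 'n filtration" where
  "nu_filt B F w p = F w p + W B (-2)"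

text \<open>
  The derivative at \<open>z\<close> of a period map, as an element of \<open>Hom(F\<^sup>p, V/F\<^sup>p)\<close>:
  it sends \<open>\<sigma>(z)\<close> to the class of \<open>\<sigma>'(z)\<close>, for local holomorphic sections \<open>\<sigma>\<close> of \<open>F\<^sup>p\<close>. The value is a
  coset of \<open>F z p\<close>.
\<close>

definition period_derivative ::
  "complex set \<Rightarrow> (complex \<Rightarrow> 'n::finite filtration) \<Rightarrow> complex \<Rightarrow> int \<Rightarrow> complex ^ 'n \<Rightarrow> (complex ^ 'n) set" where
  "period_derivative \<Omega> F z p x = {vderiv \<sigma> z | \<sigma> N. open N \<and> z \<in> N \<and> N \<subseteq> \<Omega> \<and>
     vholomorphic_on \<sigma> N \<and> (\<forall>w \<in> N. \<sigma> w \<in> F w p) \<and> \<sigma> z = x} + F z p"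

text \<open>
  The component in \<open>Hom(I\<^sup>0\<^sup>,\<^sup>0, I\<^sup>-\<^sup>1\<^sup>,\<^sup>0)\<close> of the derivative of the period map of \<open>\<nu>\<close>, evaluated on \<open>e\<close>.
  The projection to \<open>I\<^sup>-\<^sup>1\<^sup>,\<^sup>0\<close> kills \<open>F\<^sup>0 + W\<^sub>-\<^sub>2\<close>, hence is constant on the coset.
\<close>

definition inf_invariant ::
  "'n::finite biext_lattice \<Rightarrow> complex set \<Rightarrow> (complex \<Rightarrow> 'n filtration) \<Rightarrow> complex \<Rightarrow> complex ^ 'n \<Rightarrow> complex ^ 'n" where
  "inf_invariant B \<Omega> F z e =
     (THE u. hproj (deligne_bigrading (W B) (F z)) (-1) 0 ` period_derivative \<Omega> (nu_filt B F) z 0 e = {u})"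

section \<open>Derivatives and the Chern form\<close>

definition dz :: "(complex \<Rightarrow> complex) \<Rightarrow> complex \<Rightarrow> complex" where
  "dz f w = (frechet_derivative f (at w) 1 - \<i> * frechet_derivative f (at w) \<i>) / 2"

definition dzbar :: "(complex \<Rightarrow> complex) \<Rightarrow> complex \<Rightarrow> complex" where
  "dzbar f w = (frechet_derivative f (at w) 1 + \<i> * frechet_derivative f (at w) \<i>) / 2"

definition twice_real_differentiable_on :: "(complex \<Rightarrow> complex) \<Rightarrow> complex set \<Rightarrow> bool" where
  "twice_real_differentiable_on f \<Omega> \<longleftrightarrow>
     f differentiable_on \<Omega> \<and> dz f differentiable_on \<Omega> \<and> dzbar f differentiable_on \<Omega>"

definition h_biext :: "'n::finite biext_lattice \<Rightarrow> 'n filtration \<Rightarrow> real" where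
  "h_biext B F = exp (- 2 * pi * delta_num B F)"

text \<open>
  The \<open>(1,1)\<close>-form \<open>1/(2\<pi>\<i>) \<partial>\<partial>bar (log h)\<close> at \<open>w\<close>, as an alternating form on tangent vectors,
  with \<open>(dw \<and> dwbar)(u, v) = u * cnj v - v * cnj u\<close>.
\<close>

definition chern_form :: "(complex \<Rightarrow> real) \<Rightarrow> complex \<Rightarrow> complex \<Rightarrow> complex \<Rightarrow> complex" where
  "chern_form h w u v =
     1 / (2 * of_real pi * \<i>) * dz (dzbar (\<lambda>x. of_real (ln (h x)))) w * (u * cnj v - v * cnj u)"

definition semi_positive :: "(complex \<Rightarrow> complex \<Rightarrow> complex) \<Rightarrow> bool" where
  "semi_positive \<eta> \<longleftrightarrow> (\<forall>u. \<eta> u (\<i> * u) \<in> \<real>\<^sub>\<ge>\<^sub>0)"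

end

theory Submission
  imports Defs "HOL-Complex_Analysis.Cauchy_Integral_Formula"
begin

text \<open>
  Let \<open>e(s)\<close> be the element of \<open>F\<^sup>0\<^sub>s\<close> over \<open>1 \<in> \<int>(0)\<close> with \<open>e - cnj e \<in> W\<^sub>-\<^sub>2\<close>; it spans \<open>I\<^sup>0\<^sup>,\<^sup>0\<close>, and
  \<open>e - cnj e = 2\<i>\<delta> gen\<close>. Put \<open>\<beta> = \<partial>e/\<partial>cnj s\<close>. As \<open>F\<^sup>0\<close> is holomorphic, \<open>\<beta> \<in> F\<^sup>0 \<inter> W\<^sub>-\<^sub>1\<close>. Differentiating
  \<open>e - cnj e = 2\<i>\<delta> gen\<close> shows \<open>\<partial>e/\<partial>s \<equiv> cnj \<beta>\<close> modulo \<open>gen\<close>, so \<open>cnj \<beta> \<in> I\<^sup>-\<^sup>1\<^sup>,\<^sup>0\<close> by transversality, and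
  \<open>cnj \<beta>\<close> is the infinitesimal invariant \<open>t\<close>. A second differentiation gives
  \<open>\<partial>\<beta>/\<partial>s - cnj (\<partial>\<beta>/\<partial>s) = 2\<i> \<delta>\<^sub>s\<^sub>s' gen\<close>, where \<open>\<delta>\<^sub>s\<^sub>s'\<close> is the mixed derivative.

  For a fixed integral lift \<open>v\<close> of \<open>1\<close>, self-duality yields at each point an integral retraction \<open>\<rho>\<close> of
  \<open>W\<^sub>-\<^sub>1\<close> onto \<open>W\<^sub>-\<^sub>2\<close> with \<open>Q(x, e - v) = - \<rho>(x)\<close> on \<open>F\<^sup>0 \<inter> W\<^sub>-\<^sub>1\<close>. This equation determines \<open>\<rho>\<close>, because
  \<open>W\<^sub>-\<^sub>1\<close> is spanned by \<open>F\<^sup>0 \<inter> W\<^sub>-\<^sub>1\<close>, its conjugate and \<open>gen\<close>; so \<open>\<rho>\<close> is continuous in \<open>s\<close> and integral,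
  hence locally constant. Applying \<open>\<partial>/\<partial>s\<close> to \<open>Q(\<beta>, e - v) = - \<rho>(\<beta>)\<close> and subtracting the conjugate
  equation leaves \<open>\<delta>\<^sub>s\<^sub>s' = - \<i> Q(t, cnj t) = h(t, t)\<close>, at every point of the curve.
\<close>

section \<open>Wirtinger calculus\<close>

text \<open>The lift e(s) is neither holomorphic nor given by a formula: its defining condition
  mixes F^0 with its conjugate. The decomposition V = F^0 + cnj (F^0 \<inter> W_-1) + W_-2 turns
  this condition into a linear system whose coefficients come from a holomorphic frame and its
  conjugate, and Cramer's rule keeps the solution within a class of functions whose mixed
  derivatives commute. That symmetry is essential: the mixed derivative m of e is the s-derivative
  of \<beta> and also the conjugate-derivative of de/ds, so m and cnj m meet in one equation. As m -
  cnj m is a multiple of gen and Q kills gen, Q(m, e - v) = Q(cnj m, e - v); the term e - v cancels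
  and only 2 Q(\<beta>, cnj \<beta>) survives. Its sign is the second Riemann relation. The normal
  form serves only to identify cnj \<beta> with t. It gives e(s) = exp(\<Gamma>(s)) a(s) with a(s)
  merely known to lie in F^0, so the comparison uses difference quotients and a projection that
  kills F^0 + W_-2.\<close>

definition has_wd :: "(complex \<Rightarrow> complex) \<Rightarrow> complex \<Rightarrow> complex \<Rightarrow> complex \<Rightarrow> bool" where
  "has_wd f a b w \<longleftrightarrow> (f has_derivative (\<lambda>h. h * a + cnj h * b)) (at w)"

lemma has_wd_dz: "has_wd f a b w \<Longrightarrow> dz f w = a"
  and has_wd_dzbar: "has_wd f a b w \<Longrightarrow> dzbar f w = b"
  and has_wd_differentiable: "has_wd f a b w \<Longrightarrow> f differentiable (at w)"
proof -
  assume f: "has_wd f a b w"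
  then have "frechet_derivative f (at w) = (\<lambda>h. h * a + cnj h * b)"
    unfolding has_wd_def by (metis frechet_derivative_at)
  then show "dz f w = a" "dzbar f w = b" by (simp_all add: dz_def dzbar_def algebra_simps)
  show "f differentiable (at w)" using f unfolding has_wd_def differentiable_def by blast
qed

text \<open>The device by which identities are differentiated: one function is differentiated in two
  ways and the coefficients are compared.\<close>

lemma has_wd_unique:
  assumes "has_wd f a b w" "has_wd f a' b' w"
  shows "a = a'" "b = b'"
  using assms has_wd_dz has_wd_dzbar by metis+

lemma has_wd_cong_open:
  assumes "has_wd f a b w" "open N" "w \<in> N" "\<And>x. x \<in> N \<Longrightarrow> f x = g x"
  shows "has_wd g a b w"
  using assms has_derivative_transform_within_open unfolding has_wd_def by blast

lemma has_wd_const: "has_wd (\<lambda>_. c) 0 0 w"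
  by (simp add: has_wd_def)

lemma has_wd_cnj: "has_wd f a b w \<Longrightarrow> has_wd (\<lambda>w. cnj (f w)) (cnj b) (cnj a) w"
  unfolding has_wd_def by (drule has_derivative_cnj) (simp add: add.commute)

lemma has_wd_add:
  "has_wd f a b w \<Longrightarrow> has_wd g a' b' w \<Longrightarrow> has_wd (\<lambda>w. f w + g w) (a + a') (b + b') w"
  unfolding has_wd_def by (drule (1) has_derivative_add) (simp add: algebra_simps)

lemma has_wd_mult:
  "has_wd f a b w \<Longrightarrow> has_wd g a' b' w \<Longrightarrow>
    has_wd (\<lambda>w. f w * g w) (a * g w + f w * a') (b * g w + f w * b') w"
  unfolding has_wd_def by (drule (1) has_derivative_mult) (simp add: algebra_simps)

lemma has_wd_cmult: "has_wd f a b w \<Longrightarrow> has_wd (\<lambda>w. c * f w) (c * a) (c * b) w"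
  using has_wd_mult[OF has_wd_const, of f a b w c] by simp

lemma has_wd_diff:
  "has_wd f a b w \<Longrightarrow> has_wd g a' b' w \<Longrightarrow> has_wd (\<lambda>w. f w - g w) (a - a') (b - b') w"
  unfolding has_wd_def by (drule (1) has_derivative_diff) (simp add: algebra_simps)

lemma has_wd_sum:
  "(\<And>i. i \<in> S \<Longrightarrow> has_wd (f i) (a i) (b i) w) \<Longrightarrow>
    has_wd (\<lambda>w. \<Sum>i\<in>S. f i w) (\<Sum>i\<in>S. a i) (\<Sum>i\<in>S. b i) w"
  unfolding has_wd_def
  by (drule has_derivative_sum) (simp add: sum.distrib sum_distrib_left)

lemma has_wd_inverse:
  assumes "has_wd f a b w" "f w \<noteq> 0"
  shows "has_wd (\<lambda>w. inverse (f w)) (- (inverse (f w) * inverse (f w) * a)) (- (inverse (f w) * inverse (f w) * b)) w"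
  using Deriv.has_derivative_inverse[OF assms(2) assms(1)[unfolded has_wd_def]] unfolding has_wd_def
  by (simp add: algebra_simps)

lemma has_wd_holomorphic:
  assumes "f holomorphic_on N" "open N" "w \<in> N"
  shows "has_wd f (deriv f w) 0 w"
proof -
  have "(*) (deriv f w) = (\<lambda>h. h * deriv f w)" by (auto simp: mult.commute)
  then show ?thesis
    using holomorphic_derivI[OF assms, of UNIV] unfolding has_wd_def has_field_derivative_def by simp
qed

text \<open>
  A class of real-analytic functions that is stable under both Wirtinger derivatives. It replaces
  \<open>C\<^sup>\<infinity>\<close>, which would need the symmetry of second derivatives.
\<close>

inductive real_anal :: "complex set \<Rightarrow> (complex \<Rightarrow> complex) \<Rightarrow> bool" for N where
  holo: "f holomorphic_on N \<Longrightarrow> real_anal N f"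
| cnj: "real_anal N f \<Longrightarrow> real_anal N (\<lambda>w. cnj (f w))"
| add: "real_anal N f \<Longrightarrow> real_anal N g \<Longrightarrow> real_anal N (\<lambda>w. f w + g w)"
| mult: "real_anal N f \<Longrightarrow> real_anal N g \<Longrightarrow> real_anal N (\<lambda>w. f w * g w)"
| inverse: "real_anal N f \<Longrightarrow> (\<And>w. w \<in> N \<Longrightarrow> f w \<noteq> 0) \<Longrightarrow> real_anal N (\<lambda>w. inverse (f w))"
| cong: "real_anal N f \<Longrightarrow> (\<And>w. w \<in> N \<Longrightarrow> f w = g w) \<Longrightarrow> real_anal N g"

lemma real_anal_const: "real_anal N (\<lambda>_. c)"
  by (intro real_anal.holo holomorphic_intros)

lemma real_anal_minus: "real_anal N f \<Longrightarrow> real_anal N (\<lambda>w. - f w)"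
  using real_anal.mult[OF real_anal_const[of N "-1"]] by simp

lemma real_anal_diff: "real_anal N f \<Longrightarrow> real_anal N g \<Longrightarrow> real_anal N (\<lambda>w. f w - g w)"
  using real_anal.add[OF _ real_anal_minus] by simp

lemma real_anal_divide: "real_anal N f \<Longrightarrow> real_anal N g \<Longrightarrow> (\<And>w. w \<in> N \<Longrightarrow> g w \<noteq> 0) \<Longrightarrow> real_anal N (\<lambda>w. f w / g w)"
  using real_anal.mult[OF _ real_anal.inverse] by (simp add: divide_inverse)

lemma real_anal_sum: "(\<And>i. i \<in> S \<Longrightarrow> real_anal N (f i)) \<Longrightarrow> real_anal N (\<lambda>w. \<Sum>i\<in>S. f i w)"
  by (induction S rule: infinite_finite_induct) (auto intro: real_anal_const real_anal.add)

lemma real_anal_prod: "(\<And>i. i \<in> S \<Longrightarrow> real_anal N (f i)) \<Longrightarrow> real_anal N (\<lambda>w. \<Prod>i\<in>S. f i w)"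
  by (induction S rule: infinite_finite_induct) (auto intro: real_anal_const real_anal.mult)

lemma real_anal_subset: "real_anal N f \<Longrightarrow> M \<subseteq> N \<Longrightarrow> real_anal M f"
  by (induction rule: real_anal.induct) (auto intro: real_anal.intros holomorphic_on_subset)

lemma real_anal_det:
  assumes "\<And>i j. real_anal N (\<lambda>w. L w $ i $ j)"
  shows "real_anal N (\<lambda>w. det (L w :: complex ^ 'n::finite ^ 'n))"
  unfolding det_def by (intro real_anal_sum real_anal.mult real_anal_const real_anal_prod assms)

text \<open>The same \<open>fm\<close> is the conjugate-derivative of \<open>fz\<close> and the
  holomorphic derivative of \<open>fb\<close>. Carrying it through the induction is what proves the
  symmetry of mixed derivatives. As \<open>fz\<close> and \<open>fb\<close> lie in the class again,
  the lemma can be iterated.\<close>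

lemma real_anal_derivatives:
  assumes "real_anal N f" "open N"
  shows "\<exists>fz fb fm. real_anal N fz \<and> real_anal N fb \<and> real_anal N fm \<and>
    (\<forall>w\<in>N. has_wd f (fz w) (fb w) w \<and> (\<exists>a. has_wd fz a (fm w) w) \<and> (\<exists>b. has_wd fb (fm w) b w))"
  using assms(1)
proof (induction rule: real_anal.induct)
  case (holo f)
  then show ?case
    by (intro exI[of _ "deriv f"] exI[of _ "\<lambda>_. 0"])
       (auto intro!: real_anal.holo holomorphic_intros has_wd_holomorphic has_wd_const exI assms(2))
next
  case (cnj f)
  then obtain fz fb fm where r: "real_anal N fz" "real_anal N fb" "real_anal N fm"
    and d: "\<forall>w\<in>N. has_wd f (fz w) (fb w) w \<and> (\<exists>a. has_wd fz a (fm w) w) \<and> (\<exists>b. has_wd fb (fm w) b w)"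
    by (elim exE conjE) (rule that)
  show ?case
  proof (rule exI[of _ "\<lambda>w. cnj (fb w)"], rule exI[of _ "\<lambda>w. cnj (fz w)"], rule exI[of _ "\<lambda>w. cnj (fm w)"],
      intro conjI ballI)
    show "real_anal N (\<lambda>w. cnj (fb w))" "real_anal N (\<lambda>w. cnj (fz w))" "real_anal N (\<lambda>w. cnj (fm w))"
      by (intro real_anal.cnj r)+
    fix w assume w: "w \<in> N"
    then obtain a b where "has_wd f (fz w) (fb w) w" "has_wd fz a (fm w) w" "has_wd fb (fm w) b w"
      using bspec[OF d w] by blast
    note this[THEN has_wd_cnj]
    then show "has_wd (\<lambda>w. cnj (f w)) (cnj (fb w)) (cnj (fz w)) w"
      "\<exists>a. has_wd (\<lambda>w. cnj (fb w)) a (cnj (fm w)) w" "\<exists>b. has_wd (\<lambda>w. cnj (fz w)) (cnj (fm w)) b w"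
      by (auto intro: exI)
  qed
next
  case (add f g)
  from add.IH(1) obtain fz fb fm where r: "real_anal N fz" "real_anal N fb" "real_anal N fm"
    and d: "\<forall>w\<in>N. has_wd f (fz w) (fb w) w \<and> (\<exists>a. has_wd fz a (fm w) w) \<and> (\<exists>b. has_wd fb (fm w) b w)"
    by (elim exE conjE) (rule that)
  from add.IH(2) obtain gz gb gm where r': "real_anal N gz" "real_anal N gb" "real_anal N gm"
    and e: "\<forall>w\<in>N. has_wd g (gz w) (gb w) w \<and> (\<exists>a. has_wd gz a (gm w) w) \<and> (\<exists>b. has_wd gb (gm w) b w)"
    by (elim exE conjE) (rule that)
  show ?case
  proof (rule exI[of _ "\<lambda>w. fz w + gz w"], rule exI[of _ "\<lambda>w. fb w + gb w"], rule exI[of _ "\<lambda>w. fm w + gm w"],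
      intro conjI ballI)
    show "real_anal N (\<lambda>w. fz w + gz w)" "real_anal N (\<lambda>w. fb w + gb w)" "real_anal N (\<lambda>w. fm w + gm w)"
      by (intro real_anal.add r r')+
    fix w assume w: "w \<in> N"
    obtain a b a' b' where f: "has_wd f (fz w) (fb w) w" "has_wd fz a (fm w) w" "has_wd fb (fm w) b w"
      and g: "has_wd g (gz w) (gb w) w" "has_wd gz a' (gm w) w" "has_wd gb (gm w) b' w" using bspec[OF d w] bspec[OF e w] by blast
    show "has_wd (\<lambda>w. f w + g w) (fz w + gz w) (fb w + gb w) w"
      by (rule has_wd_add[OF f(1) g(1)])
    show "\<exists>a. has_wd (\<lambda>w. fz w + gz w) a (fm w + gm w) w"
      by (rule exI, rule has_wd_add[OF f(2) g(2)])
    show "\<exists>b. has_wd (\<lambda>w. fb w + gb w) (fm w + gm w) b w"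
      by (rule exI, rule has_wd_add[OF f(3) g(3)])
  qed
next
  case (mult f g)
  from mult.IH(1) obtain fz fb fm where r: "real_anal N fz" "real_anal N fb" "real_anal N fm"
    and d: "\<forall>w\<in>N. has_wd f (fz w) (fb w) w \<and> (\<exists>a. has_wd fz a (fm w) w) \<and> (\<exists>b. has_wd fb (fm w) b w)"
    by (elim exE conjE) (rule that)
  from mult.IH(2) obtain gz gb gm where r': "real_anal N gz" "real_anal N gb" "real_anal N gm"
    and e: "\<forall>w\<in>N. has_wd g (gz w) (gb w) w \<and> (\<exists>a. has_wd gz a (gm w) w) \<and> (\<exists>b. has_wd gb (gm w) b w)"
    by (elim exE conjE) (rule that)
  define m where "m = (\<lambda>w. fm w * g w + fz w * gb w + (fb w * gz w + f w * gm w))"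
  show ?case
  proof (rule exI[of _ "\<lambda>w. fz w * g w + f w * gz w"], rule exI[of _ "\<lambda>w. fb w * g w + f w * gb w"],
      rule exI[of _ m], intro conjI ballI)
    show "real_anal N (\<lambda>w. fz w * g w + f w * gz w)" "real_anal N (\<lambda>w. fb w * g w + f w * gb w)" "real_anal N m"
      unfolding m_def by (intro real_anal.add real_anal.mult r r' mult.hyps)+
    fix w assume w: "w \<in> N"
    have f: "has_wd f (fz w) (fb w) w" and g: "has_wd g (gz w) (gb w) w" using bspec[OF d w] bspec[OF e w] by auto
    obtain a b a' b' where fz: "has_wd fz a (fm w) w" and fb: "has_wd fb (fm w) b w"
      and gz: "has_wd gz a' (gm w) w" and gb: "has_wd gb (gm w) b' w" using bspec[OF d w] bspec[OF e w] by blast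
    show "has_wd (\<lambda>w. f w * g w) (fz w * g w + f w * gz w) (fb w * g w + f w * gb w) w"
      by (rule has_wd_mult[OF f g])
    show "\<exists>a. has_wd (\<lambda>w. fz w * g w + f w * gz w) a (m w) w"
      unfolding m_def by (rule exI, rule has_wd_add[OF has_wd_mult[OF fz g] has_wd_mult[OF f gz]])
    \<comment> \<open>Differentiating in the other order gives the four terms of \<open>m\<close> in
      a different arrangement, so the coefficient is rewritten into \<open>m\<close>.\<close>
    show "\<exists>b. has_wd (\<lambda>w. fb w * g w + f w * gb w) (m w) b w"
      by (rule exI, rule back_subst[of "\<lambda>a. has_wd _ a _ w", OF has_wd_add[OF has_wd_mult[OF fb g] has_wd_mult[OF f gb]]])
        (simp add: m_def algebra_simps)
  qed
next
  case (inverse f)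
  from inverse.IH obtain fz fb fm where r: "real_anal N fz" "real_anal N fb" "real_anal N fm"
    and d: "\<forall>w\<in>N. has_wd f (fz w) (fb w) w \<and> (\<exists>a. has_wd fz a (fm w) w) \<and> (\<exists>b. has_wd fb (fm w) b w)"
    by (elim exE conjE) (rule that)
  let ?i = "\<lambda>w. inverse (f w)"
  have ri: "real_anal N ?i" by (intro real_anal.inverse inverse.hyps)
  \<comment> \<open>The sign is kept as a factor -1 so that the rule for constant multiples applies
    literally.\<close>
  let ?d = "\<lambda>u w. (-1) * (?i w * ?i w * u w)"
  define m where "m = (\<lambda>w. (-1) * ((- (?i w * ?i w * fb w) * ?i w + ?i w * - (?i w * ?i w * fb w)) * fz w + ?i w * ?i w * fm w))"
  show ?case
  proof (rule exI[of _ "?d fz"], rule exI[of _ "?d fb"], rule exI[of _ m], intro conjI ballI)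
    show "real_anal N (?d fz)" "real_anal N (?d fb)" "real_anal N m"
      unfolding m_def
      by (intro real_anal.add real_anal.mult r ri real_anal_const real_anal_minus)+
    fix w assume w: "w \<in> N"
    have f: "has_wd f (fz w) (fb w) w" using bspec[OF d w] by auto
    obtain a b where fz: "has_wd fz a (fm w) w" and fb: "has_wd fb (fm w) b w" using bspec[OF d w] by blast
    note i = has_wd_inverse[OF f inverse.hyps(2)[OF w]]
    show "has_wd ?i (?d fz w) (?d fb w) w"
      using i by simp
    show "\<exists>a. has_wd (?d fz) a (m w) w"
      unfolding m_def by (rule exI, rule has_wd_cmult[OF has_wd_mult[OF has_wd_mult[OF i i] fz], of "-1"])
    have *: "has_wd (?d fb) ((-1) * ((- (?i w * ?i w * fz w) * ?i w + ?i w * - (?i w * ?i w * fz w)) * fb w + ?i w * ?i w * fm w))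
       ((-1) * ((- (?i w * ?i w * fb w) * ?i w + ?i w * - (?i w * ?i w * fb w)) * fb w + ?i w * ?i w * b)) w"
      by (rule has_wd_cmult[OF has_wd_mult[OF has_wd_mult[OF i i] fb], of "-1"])
    show "\<exists>b. has_wd (?d fb) (m w) b w"
      by (rule exI, rule back_subst[of "\<lambda>a. has_wd (?d fb) a _ w", OF *]) (simp add: m_def algebra_simps)
  qed
next
  case (cong f g)
  from cong.IH obtain fz fb fm where r: "real_anal N fz" "real_anal N fb" "real_anal N fm"
    and d: "\<forall>w\<in>N. has_wd f (fz w) (fb w) w \<and> (\<exists>a. has_wd fz a (fm w) w) \<and> (\<exists>b. has_wd fb (fm w) b w)"
    by (elim exE conjE) (rule that)
  then have "\<forall>w\<in>N. has_wd g (fz w) (fb w) w"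
    using cong.hyps(2) assms(2) has_wd_cong_open by blast
  then show ?case using r d by blast
qed

lemma real_anal_continuous:
  assumes "real_anal N f" "open N"
  shows "continuous_on N f"
  using real_anal_derivatives[OF assms] has_wd_differentiable differentiable_imp_continuous_within
    continuous_at_imp_continuous_on by metis

lemma
  assumes f: "real_anal N f" and N: "open N"
  shows real_anal_dz: "real_anal N (dz f)" and real_anal_dzbar: "real_anal N (dzbar f)"
    and has_wd_real_anal: "w \<in> N \<Longrightarrow> has_wd f (dz f w) (dzbar f w) w"
    and dz_dzbar_commute: "w \<in> N \<Longrightarrow> dzbar (dz f) w = dz (dzbar f) w"
proof -
  obtain fz fb fm where r: "real_anal N fz" "real_anal N fb"
    and d: "\<forall>w\<in>N. has_wd f (fz w) (fb w) w \<and> (\<exists>a. has_wd fz a (fm w) w) \<and> (\<exists>b. has_wd fb (fm w) b w)"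
    using real_anal_derivatives[OF assms] by blast
  have eq: "fz w = dz f w" "fb w = dzbar f w" if "w \<in> N" for w
    using d that has_wd_dz has_wd_dzbar by metis+
  show "real_anal N (dz f)" "real_anal N (dzbar f)"
    using r eq real_anal.cong by blast+
  show "has_wd f (dz f w) (dzbar f w) w" if "w \<in> N" using d eq that by metis
  show "dzbar (dz f) w = dz (dzbar f) w" if w: "w \<in> N"
  proof -
    from d w obtain a b where "has_wd fz a (fm w) w" "has_wd fb (fm w) b w" by blast
    then have "has_wd (dz f) a (fm w) w" "has_wd (dzbar f) (fm w) b w"
      using has_wd_cong_open[OF _ N w] eq by metis+
    then show ?thesis using has_wd_dz has_wd_dzbar by metis
  qed
qed

lemma real_anal_twice_differentiable:
  assumes f: "real_anal N f" and N: "open N" and w: "w \<in> N"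
  shows "f differentiable (at w)" "dz f differentiable (at w)" "dzbar f differentiable (at w)"
  using assms real_anal_dz real_anal_dzbar has_wd_real_anal has_wd_differentiable by meson+

section \<open>Conjugation and linear maps on complex vectors\<close>

lemma vcnj_simps [simp]:
  "vcnj (x + y) = vcnj x + vcnj y" "vcnj (x - y) = vcnj x - vcnj y" "vcnj (- x) = - vcnj x"
  "vcnj (c *s x) = cnj c *s vcnj x" "vcnj (vcnj x) = x" "vcnj 0 = 0" "vcnj x $ i = cnj (x $ i)"
  by (auto simp: vcnj_def vec_eq_iff)

lemma vcnj_eq_iff: "vcnj x = y \<longleftrightarrow> x = vcnj y"
  by (metis vcnj_simps(5))

lemma in_vcnj_image_iff: "x \<in> vcnj ` S \<longleftrightarrow> vcnj x \<in> S"
  by (metis (no_types, lifting) imageE imageI vcnj_simps(5))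

lemma vec_expansion: "x = (\<Sum>i\<in>UNIV. x $ i *s axis i (1::complex))"
  by (simp add: vec_eq_iff axis_def if_distrib cong: if_cong)

lemma clinearI:
  "(\<And>x y. f (x + y) = f x + f y) \<Longrightarrow> (\<And>c x. f (c *s x) = c * f x) \<Longrightarrow> clinear f"
  by (intro Vector_Spaces.linear.intro vec.vector_space_axioms vector_space_over_itself.vector_space_axioms
      module_hom.intro module_hom_axioms.intro vec.module_axioms vector_space_over_itself.module_axioms)

lemma vlinearI:
  "(\<And>x y. f (x + y) = f x + f y) \<Longrightarrow> (\<And>c x. f (c *s x) = c *s f x) \<Longrightarrow> Vector_Spaces.linear (*s) (*s) (f :: complex ^ 'n \<Rightarrow> complex ^ 'm)"
  by (intro Vector_Spaces.linear.intro vec.vector_space_axioms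
      module_hom.intro module_hom_axioms.intro vec.module_axioms)

lemma clinear_expansion:
  assumes "clinear r"
  shows "r x = (\<Sum>i\<in>UNIV. x $ i * r (axis i 1))"
proof -
  interpret r: Vector_Spaces.linear "(*s)" "(*)" r by fact
  show ?thesis by (subst (1) vec_expansion) (simp add: r.sum r.scale)
qed

abbreviation vlinear :: "(complex ^ 'n \<Rightarrow> complex ^ 'n) \<Rightarrow> bool" where
  "vlinear f \<equiv> Vector_Spaces.linear (*s) (*s) f"

lemma vlinear_expansion:
  assumes "vlinear f"
  shows "f x = (\<Sum>i\<in>UNIV. x $ i *s f (axis i 1))"
proof -
  interpret r: Vector_Spaces.linear "(*s)" "(*s)" f by fact
  show ?thesis by (subst (1) vec_expansion) (simp add: r.sum r.scale)
qed

section \<open>Wirtinger calculus of vector functions\<close>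

definition has_wdv :: "(complex \<Rightarrow> complex ^ 'n::finite) \<Rightarrow> complex ^ 'n \<Rightarrow> complex ^ 'n \<Rightarrow> complex \<Rightarrow> bool" where
  "has_wdv f a b w \<longleftrightarrow> (\<forall>i. has_wd (\<lambda>w. f w $ i) (a $ i) (b $ i) w)"

definition real_analv :: "complex set \<Rightarrow> (complex \<Rightarrow> complex ^ 'n::finite) \<Rightarrow> bool" where
  "real_analv N f \<longleftrightarrow> (\<forall>i. real_anal N (\<lambda>w. f w $ i))"

definition dzv :: "(complex \<Rightarrow> complex ^ 'n::finite) \<Rightarrow> complex \<Rightarrow> complex ^ 'n" where
  "dzv f w = (\<chi> i. dz (\<lambda>w. f w $ i) w)"

definition dzbarv :: "(complex \<Rightarrow> complex ^ 'n::finite) \<Rightarrow> complex \<Rightarrow> complex ^ 'n" where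
  "dzbarv f w = (\<chi> i. dzbar (\<lambda>w. f w $ i) w)"

lemma has_wdv_unique:
  assumes "has_wdv f a b w" "has_wdv f a' b' w"
  shows "a = a'" "b = b'"
  using assms has_wd_unique[of "\<lambda>w. f w $ _"] unfolding has_wdv_def vec_eq_iff by metis+

lemma has_wdv_cong_open:
  assumes "has_wdv f a b w" "open N" "w \<in> N" "\<And>x. x \<in> N \<Longrightarrow> f x = g x"
  shows "has_wdv g a b w"
  unfolding has_wdv_def
proof
  fix i
  show "has_wd (\<lambda>w. g w $ i) (a $ i) (b $ i) w"
    using assms by (rule_tac has_wd_cong_open[of "\<lambda>w. f w $ i" _ _ w N]) (auto simp: has_wdv_def)
qed

lemma real_analv_dz:
  assumes f: "real_analv N f" and N: "open N"
  shows "real_analv N (dzv f)" "real_analv N (dzbarv f)"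
    and "w \<in> N \<Longrightarrow> has_wdv f (dzv f w) (dzbarv f w) w"
    and "w \<in> N \<Longrightarrow> dzbarv (dzv f) w = dzv (dzbarv f) w"
  using assms real_anal_dz[OF _ N] real_anal_dzbar[OF _ N] has_wd_real_anal[OF _ N] dz_dzbar_commute[OF _ N]
  by (auto simp: real_analv_def dzv_def dzbarv_def has_wdv_def)

lemma has_wdv_diff:
  "has_wdv f a b w \<Longrightarrow> has_wdv g a' b' w \<Longrightarrow> has_wdv (\<lambda>w. f w - g w) (a - a') (b - b') w"
  by (auto simp: has_wdv_def intro!: has_wd_diff)

lemma has_wdv_const: "has_wdv (\<lambda>w. c) 0 0 w"
  by (auto simp: has_wdv_def intro!: has_wd_const)

lemma has_wdv_vcnj: "has_wdv f a b w \<Longrightarrow> has_wdv (\<lambda>w. vcnj (f w)) (vcnj b) (vcnj a) w"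
  by (auto simp: has_wdv_def intro!: has_wd_cnj)

lemma has_wdv_scale:
  "has_wd f a b w \<Longrightarrow> has_wdv g a' b' w \<Longrightarrow> has_wdv (\<lambda>w. f w *s g w) (a *s g w + f w *s a') (b *s g w + f w *s b') w"
  by (auto simp: has_wdv_def intro!: has_wd_mult)

lemma has_wdv_sum:
  "(\<And>i. i \<in> S \<Longrightarrow> has_wdv (f i) (a i) (b i) w) \<Longrightarrow>
    has_wdv (\<lambda>w. \<Sum>i\<in>S. f i w) (\<Sum>i\<in>S. a i) (\<Sum>i\<in>S. b i) w"
  by (auto simp: has_wdv_def intro!: has_wd_sum)

lemma has_wd_clinear:
  assumes "clinear r" "has_wdv f a b w"
  shows "has_wd (\<lambda>w. r (f w)) (r a) (r b) w"
proof -
  have e: "(\<Sum>i\<in>UNIV. r (axis i 1) * v $ i) = r v" for v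
    using clinear_expansion[OF assms(1), of v] by (simp add: mult.commute)
  have "has_wd (\<lambda>w. \<Sum>i\<in>UNIV. r (axis i 1) * f w $ i) (\<Sum>i\<in>UNIV. r (axis i 1) * a $ i) (\<Sum>i\<in>UNIV. r (axis i 1) * b $ i) w"
    using assms(2) by (intro has_wd_sum has_wd_cmult) (auto simp: has_wdv_def)
  then show ?thesis unfolding e .
qed

lemma has_wdv_holomorphic:
  assumes "vholomorphic_on f N" "open N" "w \<in> N"
  shows "has_wdv f (vderiv f w) 0 w"
  using assms by (auto simp: has_wdv_def vderiv_def vholomorphic_on_def intro!: has_wd_holomorphic)

lemma real_analv_holomorphic: "vholomorphic_on f N \<Longrightarrow> real_analv N f"
  by (auto simp: real_analv_def vholomorphic_on_def intro!: real_anal.holo)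

lemma real_analv_subset: "real_analv N f \<Longrightarrow> M \<subseteq> N \<Longrightarrow> real_analv M f"
  by (auto simp: real_analv_def intro: real_anal_subset)

lemma real_analv_const: "real_analv N (\<lambda>w. c)"
  by (auto simp: real_analv_def intro!: real_anal_const)

lemma real_analv_add: "real_analv N f \<Longrightarrow> real_analv N g \<Longrightarrow> real_analv N (\<lambda>w. f w + g w)"
  by (auto simp: real_analv_def intro!: real_anal.add)

lemma real_analv_diff: "real_analv N f \<Longrightarrow> real_analv N g \<Longrightarrow> real_analv N (\<lambda>w. f w - g w)"
  by (auto simp: real_analv_def intro!: real_anal_diff)

lemma real_analv_vcnj: "real_analv N f \<Longrightarrow> real_analv N (\<lambda>w. vcnj (f w))"
  by (auto simp: real_analv_def intro!: real_anal.cnj)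

lemma real_analv_scale: "real_anal N f \<Longrightarrow> real_analv N g \<Longrightarrow> real_analv N (\<lambda>w. f w *s g w)"
  by (auto simp: real_analv_def intro!: real_anal.mult)

lemma real_analv_sum: "(\<And>i. i \<in> S \<Longrightarrow> real_analv N (f i)) \<Longrightarrow> real_analv N (\<lambda>w. \<Sum>i\<in>S. f i w)"
  by (auto simp: real_analv_def intro!: real_anal_sum)

lemma real_anal_clinear:
  assumes "clinear r" "real_analv N f"
  shows "real_anal N (\<lambda>w. r (f w))"
proof -
  have e: "(\<Sum>i\<in>UNIV. v $ i * r (axis i 1)) = r v" for v
    using clinear_expansion[OF assms(1), of v] by simp
  have "real_anal N (\<lambda>w. \<Sum>i\<in>UNIV. f w $ i * r (axis i 1))"
    using assms(2) by (intro real_anal_sum real_anal.mult real_anal_const) (auto simp: real_analv_def)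
  then show ?thesis unfolding e .
qed

text \<open>Expanding \<open>x w\<close> in the standard basis leaves finitely many products of
  functions of the class.\<close>

lemma real_analv_family_apply:
  assumes "\<And>w. w \<in> N \<Longrightarrow> vlinear (L w)" "\<And>v. real_analv N (\<lambda>w. L w v)" "real_analv N x"
  shows "real_analv N (\<lambda>w. L w (x w))"
proof -
  have "real_analv N (\<lambda>w. \<Sum>i\<in>UNIV. x w $ i *s L w (axis i 1))"
    using assms by (intro real_analv_sum real_analv_scale) (auto simp: real_analv_def)
  moreover have "(\<Sum>i\<in>UNIV. x w $ i *s L w (axis i 1)) = L w (x w)" if "w \<in> N" for w
    using vlinear_expansion[OF assms(1)[OF that]] by metis
  ultimately show ?thesis
    unfolding real_analv_def by (metis (mono_tags, lifting) real_anal.cong)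
qed

text \<open>The determinant is 1 at \<open>w0\<close>, hence nonzero nearby, and Cramer's rule
  writes the solution as a quotient of determinants, under which the class is stable. The radius
  depends only on \<open>L\<close>, so one ball serves all right-hand sides.\<close>

lemma real_analv_solve:
  fixes L :: "complex \<Rightarrow> complex ^ 'n::finite \<Rightarrow> complex ^ 'n"
  assumes N: "open N" "w0 \<in> N" and L: "\<And>w. w \<in> N \<Longrightarrow> vlinear (L w)" "\<And>v. real_analv N (\<lambda>w. L w v)"
    and id: "\<And>v. L w0 v = v"
  obtains r where "r > 0" "ball w0 r \<subseteq> N"
    "\<And>b. real_analv (ball w0 r) b \<Longrightarrow>
      \<exists>x. real_analv (ball w0 r) x \<and> (\<forall>w\<in>ball w0 r. L w (x w) = b w)"
proof -
  define T where "T w = (matrix (L w) :: complex ^ 'n ^ 'n)" for w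
  have T: "T w *v v = L w v" if "w \<in> N" for w v
    unfolding T_def using L(1)[OF that] by (simp add: matrix_works)
  have rT: "real_anal N (\<lambda>w. T w $ i $ j)" for i j :: 'n
    using L(2)[of "axis j 1"] by (simp add: T_def matrix_def real_analv_def)
  then have rd: "real_anal N (\<lambda>w. det (T w))" by (rule real_anal_det)
  have "T w0 = mat 1"
    by (simp add: matrix_eq T N id)
  then have "det (T w0) \<noteq> 0" by simp
  moreover have "continuous_on N (\<lambda>w. det (T w))" using real_anal_continuous[OF rd N(1)] .
  ultimately have "open {w \<in> N. det (T w) \<noteq> 0}" "w0 \<in> {w \<in> N. det (T w) \<noteq> 0}"
    using N continuous_open_preimage[of N "\<lambda>w. det (T w)" "- {0}"]
    by (auto simp: vimage_def Int_def Collect_conj_eq[symmetric])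
  then obtain r where r: "r > 0" "ball w0 r \<subseteq> {w \<in> N. det (T w) \<noteq> 0}"
    by (meson open_contains_ball)
  show ?thesis
  proof (rule that[OF r(1)])
    show sub: "ball w0 r \<subseteq> N" using r by auto
    fix b :: "complex \<Rightarrow> complex ^ 'n"
    assume b: "real_analv (ball w0 r) b"
    define x where "x w = (\<chi> k. det (\<chi> i j. if j = k then b w $ i else T w $ i $ j) / det (T w))" for w
    have "real_analv (ball w0 r) x"
      unfolding real_analv_def x_def
    proof (intro allI)
      fix k :: 'n
      have "real_anal (ball w0 r) (\<lambda>w. det (\<chi> i j. if j = k then b w $ i else T w $ i $ j) / det (T w))"
      proof (intro real_anal_divide real_anal_det)
        fix i j :: 'n
        show "real_anal (ball w0 r) (\<lambda>w. (\<chi> i j. if j = k then b w $ i else T w $ i $ j) $ i $ j)"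
          using b real_anal_subset[OF rT sub, of i j] by (cases "j = k") (auto simp: real_analv_def)
        show "real_anal (ball w0 r) (\<lambda>w. T w $ i $ j)" by (rule real_anal_subset[OF rT sub])
      qed (use r in auto)
      then show "real_anal (ball w0 r) (\<lambda>w. (\<chi> k. det (\<chi> i j. if j = k then b w $ i else T w $ i $ j) / det (T w)) $ k)"
        by simp
    qed
    moreover have "L w (x w) = b w" if w: "w \<in> ball w0 r" for w
    proof -
      have "det (T w) \<noteq> 0" "w \<in> N" using r w by auto
      then show ?thesis using cramer[of "T w" "x w" "b w"] T[of w "x w"] by (simp add: x_def)
    qed
    ultimately show "\<exists>x. real_analv (ball w0 r) x \<and> (\<forall>w\<in>ball w0 r. L w (x w) = b w)" by blast
  qed
qed

section \<open>Lattices of biextension type\<close>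

locale biext =
  fixes B :: "'n::finite biext_lattice"
  assumes lat: "biext_lattice B"
begin

lemma gr0_linear: "clinear (gr0 B)"
  using lat by (simp add: biext_lattice_def)

lemma gr0_add: "gr0 B (x + y) = gr0 B x + gr0 B y"
  and gr0_diff: "gr0 B (x - y) = gr0 B x - gr0 B y"
  and gr0_neg: "gr0 B (- x) = - gr0 B x"
  and gr0_zero [simp]: "gr0 B 0 = 0"
  and gr0_scale: "gr0 B (c *s x) = c * gr0 B x"
  and gr0_sum: "gr0 B (sum f S) = (\<Sum>i\<in>S. gr0 B (f i))"
proof -
  interpret gr0: Vector_Spaces.linear "(*s)" "(*)" "gr0 B"
    by (rule gr0_linear)
  show "gr0 B (x + y) = gr0 B x + gr0 B y" "gr0 B (x - y) = gr0 B x - gr0 B y" "gr0 B (- x) = - gr0 B x"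
    "gr0 B 0 = 0" "gr0 B (c *s x) = c * gr0 B x" "gr0 B (sum f S) = (\<Sum>i\<in>S. gr0 B (f i))"
    by (rule gr0.add gr0.diff gr0.neg gr0.zero gr0.scale gr0.sum)+
qed

lemma gr0_gen [simp]: "gr0 B (gen B) = 0"
  using lat by (simp add: biext_lattice_def)

lemma gen_VZ: "gen B \<in> VZ" 
proof -
  have "1 \<in> {c. c *s gen B \<in> VZ}" using lat by (simp add: biext_lattice_def)
  then show ?thesis by simp
qed

text \<open>Otherwise every scalar would carry \<open>gen B\<close> into the lattice, and
  \<open>\<i>\<close> would be an integer.\<close>

lemma gen_nonzero [simp]: "gen B \<noteq> 0"
proof
  assume "gen B = 0"
  then have "\<i> \<in> {c. c *s gen B \<in> VZ}" by (simp add: VZ_def)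
  also have "{c. c *s gen B \<in> VZ} = \<int>" using lat by (simp add: biext_lattice_def)
  finally show False by (metis imaginary_unit.simps(2) complex_Im_of_int Ints_cases zero_neq_one)
qed

lemma VZ_vcnj: "v \<in> VZ \<Longrightarrow> vcnj v = v"
  by (auto simp: VZ_def vec_eq_iff) (metis Ints_cases complex_cnj_of_int)

lemma vcnj_gen [simp]: "vcnj (gen B) = gen B"
  by (rule VZ_vcnj[OF gen_VZ])

lemma gr0_VZ: "v \<in> VZ \<Longrightarrow> gr0 B v \<in> \<int>"
  using lat by (auto simp: biext_lattice_def)

lemma VZ_axis: "axis i 1 \<in> VZ"
  by (auto simp: VZ_def axis_def)

lemma exists_unit: "\<exists>v. v \<in> VZ \<and> gr0 B v = 1"
proof -
  have "1 \<in> gr0 B ` VZ" using lat by (simp add: biext_lattice_def)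
  then show ?thesis by auto
qed

text \<open>The fixed integral lift v of 1. It serves as the integral lift in self-duality and
  splits the lattice over W_-1.\<close>

definition "unit_lift = (SOME v. v \<in> VZ \<and> gr0 B v = 1)"

lemma unit_lift: "unit_lift \<in> VZ" "gr0 B unit_lift = 1"
  using someI_ex[OF exists_unit] by (auto simp: unit_lift_def)

lemma cnj_Ints: "z \<in> \<int> \<Longrightarrow> cnj z = z"
  by (metis Ints_cases complex_cnj_of_int)

lemma gr0_vcnj [simp]: "gr0 B (vcnj x) = cnj (gr0 B x)"
proof -
  have "cnj (gr0 B (axis i 1)) = gr0 B (axis i 1)" for i
    by (rule cnj_Ints[OF gr0_VZ[OF VZ_axis]])
  then show ?thesis
    using clinear_expansion[OF gr0_linear, of x] clinear_expansion[OF gr0_linear, of "vcnj x"] by simp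
qed

lemma W_simps [simp]:
  "W B 0 = UNIV" "W B (-1) = {v. gr0 B v = 0}" "W B (-2) = range (\<lambda>c. c *s gen B)" 
  "k \<ge> 0 \<Longrightarrow> W B k = UNIV" "k \<le> -3 \<Longrightarrow> W B k = {0}"
  by (auto simp: W_def)

text \<open>The standard basis projected to W_-1 along \<open>unit_lift\<close>: integral
  generators, not a basis. A vector of W_-1 is expanded with its own standard coordinates, because
  the multiples of \<open>unit_lift\<close> add up to its image under \<open>gr0 B\<close>, which is
  0.\<close>

definition "wbase i = axis i 1 - gr0 B (axis i 1) *s unit_lift"

lemma wbase: "wbase i \<in> VZ" "gr0 B (wbase i) = 0"
  using gr0_VZ[OF VZ_axis, of i] unit_lift
  by (auto simp: wbase_def gr0_diff gr0_scale VZ_def axis_def intro!: Ints_diff Ints_mult)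

lemma wbase_expansion: "gr0 B x = 0 \<Longrightarrow> x = (\<Sum>i\<in>UNIV. x $ i *s wbase i)"
  using vec_expansion[of x] clinear_expansion[OF gr0_linear, of x]
  by (simp add: wbase_def vec.scale_right_diff_distrib sum_subtractf vec.scale_sum_left[symmetric])

text \<open>The values on the integral generators \<open>wbase i\<close> are integers, hence
  real.\<close>

lemma functional_vcnj:
  assumes r: "clinear r" "\<And>x. x \<in> VZ \<Longrightarrow> gr0 B x = 0 \<Longrightarrow> r x \<in> \<int>" and x: "gr0 B x = 0"
  shows "r (vcnj x) = cnj (r x)"
proof -
  interpret r: Vector_Spaces.linear "(*s)" "(*)" r by fact
  have "r x = (\<Sum>i\<in>UNIV. x $ i * r (wbase i))" "r (vcnj x) = (\<Sum>i\<in>UNIV. vcnj x $ i * r (wbase i))"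
    using wbase_expansion[of x] wbase_expansion[of "vcnj x"] x by (metis (no_types, lifting) r.sum r.scale sum.cong gr0_vcnj complex_cnj_zero)+
  moreover have "cnj (r (wbase i)) = r (wbase i)" for i
    by (intro cnj_Ints r wbase)
  ultimately show ?thesis by simp
qed

text \<open>The polarization extended to the whole space, which makes it bilinear without side conditions.\<close>

definition "qf x y = (\<Sum>i\<in>UNIV. \<Sum>j\<in>UNIV. x $ i * y $ j * pol B (wbase i) (wbase j))"

lemma qf_add: "qf (x + x') y = qf x y + qf x' y" "qf x (y + y') = qf x y + qf x y'"
  and qf_scale: "qf (c *s x) y = c * qf x y" "qf x (c *s y) = c * qf x y"
  by (simp_all add: qf_def algebra_simps sum.distrib sum_distrib_left)

lemma qf_diff: "qf (x - x') y = qf x y - qf x' y" "qf x (y - y') = qf x y - qf x y'"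
  by (metis qf_add add_diff_cancel diff_add_cancel)+

lemma pol_linear:
  assumes "gr0 B x = 0" "gr0 B y = 0" "gr0 B z = 0"
  shows "pol B (a *s x + b *s y) z = a * pol B x z + b * pol B y z"
    "pol B z (a *s x + b *s y) = a * pol B z x + b * pol B z y"
  using lat assms by (simp_all add: biext_lattice_def)

lemma pol_sum:
  assumes "\<And>i. i \<in> S \<Longrightarrow> gr0 B (f i) = 0" "gr0 B z = 0"
  shows "pol B (\<Sum>i\<in>S. c i *s f i) z = (\<Sum>i\<in>S. c i * pol B (f i) z)"
    "pol B z (\<Sum>i\<in>S. c i *s f i) = (\<Sum>i\<in>S. c i * pol B z (f i))"
proof -
  have z: "pol B 0 z = 0" "pol B z 0 = 0"
    using pol_linear[of z z z 0 0] assms(2) by simp_all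
  have "gr0 B (\<Sum>i\<in>S. c i *s f i) = 0"
    using assms(1) by (simp add: gr0_sum gr0_scale)
  moreover have "pol B (\<Sum>i\<in>S. c i *s f i) z = (\<Sum>i\<in>S. c i * pol B (f i) z) \<and>
    pol B z (\<Sum>i\<in>S. c i *s f i) = (\<Sum>i\<in>S. c i * pol B z (f i))"
    using assms
  proof (induction S rule: infinite_finite_induct)
    case (insert x F)
    have "gr0 B (\<Sum>i\<in>F. c i *s f i) = 0"
      using insert.prems by (simp add: gr0_sum gr0_scale)
    then show ?case
      using insert pol_linear[of "f x" "\<Sum>i\<in>F. c i *s f i" z "c x" 1] by simp
  qed (auto simp: z)
  ultimately show "pol B (\<Sum>i\<in>S. c i *s f i) z = (\<Sum>i\<in>S. c i * pol B (f i) z)"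
    "pol B z (\<Sum>i\<in>S. c i *s f i) = (\<Sum>i\<in>S. c i * pol B z (f i))" by auto
qed

lemma pol_eq_qf:
  assumes "gr0 B x = 0" "gr0 B y = 0"
  shows "pol B x y = qf x y"
proof -
  have y: "pol B (wbase i) y = (\<Sum>j\<in>UNIV. y $ j * pol B (wbase i) (wbase j))" for i
    using pol_sum(2)[of UNIV wbase "wbase i" "\<lambda>j. y $ j"] wbase_expansion[OF assms(2)] by (simp add: wbase)
  have "pol B x y = (\<Sum>i\<in>UNIV. x $ i * pol B (wbase i) y)"
    using pol_sum(1)[of UNIV wbase y "\<lambda>j. x $ j"] wbase_expansion[OF assms(1)] assms by (simp add: wbase)
  then show ?thesis by (simp add: y qf_def sum_distrib_left mult.assoc)
qed

lemma qf_vcnj: "qf (vcnj x) (vcnj y) = cnj (qf x y)"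
proof -
  have "pol B (wbase i) (wbase j) \<in> \<int>" for i j
    using lat wbase by (auto simp: biext_lattice_def)
  from cnj_Ints[OF this] show ?thesis by (simp add: qf_def)
qed

lemma qf_self: "gr0 B x = 0 \<Longrightarrow> qf x x = 0" and qf_gen: "gr0 B x = 0 \<Longrightarrow> qf (gen B) x = 0"
  using lat by (auto simp: biext_lattice_def simp flip: pol_eq_qf)

lemma qf_swap:
  assumes "gr0 B x = 0" "gr0 B y = 0"
  shows "qf x y = - qf y x"
  using qf_self[of "x + y"] assms
  by (simp add: qf_add gr0_add qf_self add_eq_0_iff)

lemma qf_gen_right: "gr0 B x = 0 \<Longrightarrow> qf x (gen B) = 0"
  using qf_swap[of x "gen B"] qf_gen[of x] by simp

lemma has_wd_qf:
  assumes f: "has_wdv f a b w" and g: "has_wdv g a' b' w"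
  shows "has_wd (\<lambda>w. qf (f w) (g w)) (qf a (g w) + qf (f w) a') (qf b (g w) + qf (f w) b') w"
proof -
  let ?c = "\<lambda>i j. pol B (wbase i) (wbase j)"
  have qf: "qf x y = (\<Sum>i\<in>UNIV. \<Sum>j\<in>UNIV. ?c i j * (x $ i * y $ j))" for x y
    by (simp add: qf_def mult.commute)
  have "has_wd (\<lambda>w. ?c i j * (f w $ i * g w $ j)) (?c i j * (a $ i * g w $ j + f w $ i * a' $ j))
     (?c i j * (b $ i * g w $ j + f w $ i * b' $ j)) w" for i j
    using f g by (intro has_wd_cmult has_wd_mult) (auto simp: has_wdv_def)
  then have "has_wd (\<lambda>w. qf (f w) (g w))
    (\<Sum>i\<in>UNIV. \<Sum>j\<in>UNIV. ?c i j * (a $ i * g w $ j + f w $ i * a' $ j))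
    (\<Sum>i\<in>UNIV. \<Sum>j\<in>UNIV. ?c i j * (b $ i * g w $ j + f w $ i * b' $ j)) w"
    unfolding qf by (intro has_wd_sum)
  then show ?thesis
    by (simp add: qf distrib_left sum.distrib)
qed

lemma real_anal_qf: "real_analv N f \<Longrightarrow> real_analv N g \<Longrightarrow> real_anal N (\<lambda>w. qf (f w) (g w))"
  unfolding qf_def by (intro real_anal_sum real_anal.mult real_anal_const) (auto simp: real_analv_def)

end

section \<open>Bigradings\<close>

abbreviation bspan :: "'n::finite bigrading \<Rightarrow> (int \<Rightarrow> int \<Rightarrow> bool) \<Rightarrow> (complex ^ 'n) set" where
  "bspan I P \<equiv> vec.span (\<Union>{I a b | a b. P a b})"

lemma bspan_base: "P a b \<Longrightarrow> x \<in> I a b \<Longrightarrow> x \<in> bspan I P"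
  by (rule vec.span_base) blast

lemma bspan_subset:
  assumes "\<And>a b x. P a b \<Longrightarrow> x \<in> I a b \<Longrightarrow> x \<in> S" "vec.subspace S"
  shows "bspan I P \<subseteq> S"
  by (rule vec.span_minimal) (use assms in auto)

lemma bspan_mono: "(\<And>a b. P a b \<Longrightarrow> P' a b) \<Longrightarrow> bspan I P \<subseteq> bspan I P'"
  by (rule vec.span_mono) blast

lemma bigr_decomposes_superset:
  assumes "bigr_decomposes I c v" "finite S" "{z. c z \<noteq> 0} \<subseteq> S"
  shows "v = (\<Sum>z\<in>S. c z)"
  using assms by (auto simp: bigr_decomposes_def intro!: sum.mono_neutral_left)

lemma bigr_decomposesI:
  assumes "\<And>p q. c (p, q) \<in> I p q" "finite S" "{z. c z \<noteq> 0} \<subseteq> S" "v = (\<Sum>z\<in>S. c z)"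
  shows "bigr_decomposes I c v"
  using assms finite_subset[OF assms(3,2)]
  by (auto simp: bigr_decomposes_def intro!: sum.mono_neutral_right)

lemma bigr_decomposes_add:
  assumes "\<And>p q. vec.subspace (I p q)" "bigr_decomposes I c v" "bigr_decomposes I c' v'"
  shows "bigr_decomposes I (\<lambda>z. c z + c' z) (v + v')"
proof -
  let ?S = "{z. c z \<noteq> 0} \<union> {z. c' z \<noteq> 0}"
  have S: "finite ?S" using assms(2,3) by (auto simp: bigr_decomposes_def)
  show ?thesis
  proof (rule bigr_decomposesI[OF _ S])
    show "v + v' = (\<Sum>z\<in>?S. c z + c' z)"
      using bigr_decomposes_superset[OF assms(2) S] bigr_decomposes_superset[OF assms(3) S]
      by (simp add: sum.distrib)
  qed (use assms in \<open>auto simp: bigr_decomposes_def intro!: vec.subspace_add\<close>)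
qed

lemma bigr_decomposes_scale:
  assumes "\<And>p q. vec.subspace (I p q)" "bigr_decomposes I c v"
  shows "bigr_decomposes I (\<lambda>z. k *s c z) (k *s v)"
proof -
  let ?S = "{z. c z \<noteq> 0}"
  have S: "finite ?S" using assms(2) by (auto simp: bigr_decomposes_def)
  show ?thesis
    by (rule bigr_decomposesI[OF _ S])
      (use assms in \<open>auto simp: bigr_decomposes_def vec.scale_sum_right intro!: vec.subspace_scale\<close>)
qed

lemma bigr_decomposes_single:
  assumes "\<And>p q. vec.subspace (I p q)" "x \<in> I p q"
  shows "bigr_decomposes I (\<lambda>z. if z = (p, q) then x else 0) x"
  by (rule bigr_decomposesI[of _ _ "{(p, q)}"]) (use assms in \<open>auto intro: vec.subspace_0\<close>)

lemma bspan_decomposes: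
  assumes I: "\<And>p q. vec.subspace (I p q)" and v: "v \<in> bspan I P"
  shows "\<exists>c. bigr_decomposes I c v \<and> (\<forall>a b. \<not> P a b \<longrightarrow> c (a, b) = 0)"
  using v
proof (induction rule: vec.span_induct_alt)
  case base
  show ?case
    by (rule exI[of _ "\<lambda>_. 0"]) (use I in \<open>auto simp: bigr_decomposes_def intro: vec.subspace_0\<close>)
next
  case (step k x y)
  then obtain a b c where x: "x \<in> I a b" "P a b" and c: "bigr_decomposes I c y" "\<forall>a b. \<not> P a b \<longrightarrow> c (a, b) = 0"
    by blast
  show ?case
    by (intro exI conjI, rule bigr_decomposes_add[OF I bigr_decomposes_scale[OF I bigr_decomposes_single[of I x a b, OF I x(1)], of k] c(1)])
      (use x c in auto)
qed

lemma decomposes_unique: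
  assumes I: "\<And>p q. vec.subspace (I p q)"
    and *: "bspan I (\<lambda>_ _. True) = UNIV" "\<And>c. bigr_decomposes I c 0 \<Longrightarrow> c = (\<lambda>_. 0)"
  shows "\<forall>v. \<exists>!c. bigr_decomposes I c v"
proof
  fix v
  have "v \<in> bspan I (\<lambda>_ _. True)" using * by simp
  then obtain c where c: "bigr_decomposes I c v" using bspan_decomposes[of I v "\<lambda>_ _. True", OF I] by blast
  show "\<exists>!c. bigr_decomposes I c v"
  proof (rule ex1I, rule c)
    fix c' assume "bigr_decomposes I c' v"
    from bigr_decomposes_add[OF I this bigr_decomposes_scale[OF I c, of "-1"]] *
    have "(\<lambda>z. c' z + - 1 *s c z) = (\<lambda>_. 0)" by simp
    then have "c' z + - 1 *s c z = 0" for z by (rule fun_cong)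
    then show "c' = c" by auto
  qed
qed

lemma hproj_eq:
  assumes "\<forall>v. \<exists>!c. bigr_decomposes I c v" "bigr_decomposes I c v"
  shows "hproj I p q v = c (p, q)"
  using assms by (metis hproj_def the1_equality)

lemma hproj_add:
  assumes "\<And>p q. vec.subspace (I p q)" "\<forall>v. \<exists>!c. bigr_decomposes I c v"
  shows "hproj I p q (x + y) = hproj I p q x + hproj I p q y"
proof -
  obtain c d where cd: "bigr_decomposes I c x" "bigr_decomposes I d y"
    using assms(2)[THEN spec, of x] assms(2)[THEN spec, of y] by blast
  show ?thesis
    unfolding hproj_eq[OF assms(2) bigr_decomposes_add[OF assms(1) cd]]
      hproj_eq[OF assms(2) cd(1)] hproj_eq[OF assms(2) cd(2)] ..
qed

lemma hproj_bspan_zero: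
  assumes "\<And>p q. vec.subspace (I p q)" "\<forall>v. \<exists>!c. bigr_decomposes I c v" "x \<in> bspan I P" "\<not> P p q"
  shows "hproj I p q x = 0"
proof -
  obtain c where "bigr_decomposes I c x" "c (p, q) = 0"
    using bspan_decomposes[of I x P, OF assms(1,3)] assms(4) by blast
  then show ?thesis using hproj_eq[OF assms(2)] by simp
qed

lemma hproj_single:
  assumes "\<And>p q. vec.subspace (I p q)" "\<forall>v. \<exists>!c. bigr_decomposes I c v" "x \<in> I p q"
  shows "hproj I p' q' x = (if p' = p \<and> q' = q then x else 0)"
  using hproj_eq[OF assms(2) bigr_decomposes_single[of I, OF assms(1,3)]] by auto

section \<open>The Deligne bigrading of a biextension\<close>

context biext begin

text \<open>
  As \<open>I\<^sup>0\<^sup>,\<^sup>0 = F\<^sup>0 \<inter> (cnj F\<^sup>0 + W\<^sub>-\<^sub>2)\<close>, this is the generator of \<open>I\<^sup>0\<^sup>,\<^sup>0\<close> over \<open>1\<close>.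
\<close>

definition hlift :: "'n filtration \<Rightarrow> complex ^ 'n" where
  "hlift F = (THE e. e \<in> F 0 \<and> gr0 B e = 1 \<and> (\<exists>c. e - vcnj e = c *s gen B))"

text \<open>Subtracting \<open>\<i> * d\<close> times \<open>gen B\<close> from the lift makes it
  real exactly when \<open>d\<close> is this number; the factor \<open>2 * \<i>\<close> is chosen
  for that.\<close>

definition hdelta :: "'n filtration \<Rightarrow> real" where
  "hdelta F = (THE d. hlift F - vcnj (hlift F) = (2 * \<i> * of_real d) *s gen B)"

text \<open>Deligne's formula for the bigrading, specialised to biextension type. Its correction
  terms lie at least two weights lower, so they vanish in weight -1, and in weight 0 they only
  contribute W_-2, which is already built into \<open>hlift\<close>.\<close>

definition ibig :: "'n filtration \<Rightarrow> 'n bigrading" where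
  "ibig F p q =
     (if p = 0 \<and> q = 0 then range (\<lambda>c. c *s hlift F)
      else if p = -1 \<and> q = -1 then range (\<lambda>c. c *s gen B)
      else if p + q = -1 then {x \<in> F p. gr0 B x = 0 \<and> vcnj x \<in> F q}
      else {0})"

end

section \<open>Opposedness and the Hodge lift of a single biextension\<close>

locale biext_hodge = biext B for B :: "'n::finite biext_lattice" +
  fixes F :: "'n filtration"
  assumes hodge: "biext_mhs B F"
begin

lemma subspace_F: "vec.subspace (F p)"
  using hodge by (simp add: biext_mhs_def mhs_def)

lemma F_mono: "p \<le> q \<Longrightarrow> x \<in> F q \<Longrightarrow> x \<in> F p"
  using hodge by (auto simp: biext_mhs_def mhs_def monotone_def)

lemma F_bounds: "\<exists>p. F p = UNIV" "\<exists>p. F p = {0}"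
  using hodge by (auto simp: biext_mhs_def mhs_def)

lemmas F_closed = vec.subspace_add[OF subspace_F] vec.subspace_diff[OF subspace_F]
  vec.subspace_scale[OF subspace_F] vec.subspace_neg[OF subspace_F]

lemma F0_onto: "\<exists>x \<in> F 0. gr0 B x = 1"
proof -
  have "gr_filt (W B) F 0 0 = UNIV" using hodge by (simp add: biext_mhs_def)
  then have "unit_lift \<in> gr_filt (W B) F 0 0" by simp
  then show ?thesis
    using unit_lift by (auto simp: gr_filt_def set_plus_def gr0_add)
qed

lemma F1_ker: "x \<in> F 1 \<Longrightarrow> gr0 B x = 0"
proof -
  assume x: "x \<in> F 1"
  have "gr_filt (W B) F 0 1 = {v. gr0 B v = 0}" using hodge by (simp add: biext_mhs_def)
  moreover have "x + 0 \<in> gr_filt (W B) F 0 1"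
    unfolding gr_filt_def by (rule set_plus_intro) (use x in auto)
  ultimately show ?thesis by simp
qed

lemma gen_F: "p \<le> -1 \<Longrightarrow> c *s gen B \<in> F p"
proof -
  assume p: "p \<le> -1"
  have "gr_filt (W B) F (-2) (-1) = range (\<lambda>c. c *s gen B)" using hodge by (simp add: biext_mhs_def)
  then have "c *s gen B \<in> gr_filt (W B) F (-2) (-1)" by blast
  then have "c *s gen B \<in> F (-1)" by (auto simp: gr_filt_def)
  then show ?thesis using F_mono[OF p] by simp
qed

lemma gen_F0: "0 \<le> p \<Longrightarrow> c *s gen B \<in> F p \<Longrightarrow> c = 0"
proof -
  assume p: "0 \<le> p" "c *s gen B \<in> F p"
  have "gr_filt (W B) F (-2) 0 = {0}" using hodge by (simp add: biext_mhs_def)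
  moreover have "c *s gen B + 0 \<in> gr_filt (W B) F (-2) 0"
    unfolding gr_filt_def by (rule set_plus_intro) (use F_mono[OF p] in auto)
  ultimately show ?thesis by simp
qed

lemma gr_filt_1: "gr_filt (W B) F (-1) p = {a + c *s gen B | a c. a \<in> F p \<and> gr0 B a = 0}"
  by (auto simp: gr_filt_def set_plus_def)

lemma in_gr_filt_1: "x \<in> F p \<Longrightarrow> gr0 B x = 0 \<Longrightarrow> x \<in> gr_filt (W B) F (-1) p"
  unfolding gr_filt_1 by (rule CollectI, rule exI[of _ x], rule exI[of _ 0]) simp

lemma opposed_sum:
  assumes "gr0 B x = 0"
  obtains a b c where "a \<in> F p" "gr0 B a = 0" "b \<in> F (-p)" "gr0 B b = 0" "x = a + vcnj b + c *s gen B"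
proof -
  have "gr_filt (W B) F (-1) p + vcnj ` gr_filt (W B) F (-1) (-1 + 1 - p) = W B (-1)"
    using hodge unfolding biext_mhs_def mhs_def by blast
  then have "x \<in> gr_filt (W B) F (-1) p + vcnj ` gr_filt (W B) F (-1) (- p)" using assms by simp
  then obtain a c b d where "x = (a + c *s gen B) + vcnj (b + d *s gen B)"
    "a \<in> F p" "gr0 B a = 0" "b \<in> F (-p)" "gr0 B b = 0"
    unfolding gr_filt_1 set_plus_def by blast
  then show ?thesis
    by (intro that[of a b "c + cnj d"]) (auto simp: vec.scale_left_distrib)
qed

lemma opposed_inter:
  assumes "a \<in> F p" "gr0 B a = 0" "b \<in> F (-p)" "gr0 B b = 0" "a - vcnj b = c *s gen B"
  shows "\<exists>k. a = k *s gen B"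
proof -
  have eq: "gr_filt (W B) F (-1) p \<inter> vcnj ` gr_filt (W B) F (-1) (-1 + 1 - p) = W B (-1 - 1)"
    using hodge unfolding biext_mhs_def mhs_def by blast
  have "vcnj a = b + cnj c *s gen B"
    using arg_cong[OF assms(5), of vcnj] by (simp add: algebra_simps)
  then have "vcnj a \<in> gr_filt (W B) F (-1) (-1 + 1 - p)"
    using assms unfolding gr_filt_1 by auto
  moreover have "a \<in> gr_filt (W B) F (-1) p"
    using assms by (intro in_gr_filt_1)
  ultimately have "a \<in> W B (-1 - 1)"
    unfolding eq[symmetric] by (simp add: in_vcnj_image_iff)
  then show ?thesis by auto
qed

text \<open>On gr_-1, F^0 meets its conjugate only in 0, so \<open>a\<close> is a multiple of
  \<open>gen B\<close>; but F^0 contains no nonzero such multiple, gr_-2 being of type (-1,-1). This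
  is the source of the uniqueness statements below.\<close>

lemma opposed_zero:
  assumes "a \<in> F 0" "gr0 B a = 0" "b \<in> F 0" "gr0 B b = 0" "a - vcnj b = c *s gen B"
  shows "a = 0"
  using opposed_inter[of a 0 b c] assms gen_F0[of 0] by auto

text \<open>The second bilinear relation for the type (-1,0), where the Weil factor is
  \<open>\<i> powi (-1)\<close>, that is \<open>- \<i>\<close>. The relation excludes W_-2, but
  there \<open>x\<close> vanishes because its conjugate lies in F^0.\<close>

lemma qf_positive:
  assumes "x \<in> F (-1)" "gr0 B x = 0" "vcnj x \<in> F 0"
  shows "- \<i> * qf x (vcnj x) \<in> \<real>\<^sub>\<ge>\<^sub>0"
proof (cases "\<exists>k. x = k *s gen B")
  case True
  then obtain k where k: "x = k *s gen B" by blast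
  then have "cnj k = 0" using gen_F0[of 0 "cnj k"] assms(3) by simp
  then show ?thesis using k by (simp add: qf_def)
next
  case False
  have "x \<in> gr_filt (W B) F (-1) (-1)" "vcnj x \<in> gr_filt (W B) F (-1) 0"
    using assms by (auto intro: in_gr_filt_1)
  then have "x \<in> gr_filt (W B) F (-1) (-1) \<inter> vcnj ` gr_filt (W B) F (-1) 0"
    by (simp add: in_vcnj_image_iff)
  moreover have "x \<notin> W B (-2)" using False by auto
  ultimately have "\<i> powi (-1 - 0) * pol B x (vcnj x) \<in> \<real> \<and> 0 < Re (\<i> powi (-1 - 0) * pol B x (vcnj x))"
    using hodge unfolding biext_mhs_def polarized_def by (metis add_0_right)
  then show ?thesis
    using assms by (simp add: pol_eq_qf power_int_minus complex_nonneg_Reals_iff complex_is_Real_iff)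
qed

text \<open>Any lift \<open>v\<close> in F^0 is corrected by the F^0-part of
  \<open>v - vcnj v\<close>; two corrected lifts differ by an element to which
  \<open>opposed_zero\<close> applies.\<close>

lemma hlift_ex1: "\<exists>!e. e \<in> F 0 \<and> gr0 B e = 1 \<and> (\<exists>c. e - vcnj e = c *s gen B)"
proof -
  obtain v where v: "v \<in> F 0" "gr0 B v = 1" using F0_onto by blast
  then have "gr0 B (v - vcnj v) = 0" by (simp add: gr0_diff)
  from opposed_sum[OF this, of 0] obtain a b c where ab: "a \<in> F 0" "gr0 B a = 0" "b \<in> F 0" "gr0 B b = 0"
    and eq: "v - vcnj v = a + vcnj b + c *s gen B" by auto
  have "vcnj v - v = vcnj a + b + cnj c *s gen B"
    using arg_cong[OF eq, of vcnj] by simp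
  then have 1: "b + vcnj a = vcnj v - v - cnj c *s gen B" by (simp add: algebra_simps)
  have 2: "a + vcnj b = v - vcnj v - c *s gen B" using eq by simp
  \<comment> \<open>Conjugation negates \<open>v - vcnj v\<close>. Adding its decomposition to the
    conjugate one shows that \<open>a + b\<close> equals minus its own conjugate modulo
    \<open>gen B\<close>, which forces \<open>b = - a\<close>.\<close>
  have "(a + b) - vcnj (- (a + b)) = (a + vcnj b) + (b + vcnj a)" by simp
  also have "\<dots> = (- c - cnj c) *s gen B"
    unfolding 1 2 by (simp add: vec.scale_left_diff_distrib)
  finally have "(a + b) - vcnj (- (a + b)) = (- c - cnj c) *s gen B" .
  from opposed_zero[OF _ _ _ _ this] have "a + b = 0"
    using ab by (simp add: F_closed gr0_add gr0_neg gr0_diff)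
  then have b: "b = - a" by (simp add: add_eq_0_iff)
  let ?e = "v - a"
  have e: "?e \<in> F 0" "gr0 B ?e = 1" using v ab by (auto simp: F_closed gr0_diff)
  have e': "?e - vcnj ?e = c *s gen B"
    using eq by (simp add: b algebra_simps)
  show ?thesis
  proof (rule ex1I[of _ ?e])
    show "?e \<in> F 0 \<and> gr0 B ?e = 1 \<and> (\<exists>c. ?e - vcnj ?e = c *s gen B)" using e e' by blast
    fix e2 assume e2: "e2 \<in> F 0 \<and> gr0 B e2 = 1 \<and> (\<exists>c. e2 - vcnj e2 = c *s gen B)"
    then obtain c2 where c2: "e2 - vcnj e2 = c2 *s gen B" by blast
    have "(e2 - ?e) - vcnj (e2 - ?e) = (c2 - c) *s gen B"
      using c2 e' by (simp add: algebra_simps vec_eq_iff)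
    from opposed_zero[OF _ _ _ _ this] e e2 have "e2 - ?e = 0" by (simp add: F_closed gr0_diff)
    then show "e2 = ?e" by simp
  qed
qed

lemma hlift: "hlift F \<in> F 0" "gr0 B (hlift F) = 1" "\<exists>c. hlift F - vcnj (hlift F) = c *s gen B"
  using theI'[OF hlift_ex1] by (auto simp: hlift_def)

lemma hlift_eqI: "e \<in> F 0 \<Longrightarrow> gr0 B e = 1 \<Longrightarrow> e - vcnj e = c *s gen B \<Longrightarrow> hlift F = e"
  unfolding hlift_def using hlift_ex1 by (intro the1_equality) auto

text \<open>Conjugation negates the left side and fixes \<open>gen B\<close>, so the coefficient is
  purely imaginary.\<close>

lemma hdelta: "hlift F - vcnj (hlift F) = (2 * \<i> * of_real (hdelta F)) *s gen B"
proof -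
  obtain c where c: "hlift F - vcnj (hlift F) = c *s gen B" using hlift(3) by blast
  have "vcnj (hlift F) - hlift F = cnj c *s gen B"
    using arg_cong[OF c, of vcnj] by simp
  then have "(c + cnj c) *s gen B = 0"
    using c by (simp add: vec.scale_left_distrib) (metis add.right_inverse minus_diff_eq)
  then have "c + cnj c = 0" unfolding vec.scale_eq_0_iff by simp
  then have "Re c = 0" by (simp add: complex_add_cnj)
  then have c': "c = 2 * \<i> * of_real (Im c / 2)" by (simp add: complex_eq_iff)
  show ?thesis
    unfolding hdelta_def
  proof (rule theI[of _ "Im c / 2"])
    show "hlift F - vcnj (hlift F) = (2 * \<i> * complex_of_real (Im c / 2)) *s gen B" using c c' by metis
    fix d :: real assume "hlift F - vcnj (hlift F) = (2 * \<i> * complex_of_real d) *s gen B"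
    then have "(2 * \<i> * complex_of_real d) *s gen B = c *s gen B" using c by simp
    then have "2 * \<i> * complex_of_real d = c" by (simp add: vec.scale_cancel_right)
    then show "d = Im c / 2" by auto
  qed
qed

lemma hdelta_eqI:
  assumes "hlift F - vcnj (hlift F) = (2 * \<i> * of_real d) *s gen B"
  shows "hdelta F = d"
proof -
  have "(2 * \<i> * of_real d) *s gen B = (2 * \<i> * of_real (hdelta F)) *s gen B"
    by (rule trans[OF assms[symmetric] hdelta])
  then show ?thesis unfolding vec.scale_cancel_right by simp
qed

lemma vcnj_hlift: "vcnj (hlift F) = hlift F + (- 2 * \<i> * of_real (hdelta F)) *s gen B"
proof -
  have "vcnj (hlift F) = hlift F - (hlift F - vcnj (hlift F))" by simp
  also have "\<dots> = hlift F - (2 * \<i> * of_real (hdelta F)) *s gen B" by (rule arg_cong[OF hdelta])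
  finally show ?thesis by simp
qed

end

section \<open>The explicit bigrading is the Deligne bigrading\<close>

lemma scale_in_range [simp]: "c *s v \<in> range (\<lambda>c. c *s v)"
  by blast

context biext_hodge begin

lemma ibig_simps:
  "ibig F 0 0 = range (\<lambda>c. c *s hlift F)"
  "ibig F (-1) (-1) = range (\<lambda>c. c *s gen B)"
  "p + q = -1 \<Longrightarrow> ibig F p q = {x \<in> F p. gr0 B x = 0 \<and> vcnj x \<in> F q}"
  by (auto simp: ibig_def)

lemma ibig_cases:
  assumes "x \<in> ibig F p q"
  obtains "x = 0" | c where "p = 0" "q = 0" "x = c *s hlift F" | c where "p = -1" "q = -1" "x = c *s gen B"
    | "p + q = -1" "x \<in> F p" "gr0 B x = 0" "vcnj x \<in> F q"
  using assms by (auto simp: ibig_def split: if_splits)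

lemma ibig_subspace: "vec.subspace (ibig F p q)"
proof (cases "p + q = -1")
  case True
  then show ?thesis
    using subspace_F[of p] subspace_F[of q]
    by (simp add: ibig_simps vec.subspace_def gr0_add gr0_scale)
next
  case False
  have "vec.subspace (range (\<lambda>c. c *s v))" for v :: "complex ^ 'n"
    unfolding vec.span_singleton[symmetric] by (rule vec.subspace_span)
  moreover have "vec.subspace {0 :: complex ^ 'n}" by (rule vec.subspace_single_0)
  ultimately show ?thesis using False by (simp add: ibig_def)
qed

lemma ibig_F:
  assumes "x \<in> ibig F p q"
  shows "x \<in> F p"
  using assms
proof (cases rule: ibig_cases)
  case 1
  then show ?thesis using vec.subspace_0[OF subspace_F] by simp
next
  case (2 c)
  then show ?thesis using hlift(1) by (simp add: F_closed)
next
  case (3 c)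
  then show ?thesis using gen_F[of "-1" c] by simp
qed

lemma ibig_gr0:
  assumes "x \<in> ibig F p q" "p + q \<le> -1"
  shows "gr0 B x = 0"
  using assms by (cases rule: ibig_cases) (auto simp: gr0_scale)

text \<open>Descending induction on the Hodge level, starting where the filtration vanishes.
  Opposedness at level p + 1 splits \<open>x\<close> into a part in F^(p+1), a conjugate of an
  element of F^(-1-p), and a multiple of \<open>gen B\<close>; the middle part is essentially the
  component of type (p, -1-p).\<close>

lemma F_ker_bspan:
  assumes "x \<in> F p" "gr0 B x = 0"
  shows "x \<in> bspan (ibig F) (\<lambda>a b. p \<le> a \<and> a + b \<le> -1)"
proof -
  obtain p0 where p0: "F p0 = {0}" using F_bounds by blast
  have "\<forall>x. x \<in> F p \<longrightarrow> gr0 B x = 0 \<longrightarrow> x \<in> bspan (ibig F) (\<lambda>a b. p \<le> a \<and> a + b \<le> -1)" if "p \<le> p0" for p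
    using that
  proof (induction p rule: int_le_induct)
    case base
    show ?case using p0 by (auto intro: vec.span_zero)
  next
    case (step q)
    define p where "p = q - 1"
    have q: "q = p + 1" by (simp add: p_def)
    let ?S = "bspan (ibig F) (\<lambda>a b. p \<le> a \<and> a + b \<le> -1)"
    have mono: "bspan (ibig F) (\<lambda>a b. q \<le> a \<and> a + b \<le> -1) \<subseteq> ?S"
      by (rule bspan_mono) (simp add: q)
    show ?case
      unfolding p_def[symmetric]
    proof (intro allI impI)
      fix x assume x: "x \<in> F p" "gr0 B x = 0"
      obtain a b c where a: "a \<in> F q" "gr0 B a = 0" and b: "b \<in> F (-q)" "gr0 B b = 0"
        and eq: "x = a + vcnj b + c *s gen B" using opposed_sum[OF x(2), of q] by metis
      have "a \<in> ?S" using step.IH a mono by auto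
      have aF: "a \<in> F p" using F_mono[of p q a] a by (simp add: q)
      have nq: "- q = -1 - p" by (simp add: q)
      show "x \<in> ?S"
      \<comment> \<open>The multiple of \<open>gen B\<close> goes where the filtration allows it:
        for p \<ge> 0 the conjugate level -1-p is negative and absorbs it, for p < 0 it lies in F^p
        and is split off as the component of type (-1,-1).\<close>
      proof (cases "p \<ge> 0")
        case True
        have "x - a = vcnj b + c *s gen B" using eq by simp
        moreover have "vcnj (x - a) \<in> F (-1 - p)"
          unfolding calculation using b gen_F[of "-1 - p" "cnj c"] True nq by (simp add: F_closed)
        moreover have "x - a \<in> F p" "gr0 B (x - a) = 0" using x a aF by (auto simp: F_closed gr0_diff)
        ultimately have "x - a \<in> ibig F p (-1 - p)" by (simp add: ibig_simps)
        then have "x - a \<in> ?S" by (rule bspan_base[rotated]) simp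
        then have "(x - a) + a \<in> ?S" using \<open>a \<in> ?S\<close> by (rule vec.span_add)
        then show ?thesis by simp
      next
        case False
        then have g: "c *s gen B \<in> F p" by (intro gen_F) simp
        have "x - a - c *s gen B = vcnj b" using eq by simp
        moreover have "x - a - c *s gen B \<in> F p" using x aF g by (simp add: F_closed)
        ultimately have "vcnj b \<in> ibig F p (-1 - p)" using b nq by (simp add: ibig_simps)
        then have "vcnj b \<in> ?S" by (rule bspan_base[rotated]) simp
        moreover have "c *s gen B \<in> ibig F (-1) (-1)" by (simp add: ibig_simps)
        then have "c *s gen B \<in> ?S" by (rule bspan_base[rotated]) (use False in simp)
        ultimately show ?thesis unfolding eq using \<open>a \<in> ?S\<close> by (intro vec.span_add)
      qed
    qed
  qed
  moreover have "F p \<subseteq> {0}" if "\<not> p \<le> p0" using F_mono[of p0 p] p0 that by auto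
  ultimately show ?thesis using assms by (cases "p \<le> p0") (auto intro: vec.span_zero)
qed

lemma hlift_decompose: 
  obtains x' where "x = gr0 B x *s hlift F + x'" "gr0 B x' = 0" "p \<le> 0 \<Longrightarrow> x \<in> F p \<Longrightarrow> x' \<in> F p"
proof (rule that[of "x - gr0 B x *s hlift F"])
  show "p \<le> 0 \<Longrightarrow> x \<in> F p \<Longrightarrow> x - gr0 B x *s hlift F \<in> F p"
    using F_mono[of p 0 "hlift F"] hlift by (simp add: F_closed)
qed (simp_all add: gr0_diff gr0_scale hlift)

lemma ibig_span_F: "F p = bspan (ibig F) (\<lambda>a b. p \<le> a)"
proof
  show "bspan (ibig F) (\<lambda>a b. p \<le> a) \<subseteq> F p"
    by (rule bspan_subset) (auto intro: subspace_F F_mono ibig_F)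
  show "F p \<subseteq> bspan (ibig F) (\<lambda>a b. p \<le> a)" 
  proof
    fix x assume x: "x \<in> F p"
    have sub: "bspan (ibig F) (\<lambda>a b. p \<le> a \<and> a + b \<le> -1) \<subseteq> bspan (ibig F) (\<lambda>a b. p \<le> a)"
      by (rule bspan_mono) simp
    show "x \<in> bspan (ibig F) (\<lambda>a b. p \<le> a)"
    proof (cases "p \<le> 0")
      case True
      obtain x' where eq: "x = gr0 B x *s hlift F + x'" and x': "gr0 B x' = 0" "x' \<in> F p"
        using hlift_decompose[of x p] True x by metis
      have "gr0 B x *s hlift F \<in> bspan (ibig F) (\<lambda>a b. p \<le> a)"
        by (rule bspan_base[of _ 0 0]) (use True in \<open>auto simp: ibig_simps\<close>)
      moreover have "x' \<in> bspan (ibig F) (\<lambda>a b. p \<le> a)" using F_ker_bspan[of x' p] x' sub by auto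
      ultimately have "gr0 B x *s hlift F + x' \<in> bspan (ibig F) (\<lambda>a b. p \<le> a)" by (rule vec.span_add)
      then show ?thesis using eq by simp
    next
      case False
      then have "gr0 B x = 0" using F1_ker F_mono[of 1 p] x by simp
      then show ?thesis using F_ker_bspan[of x p] x sub by auto
    qed
  qed
qed

lemma ibig_span_W: "W B k = bspan (ibig F) (\<lambda>a b. a + b \<le> k)"
proof -
  have zero: "ibig F a b = {0}" if "a + b \<noteq> 0" "a + b \<noteq> -1" "a + b \<noteq> -2" for a b
    using that by (auto simp: ibig_def)
  obtain p1 where p1: "F p1 = UNIV" using F_bounds by blast
  have ker: "{v. gr0 B v = 0} \<subseteq> bspan (ibig F) (\<lambda>a b. a + b \<le> k)" if "k \<ge> -1" for k
  proof -
    have "bspan (ibig F) (\<lambda>a b. p1 \<le> a \<and> a + b \<le> -1) \<subseteq> bspan (ibig F) (\<lambda>a b. a + b \<le> k)"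
      by (rule bspan_mono) (use that in auto)
    then show ?thesis using F_ker_bspan[of _ p1] p1 by auto
  qed
  consider "k \<ge> 0" | "k = -1" | "k = -2" | "k \<le> -3" by linarith
  then show ?thesis
  proof cases
    case 1
    have "x \<in> bspan (ibig F) (\<lambda>a b. a + b \<le> k)" for x
    proof -
      obtain x' where eq: "x = gr0 B x *s hlift F + x'" and x': "gr0 B x' = 0"
        using hlift_decompose[of x 0] by metis
      have "gr0 B x *s hlift F \<in> bspan (ibig F) (\<lambda>a b. a + b \<le> k)"
        by (rule bspan_base[of _ 0 0]) (use 1 in \<open>auto simp: ibig_simps\<close>)
      moreover have "x' \<in> bspan (ibig F) (\<lambda>a b. a + b \<le> k)" using ker[of k] 1 x' by auto
      ultimately have "gr0 B x *s hlift F + x' \<in> bspan (ibig F) (\<lambda>a b. a + b \<le> k)" by (rule vec.span_add)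
      then show ?thesis using eq by simp
    qed
    then show ?thesis using 1 by auto
  next
    case 2
    have "bspan (ibig F) (\<lambda>a b. a + b \<le> k) \<subseteq> {v. gr0 B v = 0}"
      by (rule bspan_subset) (use 2 ibig_gr0 in \<open>auto simp: vec.subspace_def gr0_add gr0_scale\<close>)
    then show ?thesis using 2 ker[of k] by auto
  next
    case 3
    have "range (\<lambda>c. c *s gen B) \<subseteq> bspan (ibig F) (\<lambda>a b. a + b \<le> k)"
      using bspan_base[of "\<lambda>a b. a + b \<le> k" "-1" "-1" _ "ibig F"] 3 by (auto simp: ibig_simps)
    moreover have "bspan (ibig F) (\<lambda>a b. a + b \<le> k) \<subseteq> ibig F (-1) (-1)"
    proof (rule bspan_subset)
      fix a b x assume "a + b \<le> k" "x \<in> ibig F a b"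
      then show "x \<in> ibig F (-1) (-1)" using 3
        by (auto elim!: ibig_cases simp: ibig_simps intro: range_eqI[of _ _ 0])
    qed (rule ibig_subspace)
    ultimately show ?thesis using 3 by (auto simp: ibig_simps)
  next
    case 4
    have "bspan (ibig F) (\<lambda>a b. a + b \<le> k) \<subseteq> {0}"
      by (rule bspan_subset) (use 4 zero in \<open>auto\<close>)
    then show ?thesis using 4 vec.span_zero by auto
  qed
qed

text \<open>Applying \<open>gr0 B\<close> removes type (0,0). In weight -1 the component of smallest
  Hodge level m would be congruent modulo \<open>gen B\<close> to an element of F^(m+1), while its
  conjugate lies in F^(-1-m); opposedness makes it a multiple of \<open>gen B\<close>, which is
  impossible unless it is 0.\<close>

lemma ibig_independent:
  assumes c: "bigr_decomposes (ibig F) c 0"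
  shows "c = (\<lambda>_. 0)"
proof -
  have cI: "c (p, q) \<in> ibig F p q" for p q using c by (auto simp: bigr_decomposes_def)
  let ?S = "{z. c z \<noteq> 0}"
  have fin: "finite ?S" and sum: "(\<Sum>z\<in>?S. c z) = 0" using c by (auto simp: bigr_decomposes_def)
  have sup: "(\<Sum>z\<in>T. c z) = 0" if "finite T" "?S \<subseteq> T" for T
    using bigr_decomposes_superset[OF c that] by simp
  have c00: "c (0, 0) = 0"
  proof -
    have "0 = gr0 B (\<Sum>z\<in>insert (0,0) ?S. c z)" using sup fin by (simp add: subset_insertI)
    also have "\<dots> = (\<Sum>z\<in>insert (0,0) ?S. gr0 B (c z))" by (rule gr0_sum)
    also have "\<dots> = (\<Sum>z\<in>{(0,0)}. gr0 B (c z))"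
    proof (rule sum.mono_neutral_right)
      show "\<forall>z\<in>insert (0, 0) ?S - {(0, 0)}. gr0 B (c z) = 0"
      proof
        fix z assume z: "z \<in> insert (0, 0) ?S - {(0, 0)}"
        obtain p q where "z = (p, q)" by (cases z)
        then show "gr0 B (c z) = 0" using z cI[of p q] by (auto elim!: ibig_cases simp: gr0_scale)
      qed
    qed (use fin in auto)
    finally have "gr0 B (c (0,0)) = 0" by simp
    then show ?thesis using cI[of 0 0] by (auto simp: ibig_simps gr0_scale hlift)
  qed
  have weight1: "c (p, -1 - p) = 0" for p
  proof (rule ccontr)
    assume ex: "c (p, -1 - p) \<noteq> 0"
    let ?T = "{p. c (p, -1 - p) \<noteq> 0}"
    have "?T \<subseteq> fst ` ?S" by force
    then have "finite ?T" using fin finite_subset by blast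
    moreover have "?T \<noteq> {}" using ex by blast
    ultimately have "Min ?T \<in> ?T" by (rule Min_in)
    moreover have "\<forall>a\<in>?T. Min ?T \<le> a" using \<open>finite ?T\<close> by (blast intro: Min_le)
    ultimately obtain m where m: "c (m, -1 - m) \<noteq> 0" and min: "\<And>a. c (a, -1 - a) \<noteq> 0 \<Longrightarrow> m \<le> a" by blast
    define x where "x = c (m, -1 - m)"
    have x: "x \<in> F m" "gr0 B x = 0" "vcnj x \<in> F (-1 - m)"
      using cI[of m "-1 - m"] by (auto simp: x_def ibig_simps)
    \<comment> \<open>The preimage in W_-1 of F^(m+1) on gr_-1; by minimality of m it contains all
      components other than \<open>x\<close>.\<close>
    let ?K = "{a + k *s gen B | a k. a \<in> F (m + 1) \<and> gr0 B a = 0}"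
    have K: "vec.subspace ?K"
    proof (rule vec.subspaceI)
      show "0 \<in> ?K" using vec.subspace_0[OF subspace_F] by (auto intro!: exI[of _ 0])
    next
      fix l u assume "u \<in> ?K"
      then obtain a k where u: "u = a + k *s gen B" "a \<in> F (m + 1)" "gr0 B a = 0" by blast
      show "l *s u \<in> ?K"
        using u by (auto intro!: exI[of _ "l *s a"] exI[of _ "l * k"] simp: algebra_simps F_closed gr0_scale vec.scale_right_distrib)
    next
      fix u v assume "u \<in> ?K" "v \<in> ?K"
      then obtain a k b l where u: "u = a + k *s gen B" "a \<in> F (m + 1)" "gr0 B a = 0"
        and v: "v = b + l *s gen B" "b \<in> F (m + 1)" "gr0 B b = 0" by blast
      show "u + v \<in> ?K"
        using u v by (auto intro!: exI[of _ "a + b"] exI[of _ "k + l"] simp: F_closed gr0_add vec.scale_left_distrib)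
    qed
    let ?R = "insert (m, -1 - m) ?S"
    have "0 = (\<Sum>z\<in>?R. c z)" using sup fin by (simp add: subset_insertI)
    also have "\<dots> = x + (\<Sum>z\<in>?R - {(m, -1 - m)}. c z)"
      unfolding x_def using fin by (intro sum.remove) auto
    finally have "- x = (\<Sum>z\<in>?R - {(m, -1 - m)}. c z)" by (simp add: add_eq_0_iff)
    also have "\<dots> \<in> ?K"
    proof (rule vec.subspace_sum[OF K])
      fix z assume z: "z \<in> ?R - {(m, -1 - m)}"
      obtain p q where pq: "z = (p, q)" by (cases z)
      have nz: "c (p, q) \<noteq> 0" and ne: "(p, q) \<noteq> (m, -1 - m)" using z pq by auto
      from cI[of p q] have "c (p, q) \<in> ?K"
      proof (cases rule: ibig_cases)
        case (2 k)
        then show ?thesis using nz c00 by simp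
      next
        case (3 k)
        then show ?thesis using vec.subspace_0[OF subspace_F]
          by (intro CollectI, rule_tac exI[of _ 0], rule_tac exI[of _ k]) simp
      next
        case 4
        then have "q = -1 - p" by simp
        then have "m \<le> p" "p \<noteq> m" using min[of p] nz ne by auto
        then have "c (p, q) \<in> F (m + 1)" using F_mono[of "m + 1" p] 4 by simp
        then show ?thesis using 4
          by (intro CollectI, rule_tac exI[of _ "c (p, q)"], rule_tac exI[of _ 0]) simp
      qed (use nz in simp)
      then show "c z \<in> ?K" by (simp add: pq)
    qed
    finally obtain a k where a: "- x = a + k *s gen B" "a \<in> F (m + 1)" "gr0 B a = 0" by blast
    have "x = - (a + k *s gen B)" using a(1) by (metis minus_minus)
    then have ax: "x = - a - k *s gen B" by simp
    then have "- a - vcnj (vcnj x) = k *s gen B" by simp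
    moreover have "vcnj x \<in> F (- (m + 1))" using x(3) by (simp add: algebra_simps)
    ultimately have "\<exists>k. - a = k *s gen B"
      using a x by (intro opposed_inter[of "- a" "m + 1" "vcnj x" k]) (auto simp: F_closed gr0_neg)
    then obtain l where "- a = l *s gen B" by blast
    then have xl: "x = (l - k) *s gen B"
      using ax by (simp add: vec.scale_left_diff_distrib)
    show False
    \<comment> \<open>One of the two levels m and -1-m is nonnegative, and there the filtration
      contains no nonzero multiple of \<open>gen B\<close>.\<close>
    proof (cases "m \<ge> 0")
      case True
      then show False using gen_F0[of m "l - k"] xl x(1) m by (simp add: x_def)
    next
      case False
      have "vcnj x = cnj (l - k) *s gen B" using xl by simp
      then show False using gen_F0[of "-1 - m" "cnj (l - k)"] x(3) False m xl by (simp add: x_def)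
    qed
  qed
  have zero: "c z = 0" if "z \<noteq> (-1, -1)" for z
  proof -
    obtain p q where pq: "z = (p, q)" by (cases z)
    from cI[of p q] have "c (p, q) = 0"
    proof (cases rule: ibig_cases)
      case 4
      then have "q = -1 - p" by simp
      then show ?thesis using weight1 by simp
    qed (use that pq c00 in auto)
    then show ?thesis by (simp add: pq)
  qed
  have "?S \<subseteq> {(-1, -1)}" using zero by blast
  then have "c (-1, -1) = 0" using sup[of "{(-1, -1)}"] by simp
  then show ?thesis using zero by (metis ext)
qed

text \<open>Conjugation exchanges the pieces exactly, except at (0,0): there \<open>hlift F\<close>
  moves by a multiple of \<open>gen B\<close>, which has type (-1,-1) and is absorbed by the
  permitted correction.\<close>

lemma ibig_deligne: "is_deligne_bigrading (W B) F (ibig F)"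
  unfolding is_deligne_bigrading_def
proof (intro conjI allI)
  show "vec.subspace (ibig F p q)" for p q by (rule ibig_subspace)
  have "bspan (ibig F) (\<lambda>_ _. True) = UNIV"
    using ibig_span_W[of 0] bspan_mono[of "\<lambda>a b. a + b \<le> 0" "\<lambda>_ _. True" "ibig F"] by auto
  then have "\<forall>v. \<exists>!c. bigr_decomposes (ibig F) c v"
    using decomposes_unique[of "ibig F", OF ibig_subspace] ibig_independent by blast
  then show "\<exists>!c. bigr_decomposes (ibig F) c v" for v by blast
  show "F p = bspan (ibig F) (\<lambda>a b. p \<le> a)" for p by (rule ibig_span_F)
  show "W B k = bspan (ibig F) (\<lambda>a b. a + b \<le> k)" for k by (rule ibig_span_W)
  fix p q
  let ?S = "bspan (ibig F) (\<lambda>a b. a < q \<and> b < p)"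
  show "vcnj ` ibig F p q + ?S = ibig F q p + ?S"
  proof (cases "p = 0 \<and> q = 0")
    case False
    have "vcnj ` ibig F p q = ibig F q p"
    proof (cases "p + q = -1")
      case True
      then show ?thesis
        by (auto simp: ibig_simps add.commute in_vcnj_image_iff)
    next
      case f: False
      show ?thesis
        using False f by (auto simp: ibig_def in_vcnj_image_iff vcnj_eq_iff)
    qed
    then show ?thesis by simp
  next
    case True
    have "gen B \<in> ibig F (-1) (-1)" by (auto simp: ibig_simps intro: range_eqI[of _ _ 1])
    then have gS: "gen B \<in> ?S" by (rule bspan_base[rotated]) (use True in simp)
    have gs: "l *s gen B + s \<in> ?S" if "s \<in> ?S" for l s
      by (intro vec.span_add vec.span_scale gS that)
    have "x + s \<in> ibig F 0 0 + ?S" if x: "x \<in> vcnj ` ibig F 0 0" and s: "s \<in> ?S" for x s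
    proof -
      obtain k where "x = vcnj (k *s hlift F)" using x unfolding ibig_simps by blast
      then have "x + s = cnj k *s hlift F + ((cnj k * (- 2 * \<i> * of_real (hdelta F))) *s gen B + s)"
        by (simp only: vcnj_simps vcnj_hlift vec.scale_right_distrib vec.scale_scale add.assoc)
      also have "\<dots> \<in> ibig F 0 0 + ?S"
        by (intro set_plus_intro gs s) (simp add: ibig_simps)
      finally show ?thesis .
    qed
    moreover have "x + s \<in> vcnj ` ibig F 0 0 + ?S" if x: "x \<in> ibig F 0 0" and s: "s \<in> ?S" for x s
    proof -
      obtain k where "x = k *s hlift F" using x by (auto simp: ibig_simps)
      then have "x + s = vcnj (cnj k *s hlift F) + (- (k * (- 2 * \<i> * of_real (hdelta F))) *s gen B + s)"
        by (simp add: vcnj_hlift vec.scale_right_distrib)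
      also have "\<dots> \<in> vcnj ` ibig F 0 0 + ?S"
        by (intro set_plus_intro gs s imageI) (simp add: ibig_simps)
      finally show ?thesis .
    qed
    ultimately have "vcnj ` ibig F 0 0 + ?S = ibig F 0 0 + ?S"
      by (auto elim!: set_plus_elim)
    then show ?thesis using True by simp
  qed
qed

text \<open>It suffices to show that each piece of \<open>J\<close> lies in the corresponding piece
  of \<open>ibig F\<close>; uniqueness of decompositions turns this inclusion into equality. The
  conjugation axiom is used only modulo W_(p+q-2), which is 0 in weights -1 and -2 and is W_-2 in
  weight 0.\<close>

lemma deligne_unique:
  assumes J: "is_deligne_bigrading (W B) F J"
  shows "J = ibig F"
proof -
  have sub: "vec.subspace (J p q)" for p q using J by (simp add: is_deligne_bigrading_def)
  have ex1: "\<forall>v. \<exists>!c. bigr_decomposes J c v" using J unfolding is_deligne_bigrading_def by blast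
  have JF: "F p = bspan J (\<lambda>a b. p \<le> a)" for p using J unfolding is_deligne_bigrading_def by blast
  have JW: "W B k = bspan J (\<lambda>a b. a + b \<le> k)" for k using J unfolding is_deligne_bigrading_def by blast
  have Jcnj: "vcnj ` J p q + bspan J (\<lambda>a b. a < q \<and> b < p) = J q p + bspan J (\<lambda>a b. a < q \<and> b < p)" for p q
    using J unfolding is_deligne_bigrading_def by blast
  have zero: "x = 0" if "x \<in> J p q" "x \<in> bspan J P" "\<not> P p q" for x p q P
    using hproj_bspan_zero[of J x P, OF sub ex1 that(2,3)] hproj_single[of J x p q p q, OF sub ex1 that(1)] by simp
  have inF: "x \<in> F p" if "x \<in> J p q" for x p q
    unfolding JF by (rule bspan_base[of _ p q]) (use that in auto)
  have inW: "x \<in> W B (p + q)" if "x \<in> J p q" for x p q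
    unfolding JW by (rule bspan_base[of _ p q]) (use that in auto)
  have conj: "vcnj x \<in> J q p + W B (p + q - 2)" if x: "x \<in> J p q" for x p q
  proof -
    have "vcnj x + 0 \<in> vcnj ` J p q + bspan J (\<lambda>a b. a < q \<and> b < p)"
      by (rule set_plus_intro) (use x vec.span_zero in auto)
    then have "vcnj x \<in> J q p + bspan J (\<lambda>a b. a < q \<and> b < p)" by (simp add: Jcnj)
    moreover have "bspan J (\<lambda>a b. a < q \<and> b < p) \<subseteq> W B (p + q - 2)"
      unfolding JW by (rule bspan_mono) simp
    ultimately show ?thesis using set_plus_mono2[OF order.refl] by blast
  qed
  have JI: "x \<in> ibig F p q" if x: "x \<in> J p q" for x p q
  proof -
    consider "p + q \<ge> 1" | "p + q \<le> -3" | "p + q = -2" | "p + q = -1" | "p + q = 0" by linarith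
    then show ?thesis
    proof cases
      case 1
      then have "x \<in> W B 0" by simp
      then have "x = 0" using zero[OF x, of "\<lambda>a b. a + b \<le> 0"] 1 unfolding JW by auto
      then show ?thesis using vec.subspace_0[OF ibig_subspace] by simp
    next
      case 2
      then have "x = 0" using inW[OF x] by simp
      then show ?thesis using vec.subspace_0[OF ibig_subspace] by simp
    next
      case 3
      then obtain c where c: "x = c *s gen B" using inW[OF x] by auto
      \<comment> \<open>Apart from (-1,-1), a type of weight -2 has a nonnegative entry, and F^0
        contains no nonzero multiple of \<open>gen B\<close>.\<close>
      consider "p = -1" | "p \<ge> 0" | "q \<ge> 0" using 3 by linarith
      then show ?thesis
      proof cases
        case 1
        then have "p = -1" "q = -1" using 3 by auto
        then show ?thesis using c by (simp add: ibig_simps)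
      next
        case 2
        then show ?thesis using gen_F0[of p c] inF[OF x] c vec.subspace_0[OF ibig_subspace] by simp
      next
        case 3
        have "vcnj x \<in> J q p" using conj[OF x] \<open>p + q = -2\<close> by (auto elim!: set_plus_elim)
        then have "cnj c *s gen B \<in> F q" using inF c by auto
        then show ?thesis using gen_F0[of q "cnj c"] 3 c vec.subspace_0[OF ibig_subspace] by simp
      qed
    next
      case 4
      have "vcnj x \<in> J q p" using conj[OF x] 4 by (auto elim!: set_plus_elim)
      then show ?thesis using inF[OF x] inF inW[OF x] 4 by (auto simp: ibig_simps)
    next
      case 5
      consider "p = 0" | "p \<ge> 1" | "q \<ge> 1" using 5 by linarith
      then show ?thesis
      proof cases
        case 1
        then have "vcnj x \<in> J 0 0 + W B (-2)" using conj[OF x] 5 by simp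
        then obtain y c where y: "y \<in> J 0 0" "vcnj x = y + c *s gen B" by (auto elim!: set_plus_elim)
        then have yF: "y \<in> F 0" "x \<in> F 0" using inF x 1 by auto
        define k where "k = gr0 B x"
        \<comment> \<open>Removing the multiples of the Hodge lift puts both \<open>x\<close> and
          the \<open>J\<close>-part \<open>y\<close> of its conjugate into F^0 \<inter> W_-1, where
          opposedness gives \<open>u = 0\<close>.\<close>
        define u where "u = x - k *s hlift F"
        define v where "v = y - cnj k *s hlift F"
        have gy: "gr0 B y = cnj k"
        proof -
          have "gr0 B (vcnj x) = gr0 B y" unfolding y(2) by (simp add: gr0_add gr0_scale)
          then show ?thesis by (simp add: k_def)
        qed
        have u: "u \<in> F 0" "gr0 B u = 0" and v: "v \<in> F 0" "gr0 B v = 0"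
          using yF gy hlift by (simp_all add: u_def v_def k_def F_closed gr0_diff gr0_scale)
        have "vcnj v = x - cnj c *s gen B - k *s vcnj (hlift F)"
          using arg_cong[OF y(2), of vcnj] by (simp add: v_def)
        then have "u - vcnj v = cnj c *s gen B + k *s (vcnj (hlift F) - hlift F)"
          by (simp add: u_def vec.scale_right_diff_distrib)
        also have "\<dots> = (cnj c + k * (- 2 * \<i> * of_real (hdelta F))) *s gen B"
          unfolding vcnj_hlift by (simp add: vec.scale_left_diff_distrib)
        finally have "u = 0" using opposed_zero[OF u v] by blast
        then show ?thesis using 1 5 by (simp add: ibig_simps u_def)
      next
        case 2
        then have "gr0 B x = 0" using inF[OF x] F_mono[of 1 p] F1_ker by blast
        then have "x \<in> W B (-1)" by simp
        then have "x = 0" using zero[OF x, of "\<lambda>a b. a + b \<le> -1"] 5 unfolding JW by auto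
        then show ?thesis using vec.subspace_0[OF ibig_subspace] by simp
      next
        case 3
        have "vcnj x \<in> J q p + W B (-2)" using conj[OF x] 5 by simp
        then obtain y c where y: "y \<in> J q p" "vcnj x = y + c *s gen B" by (auto elim!: set_plus_elim)
        have "gr0 B y = 0" using inF[OF y(1)] F_mono[of 1 q] F1_ker 3 by blast
        then have "gr0 B (vcnj x) = 0" unfolding y(2) by (simp add: gr0_add gr0_scale)
        then have "x \<in> W B (-1)" by simp
        then have "x = 0" using zero[OF x, of "\<lambda>a b. a + b \<le> -1"] 5 unfolding JW by auto
        then show ?thesis using vec.subspace_0[OF ibig_subspace] by simp
      qed
    qed
  qed
  have ex1I: "\<forall>v. \<exists>!c. bigr_decomposes (ibig F) c v"
    using ibig_deligne unfolding is_deligne_bigrading_def by blast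
  have "x \<in> J p q" if x: "x \<in> ibig F p q" for x p q
  proof -
    obtain c where c: "bigr_decomposes J c x" using ex1 by blast
    \<comment> \<open>By the inclusion just proved, a decomposition along \<open>J\<close> is one
      along \<open>ibig F\<close>, so it must be the decomposition with the single entry
      \<open>x\<close>.\<close>
    then have "bigr_decomposes (ibig F) c x" using JI by (auto simp: bigr_decomposes_def)
    moreover have "bigr_decomposes (ibig F) (\<lambda>z. if z = (p, q) then x else 0) x"
      using bigr_decomposes_single[of "ibig F", OF ibig_subspace x] .
    ultimately have "c = (\<lambda>z. if z = (p, q) then x else 0)" using ex1I by blast
    then have "c (p, q) = x" by simp
    moreover have "c (p, q) \<in> J p q" using c by (simp add: bigr_decomposes_def)
    ultimately show ?thesis by simp
  qed
  then show ?thesis using JI by (intro ext set_eqI) blast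
qed

lemma deligne_bigrading_eq: "deligne_bigrading (W B) F = ibig F"
  unfolding deligne_bigrading_def
  by (rule the_equality, rule ibig_deligne, rule deligne_unique)

lemma ibig_ex1: "\<forall>v. \<exists>!c. bigr_decomposes (ibig F) c v"
  using ibig_deligne unfolding is_deligne_bigrading_def by blast

text \<open>Only the piece of type (0,0) can fail to be exchanged by conjugation. If it is stable,
  then \<open>hlift F - vcnj (hlift F)\<close> is a multiple of \<open>gen B\<close> in F^0, hence
  0.\<close>

lemma split_over_reals_iff: "split_over_reals (W B) F \<longleftrightarrow> hdelta F = 0"
proof
  assume "split_over_reals (W B) F"
  then have "vcnj ` ibig F 0 0 = ibig F 0 0"
    by (simp add: split_over_reals_def deligne_bigrading_eq)
  moreover have "hlift F \<in> ibig F 0 0" by (auto simp: ibig_simps intro: range_eqI[of _ _ 1])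
  ultimately have "vcnj (hlift F) \<in> ibig F 0 0" by blast
  then have "vcnj (hlift F) \<in> F 0" by (rule ibig_F)
  then have "hlift F - vcnj (hlift F) \<in> F 0" using hlift by (simp add: F_closed)
  then have "2 * \<i> * of_real (hdelta F) = (0 :: complex)"
    unfolding hdelta by (rule gen_F0[OF order.refl])
  then show "hdelta F = 0" by simp
next
  assume "hdelta F = 0"
  then have *: "vcnj (hlift F) = hlift F" by (simp add: vcnj_hlift)
  show "split_over_reals (W B) F"
    unfolding split_over_reals_def deligne_bigrading_eq
  proof (intro allI)
    fix p q :: int
    consider "p = 0 \<and> q = 0" | "p + q = -1" | "p \<noteq> 0 \<or> q \<noteq> 0" "p + q \<noteq> -1" by blast
    then show "vcnj ` ibig F p q = ibig F q p"
    proof cases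
      case 1
      have "vcnj ` range (\<lambda>c. c *s hlift F) = range (\<lambda>c. c *s hlift F)"
        by (auto simp: in_vcnj_image_iff *)
      then show ?thesis using 1 by (simp add: ibig_simps)
    next
      case 2
      then show ?thesis by (auto simp: ibig_simps add.commute in_vcnj_image_iff)
    next
      case 3
      then show ?thesis by (auto simp: ibig_def in_vcnj_image_iff vcnj_eq_iff)
    qed
  qed
qed

end

section \<open>The Deligne splitting of a biextension\<close>

lemma mat_exp_square_zero:
  fixes X :: "complex ^ 'n::finite ^ 'n"
  assumes "X ** X = 0"
  shows "mat_exp X = mat 1 + X"
proof -
  have z: "((\<lambda>Y. X ** Y) ^^ k) (mat 1) = 0" if "k \<notin> {0, 1}" for k
  proof -
    have "2 \<le> k" using that by auto
    then obtain m where "k = 2 + m" using le_Suc_ex by blast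
    then have "k = Suc (Suc m)" by simp
    then show ?thesis using assms by (simp add: matrix_mul_assoc)
  qed
  have "mat_exp X = (\<Sum>k\<in>{0, 1}. ((\<lambda>Y. X ** Y) ^^ k) (mat 1) /\<^sub>R fact k)"
    unfolding mat_exp_def by (rule suminf_finite) (use z in auto)
  then show ?thesis by simp
qed

context biext begin

text \<open>The endomorphisms factoring through Hom(gr_0, gr_-2). They do not depend on the Hodge
  filtration and have square zero, so their exponentials are shears.\<close>

definition dmat :: "complex \<Rightarrow> complex ^ 'n ^ 'n" where
  "dmat c = (\<chi> i j. c * gen B $ i * gr0 B (axis j 1))"

lemma dmat_apply [simp]: "dmat c *v v = (c * gr0 B v) *s gen B"
proof -
  have "(dmat c *v v) $ i = (c * gr0 B v) * gen B $ i" for i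
  proof -
    have "(dmat c *v v) $ i = (\<Sum>j\<in>UNIV. (c * gen B $ i) * (v $ j * gr0 B (axis j 1)))"
      unfolding matrix_vector_mult_def dmat_def vec_lambda_beta by (rule sum.cong) (simp_all only: ac_simps)
    also have "\<dots> = (c * gen B $ i) * gr0 B v"
      by (subst clinear_expansion[OF gr0_linear, of v]) (rule sum_distrib_left[symmetric])
    finally show ?thesis by (simp only: ac_simps)
  qed
  then show ?thesis by (simp add: vec_eq_iff)
qed

lemma matrix_scaleR: "(t *\<^sub>R X) *v (v :: complex ^ 'n) = of_real t *s (X *v v)" for X :: "complex ^ 'n ^ 'n"
  by (simp add: vec_eq_iff matrix_vector_mult_def sum_distrib_left mult.assoc scaleR_conv_of_real[where 'a=complex])

lemma mat_scalar: "mat k *v (v :: complex ^ 'n) = k *s v"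
  by (simp add: vec_eq_iff matrix_vector_mult_def mat_def if_distrib[of "\<lambda>x. x * _"] cong: if_cong)

lemma dmat_simps:
  "t *\<^sub>R dmat c = dmat (of_real t * c)" "mat k ** dmat c = dmat (k * c)" "dmat c ** dmat c' = 0"
  by (simp_all add: matrix_eq matrix_scaleR mat_scalar gr0_scale flip: matrix_vector_mul_assoc)

lemma dmat_exp: "mat_exp (dmat c) *v v = v + (c * gr0 B v) *s gen B"
  by (simp add: mat_exp_square_zero dmat_simps matrix_vector_mult_add_rdistrib)

lemma shear_inverse: "mat_exp (dmat c) ** mat_exp (dmat (-c)) = mat 1"
  by (simp add: matrix_eq dmat_exp gr0_add gr0_diff gr0_scale flip: matrix_vector_mul_assoc)

lemma W_gr0: "k \<le> -1 \<Longrightarrow> x \<in> W B k \<Longrightarrow> gr0 B x = 0"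
  by (auto simp: W_def gr0_scale split: if_splits)

lemma dmat_exp_W: "(\<lambda>v. mat_exp (dmat c) *v v) ` W B k = W B k"
proof -
  have sub: "mat_exp (dmat c) *v v \<in> W B k" if "v \<in> W B k" for v c
  proof (cases "k \<ge> 0")
    case False
    then show ?thesis using W_gr0[of k v] that by (simp add: dmat_exp)
  qed simp
  have "v \<in> (\<lambda>v. mat_exp (dmat c) *v v) ` W B k" if "v \<in> W B k" for v
    using sub[OF that, of "-c"] shear_inverse[of c] by (intro image_eqI) (auto simp: matrix_vector_mul_assoc)
  then show ?thesis using sub by blast
qed

lemma dmat_lie_alg: "dmat c \<in> lie_alg B"
  unfolding lie_alg_def graded_aut_def
proof (intro CollectI allI conjI ballI)
  fix t :: real and k x y
  show "invertible (mat_exp (t *\<^sub>R dmat c))"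
    using shear_inverse[of "of_real t * c"] shear_inverse[of "- (of_real t * c)"]
    by (auto simp: invertible_def dmat_simps)
  show "(\<lambda>v. mat_exp (t *\<^sub>R dmat c) *v v) ` W B k = W B k"
    by (simp add: dmat_simps dmat_exp_W)
  assume "x \<in> W B k" "y \<in> W B k"
  then show "graded_pol B k (mat_exp (t *\<^sub>R dmat c) *v x) (mat_exp (t *\<^sub>R dmat c) *v y) = graded_pol B k x y"
    using W_gr0[of k x] W_gr0[of k y] by (cases "k \<le> -1") (simp_all add: graded_pol_def dmat_simps dmat_exp gr0_add gr0_scale)
qed

lemma gen_component: "\<exists>i. gen B $ i \<noteq> 0"
  using gen_nonzero by (metis vec_eq_iff zero_index)

lemma dmat_real: "(\<forall>i j. dmat c $ i $ j \<in> \<real>) \<longleftrightarrow> c \<in> \<real>"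
proof
  have VZ_real: "v $ i \<in> \<real>" if "v \<in> VZ" for v :: "complex ^ 'n" and i
    using that unfolding VZ_def by (metis (mono_tags, lifting) mem_Collect_eq Ints_cases Reals_of_int)
  have gr0_real: "gr0 B (axis j 1) \<in> \<real>" for j
    using gr0_VZ[OF VZ_axis, of j] by (auto elim!: Ints_cases)
  { assume "c \<in> \<real>"
    then show "\<forall>i j. dmat c $ i $ j \<in> \<real>"
      using VZ_real[OF gen_VZ] gr0_real by (simp add: dmat_def) }
  assume *: "\<forall>i j. dmat c $ i $ j \<in> \<real>"
  obtain i where i: "gen B $ i \<noteq> 0" using gen_component by blast
  have "(dmat c *v unit_lift) $ i \<in> \<real>"
    unfolding matrix_vector_mult_def using * VZ_real[OF unit_lift(1)] by (auto intro!: sum_in_Reals Reals_mult)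
  then have "c * gen B $ i / gen B $ i \<in> \<real>"
    using VZ_real[OF gen_VZ] by (intro Reals_divide) (simp_all add: unit_lift)
  then show "c \<in> \<real>" using i by simp
qed

end

context biext_hodge begin

text \<open>Type (-1,-1) lowers the weight by two: it kills W_-1, since no weights below -2 occur,
  and sends the lift to a multiple of \<open>gen B\<close>.\<close>

lemma lie_alg_type_iff: "X \<in> lie_alg_type B F (-1) (-1) \<longleftrightarrow> (\<exists>c. X = dmat c)"
proof
  assume "X \<in> lie_alg_type B F (-1) (-1)"
  then have X: "X *v v \<in> ibig F (p - 1) (q - 1)" if "v \<in> ibig F p q" for v p q
    using that by (auto simp: lie_alg_type_def deligne_bigrading_eq image_subset_iff)
  have "hlift F \<in> ibig F 0 0" using scale_in_range[of 1 "hlift F"] by (simp add: ibig_simps)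
  from X[OF this] obtain c where c: "X *v hlift F = c *s gen B" by (auto simp: ibig_simps)
  have "bspan (ibig F) (\<lambda>a b. a + b \<le> -1) \<subseteq> {v. X *v v = 0}"
  proof (rule bspan_subset)
    fix a b x assume "a + b \<le> -1" "x \<in> ibig F a b"
    with X[of x a b] show "x \<in> {v. X *v v = 0}"
      by (auto simp: ibig_def split: if_splits)
  qed (auto simp: vec.subspace_def matrix_vector_right_distrib vector_scalar_commute)
  then have ker: "X *v v = 0" if "gr0 B v = 0" for v using ibig_span_W[of "-1"] that by auto
  have "X *v v = dmat c *v v" for v
  proof -
    obtain v' where v: "v = gr0 B v *s hlift F + v'" and v': "gr0 B v' = 0" using hlift_decompose by metis
    have "X *v v = gr0 B v *s (X *v hlift F) + X *v v'"
      by (subst v) (simp add: matrix_vector_right_distrib vector_scalar_commute)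
    then show ?thesis using ker[OF v'] by (simp add: c mult.commute)
  qed
  then have "X = dmat c" by (simp add: matrix_eq)
  then show "\<exists>c. X = dmat c" ..
next
  assume "\<exists>c. X = dmat c"
  then obtain c where X: "X = dmat c" ..
  have "dmat c *v v \<in> ibig F (p - 1) (q - 1)" if "v \<in> ibig F p q" for v p q
    using that
  proof (cases rule: ibig_cases)
    case (2 k)
    then show ?thesis by (simp add: ibig_simps gr0_scale hlift)
  qed (auto simp: gr0_scale vec.subspace_0[OF ibig_subspace])
  then show "X \<in> lie_alg_type B F (-1) (-1)"
    by (auto simp: X lie_alg_type_def deligne_bigrading_eq dmat_lie_alg)
qed

text \<open>All conditions beyond the shape of the filtration concern the graded pieces. For
  negative weights these see only the intersection with W_-1, and in weight 0 only the image modulo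
  W_-1.\<close>

lemma biext_mhs_same_graded:
  assumes "\<And>p. vec.subspace (F' p)" "antimono F'" "\<exists>p. F' p = UNIV" "\<exists>p. F' p = {0}"
    and ker: "\<And>p x. gr0 B x = 0 \<Longrightarrow> x \<in> F' p \<longleftrightarrow> x \<in> F p"
    and quot: "\<And>p. F' p + {v. gr0 B v = 0} = F p + {v. gr0 B v = 0}"
  shows "biext_mhs B F'"
proof -
  have "gr_filt (W B) F' k p = gr_filt (W B) F k p" for k p
  proof -
    consider "k \<ge> 1" | "k = 0" | "k \<le> -1" by linarith
    then show ?thesis
    proof cases
      case 1
      have "S + UNIV = (UNIV :: (complex ^ 'n) set)" if "s \<in> S" for S s
        using that by (auto intro!: set_plus_intro[of s _ "x - s" for x, simplified])
      from this[OF vec.subspace_0[OF assms(1)]] this[OF vec.subspace_0[OF subspace_F]]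
      show ?thesis using 1 by (simp add: gr_filt_def)
    next
      case 2
      then show ?thesis using quot by (simp add: gr_filt_def)
    next
      case 3
      then have "F' p \<inter> W B k = F p \<inter> W B k" using ker W_gr0[OF 3] by blast
      then show ?thesis by (simp add: gr_filt_def)
    qed
  qed
  then have "gr_filt (W B) F' = gr_filt (W B) F" by (intro ext)
  then show ?thesis
    using hodge assms(1-4) by (simp add: biext_mhs_def mhs_def polarized_def)
qed

text \<open>The shear is the identity on W_-1 and moves every vector within its class modulo W_-1,
  so the graded pieces are unchanged.\<close>

lemma shear_biext_mhs: "biext_mhs B (act (mat_exp (dmat c)) F)"
proof (rule biext_mhs_same_graded)
  let ?f = "\<lambda>v. v + (c * gr0 B v) *s gen B"
  have act: "act (mat_exp (dmat c)) F p = ?f ` F p" for p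
    by (simp add: act_def dmat_exp)
  show "vec.subspace (act (mat_exp (dmat c)) F p)" for p
    unfolding act_def by (rule vec.subspace_image[OF subspace_F])
  show "antimono (act (mat_exp (dmat c)) F)"
    unfolding monotone_def act using F_mono by blast
  have "x \<in> ?f ` UNIV" for x
    by (rule image_eqI[of _ _ "x - (c * gr0 B x) *s gen B"]) (simp_all add: gr0_diff gr0_scale)
  then show "\<exists>p. act (mat_exp (dmat c)) F p = UNIV"
    using F_bounds(1) unfolding act by (metis UNIV_eq_I)
  show "\<exists>p. act (mat_exp (dmat c)) F p = {0}"
    using F_bounds(2) unfolding act by (metis (no_types, lifting) gr0_zero image_insert image_empty mult_zero_right vec.scale_zero_left add_0)
  show "x \<in> act (mat_exp (dmat c)) F p \<longleftrightarrow> x \<in> F p" if x: "gr0 B x = 0" for x p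
  proof
    assume "x \<in> act (mat_exp (dmat c)) F p"
    then obtain y where "y \<in> F p" "x = ?f y" unfolding act by blast
    moreover from this have "gr0 B y = 0" using x by (simp add: gr0_add gr0_scale)
    ultimately show "x \<in> F p" by simp
  next
    assume "x \<in> F p"
    then show "x \<in> act (mat_exp (dmat c)) F p" unfolding act by (rule image_eqI[rotated]) (simp add: x)
  qed
  show "act (mat_exp (dmat c)) F p + {v. gr0 B v = 0} = F p + {v. gr0 B v = 0}" for p
  proof (intro equalityI subsetI)
    fix x assume "x \<in> act (mat_exp (dmat c)) F p + {v. gr0 B v = 0}"
    then obtain y z where "x = y + ((c * gr0 B y) *s gen B + z)" "y \<in> F p" "gr0 B z = 0"
      unfolding act by (auto elim!: set_plus_elim simp: add.assoc)
    then show "x \<in> F p + {v. gr0 B v = 0}" by (auto intro!: set_plus_intro simp: gr0_add gr0_scale)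
  next
    fix x assume "x \<in> F p + {v. gr0 B v = 0}"
    then obtain y z where yz: "x = y + z" "y \<in> F p" "gr0 B z = 0" by (auto elim!: set_plus_elim)
    have "?f y + (z - (c * gr0 B y) *s gen B) \<in> act (mat_exp (dmat c)) F p + {v. gr0 B v = 0}"
      unfolding act by (rule set_plus_intro) (use yz in \<open>auto simp: gr0_diff gr0_scale\<close>)
    then show "x \<in> act (mat_exp (dmat c)) F p + {v. gr0 B v = 0}" using yz by simp
  qed
qed

text \<open>The sheared filtration has lift \<open>hlift F + c *s gen B\<close> with
  \<open>c = - \<i> * of_real d\<close>, and \<open>c - cnj c\<close> is
  \<open>- 2 * \<i> * of_real d\<close>.\<close>

lemma shear_hdelta: "hdelta (act (mat_exp (dmat (- \<i> * of_real d))) F) = hdelta F - d"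
proof -
  define c where "c = - \<i> * complex_of_real d"
  let ?F = "act (mat_exp (dmat c)) F"
  interpret F': biext_hodge B ?F by unfold_locales (rule shear_biext_mhs)
  let ?e = "hlift F + c *s gen B"
  have eq: "?e - vcnj ?e = (2 * \<i> * of_real (hdelta F - d)) *s gen B"
  proof -
    have "?e - vcnj ?e = (hlift F - vcnj (hlift F)) + (c - cnj c) *s gen B"
      by (simp add: vec.scale_left_diff_distrib)
    also have "\<dots> = (2 * \<i> * of_real (hdelta F - d)) *s gen B"
      unfolding hdelta by (simp add: c_def vec.scale_left_distrib[symmetric] algebra_simps)
    finally show ?thesis .
  qed
  have "mat_exp (dmat c) *v hlift F = ?e" by (simp add: dmat_exp hlift)
  then have "?e \<in> ?F 0" unfolding act_def using hlift(1) by (metis image_eqI)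
  then have "hlift ?F = ?e"
    by (rule F'.hlift_eqI[OF _ _ eq]) (simp add: gr0_add gr0_scale hlift)
  then show ?thesis using F'.hdelta_eqI eq unfolding c_def by simp
qed

text \<open>Candidates are the \<open>dmat\<close> of real numbers d, and the twist by d lowers
  \<open>hdelta F\<close> by d; it vanishes for exactly one d.\<close>

lemma deligne_delta_eq: "deligne_delta B F = dmat (of_real (hdelta F))"
proof -
  have split: "split_over_reals (W B) (act (mat_exp (mat (-\<i>) ** dmat (of_real d))) F) \<longleftrightarrow> d = hdelta F" for d
  proof -
    interpret F': biext_hodge B "act (mat_exp (dmat (- \<i> * of_real d))) F"
      by unfold_locales (rule shear_biext_mhs)
    show ?thesis unfolding dmat_simps F'.split_over_reals_iff shear_hdelta by auto
  qed
  show ?thesis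
    unfolding deligne_delta_def
  proof (rule the_equality)
    show "dmat (of_real (hdelta F)) \<in> lie_alg_type B F (-1) (-1) \<inter> lie_alg_real B \<and>
      split_over_reals (W B) (act (mat_exp (mat (-\<i>) ** dmat (of_real (hdelta F)))) F)"
      using split dmat_real[of "of_real (hdelta F)"] by (auto simp: lie_alg_type_iff lie_alg_real_def dmat_lie_alg)
    fix D assume D: "D \<in> lie_alg_type B F (-1) (-1) \<inter> lie_alg_real B \<and>
      split_over_reals (W B) (act (mat_exp (mat (-\<i>) ** D)) F)"
    then obtain c where c: "D = dmat c" by (auto simp: lie_alg_type_iff)
    then have "c \<in> \<real>" using D dmat_real[of c] by (auto simp: lie_alg_real_def)
    then obtain d where d: "c = of_real d" by (elim Reals_cases)
    then show "D = dmat (of_real (hdelta F))" using D split by (simp add: c)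
  qed
qed

lemma delta_num_eq: "delta_num B F = hdelta F"
  unfolding delta_num_def deligne_delta_eq dmat_apply
proof (rule the_equality)
  fix d :: real assume "\<forall>v. (of_real (hdelta F) * gr0 B v) *s gen B = (of_real d * gr0 B v) *s gen B"
  then have "(of_real (hdelta F) * gr0 B unit_lift) *s gen B = (of_real d * gr0 B unit_lift) *s gen B" by blast
  then show "d = hdelta F" unfolding vec.scale_cancel_right by (simp add: unit_lift)
qed simp

end

section \<open>Lattice automorphisms and self-duality\<close>

lemma vec_subspace_matrix_image: "vec.subspace S \<Longrightarrow> vec.subspace ((\<lambda>v. M *v v) ` S)"
  for M :: "complex ^ 'n::finite ^ 'n"
  using vec.subspace_image[of S M] by simp

context biext begin

text \<open>
  Pointwise form of self-duality: on \<open>F\<^sup>0 \<inter> W\<^sub>-\<^sub>1\<close>, the normal function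
  paired with \<open>Q\<close> is minus an integral retraction onto \<open>W\<^sub>-\<^sub>2\<close>.
\<close>

definition integral_retraction :: "(complex ^ 'n \<Rightarrow> complex) \<Rightarrow> bool" where
  "integral_retraction r \<longleftrightarrow> clinear r \<and> r (gen B) = 1 \<and> (\<forall>x \<in> VZ. gr0 B x = 0 \<longrightarrow> r x \<in> \<int>)"

definition self_dual_at :: "'n filtration \<Rightarrow> bool" where
  "self_dual_at F \<longleftrightarrow> (\<forall>vF \<in> F 0. \<forall>vZ \<in> VZ. gr0 B vF = 1 \<longrightarrow> gr0 B vZ = 1 \<longrightarrow>
     (\<exists>r. integral_retraction r \<and> (\<forall>\<beta> \<in> F 0. gr0 B \<beta> = 0 \<longrightarrow> qf \<beta> (vF - vZ) = - r \<beta>)))"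

text \<open>The Hodge retraction vanishes on F^0 \<inter> W_-1, so there only minus the integral
  retraction is left.\<close>

lemma self_dual_imp_at:
  assumes "self_dual B F"
  shows "self_dual_at (F s)"
  unfolding self_dual_at_def
proof (intro ballI impI)
  fix vF vZ assume v: "vF \<in> F s 0" "vZ \<in> VZ" "gr0 B vF = 1" "gr0 B vZ = 1"
  let ?x = "vF - vZ"
  have "?x + 0 \<in> normal_fun B (F s)"
    unfolding normal_fun_def
    by (rule set_plus_intro) (use v scale_in_range[of 0 "gen B"] in auto)
  then have "(\<lambda>\<beta>. pol B \<beta> ?x) \<in> dual_normal_fun B (F s)"
    using assms by (auto simp: self_dual_def)
  then obtain rF rZ where r: "\<forall>x \<in> F s 0 \<inter> W B (-1). rF x = 0"
     "clinear rZ" "rZ (gen B) = 1" "\<forall>x \<in> VZ \<inter> W B (-1). rZ x \<in> \<int>"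
     "\<forall>x \<in> W B (-1). pol B x ?x = rF x - rZ x"
    by (auto simp: dual_normal_fun_def)
  have "gr0 B ?x = 0" using v by (simp add: gr0_diff)
  then have "integral_retraction rZ \<and> (\<forall>\<beta>\<in>F s 0. gr0 B \<beta> = 0 \<longrightarrow> qf \<beta> ?x = - rZ \<beta>)"
    using r by (auto simp: integral_retraction_def simp flip: pol_eq_qf)
  then show "\<exists>r. integral_retraction r \<and> (\<forall>\<beta>\<in>F s 0. gr0 B \<beta> = 0 \<longrightarrow> qf \<beta> ?x = - r \<beta>)" by blast
qed

end

section \<open>Transport along lattice automorphisms\<close>

locale biext_aut = biext B for B :: "'n::finite biext_lattice" +
  fixes M :: "complex ^ 'n ^ 'n"
  assumes aut: "M \<in> lattice_aut B"
begin

lemma M_int: "M $ i $ j \<in> \<int>" and M_det: "det M = 1 \<or> det M = -1"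
  and M_gr0 [simp]: "gr0 B (M *v v) = gr0 B v" and M_gen [simp]: "M *v gen B = gen B"
  and M_pol: "gr0 B x = 0 \<Longrightarrow> gr0 B y = 0 \<Longrightarrow> pol B (M *v x) (M *v y) = pol B x y"
  using aut by (auto simp: lattice_aut_def)

lemmas M_linear = matrix_vector_right_distrib matrix_vector_mult_diff_distrib vector_scalar_commute

lemma M_qf: "gr0 B x = 0 \<Longrightarrow> gr0 B y = 0 \<Longrightarrow> qf (M *v x) (M *v y) = qf x y"
  using M_pol by (simp flip: pol_eq_qf)

lemma M_vcnj: "vcnj (M *v v) = M *v vcnj v"
  using cnj_Ints[OF M_int] by (simp add: vec_eq_iff matrix_vector_mult_def)

lemma M_bij: "bij (\<lambda>v. M *v v)"
proof -
  have "invertible M" using M_det by (auto simp: invertible_det_nz)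
  then show ?thesis by (simp add: invertible_eq_bij)
qed

lemma M_inj: "M *v x = M *v y \<longleftrightarrow> x = y"
  using bij_is_inj[OF M_bij] by (auto simp: inj_def)

lemma M_surj: "\<exists>x. M *v x = y"
  using bij_is_surj[OF M_bij] by (metis surj_def)

lemma det_Ints: "(\<And>i j. A $ i $ j \<in> \<int>) \<Longrightarrow> det A \<in> \<int>" for A :: "complex ^ 'n ^ 'n"
  unfolding det_def by (intro Ints_sum Ints_mult Ints_prod) auto

text \<open>Cramer's rule: the determinant is 1 or -1, so dividing by it keeps integers.\<close>

lemma M_VZ: "M *v x \<in> VZ \<Longrightarrow> x \<in> VZ"
proof -
  assume y: "M *v x \<in> VZ"
  have "x $ k \<in> \<int>" for k
  proof -
    have "det M \<noteq> 0" using M_det by auto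
    then have x: "x = (\<chi> k. det (\<chi> i j. if j = k then (M *v x) $ i else M $ i $ j) / det M)"
      using cramer[of M x "M *v x"] by blast
    have "det (\<chi> i j. if j = k then (M *v x) $ i else M $ i $ j) \<in> \<int>"
      by (rule det_Ints) (use y M_int in \<open>auto simp: VZ_def\<close>)
    then show ?thesis
      using M_det by (subst x) auto
  qed
  then show ?thesis by (simp add: VZ_def)
qed

lemma M_W: "(\<lambda>v. M *v v) ` W B k = W B k"
proof (intro equalityI subsetI)
  fix x assume "x \<in> (\<lambda>v. M *v v) ` W B k"
  then show "x \<in> W B k" by (auto simp: W_def M_linear split: if_splits)
next
  fix x assume x: "x \<in> W B k"
  obtain y where y: "x = M *v y" using M_surj by metis
  have "y \<in> W B k"
  proof (cases "k = -2")
    case True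
    then obtain c where "M *v y = M *v (c *s gen B)" using x y by (auto simp: M_linear)
    then show ?thesis using True by (auto simp: M_inj)
  next
    case False
    have "M *v y = 0 \<Longrightarrow> y = 0" using M_inj[of y 0] by simp
    then show ?thesis using x False unfolding y by (auto simp: W_def split: if_splits)
  qed
  then show "x \<in> (\<lambda>v. M *v v) ` W B k" using y by blast
qed

lemma M_set_plus: "(\<lambda>v. M *v v) ` (S + T) = (\<lambda>v. M *v v) ` S + (\<lambda>v. M *v v) ` T"
  by (force simp: set_plus_def M_linear)

lemma M_vcnj_image: "vcnj ` (\<lambda>v. M *v v) ` S = (\<lambda>v. M *v v) ` vcnj ` S"
  by (simp add: image_image M_vcnj)

lemma gr_filt_act: "gr_filt (W B) (act M F) k p = (\<lambda>v. M *v v) ` gr_filt (W B) F k p"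
proof -
  have "(\<lambda>v. M *v v) ` F p \<inter> W B k = (\<lambda>v. M *v v) ` (F p \<inter> W B k)"
    using M_W[of k] image_Int[OF bij_is_inj[OF M_bij], of "F p" "W B k"] by simp
  then show ?thesis by (simp add: gr_filt_def act_def M_set_plus M_W)
qed

end

locale biext_aut_hodge = biext_aut B M + biext_hodge B F
  for B :: "'n::finite biext_lattice" and M F
begin

lemma act_mhs: "mhs (W B) (act M F)"
  unfolding mhs_def
proof (intro conjI allI)
  note inj = bij_is_inj[OF M_bij]
  show "vec.subspace (act M F p)" for p
    unfolding act_def by (rule vec_subspace_matrix_image[OF subspace_F])
  show "antimono (act M F)" unfolding monotone_def act_def using F_mono by blast
  obtain p q where p: "F p = UNIV" and q: "F q = {0}" using F_bounds by blast
  have "act M F p = UNIV" using p bij_is_surj[OF M_bij] by (simp add: act_def)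
  then show "\<exists>p. act M F p = UNIV" ..
  have "act M F q = {0}" using q by (simp add: act_def)
  then show "\<exists>p. act M F p = {0}" ..
  have h: "gr_filt (W B) F k p + vcnj ` gr_filt (W B) F k (k + 1 - p) = W B k"
    "gr_filt (W B) F k p \<inter> vcnj ` gr_filt (W B) F k (k + 1 - p) = W B (k - 1)" for k p
    using hodge unfolding biext_mhs_def mhs_def by blast+
  show "gr_filt (W B) (act M F) k p + vcnj ` gr_filt (W B) (act M F) k (k + 1 - p) = W B k" for k p
    using arg_cong[OF h(1), of "image (\<lambda>v. M *v v)" k p]
    by (simp add: gr_filt_act M_vcnj_image M_set_plus M_W)
  show "gr_filt (W B) (act M F) k p \<inter> vcnj ` gr_filt (W B) (act M F) k (k + 1 - p) = W B (k - 1)" for k p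
    using arg_cong[OF h(2), of "image (\<lambda>v. M *v v)" k p]
    by (simp add: gr_filt_act M_vcnj_image image_Int[OF inj] M_W)
qed

lemma act_polarized: "polarized B (act M F)"
proof -
  have ker: "gr0 B x = 0" if "x \<in> gr_filt (W B) F (-1) p" for x p
    using that by (auto simp: gr_filt_1 gr0_add gr0_scale)
  have pol: "polarized B F" using hodge by (simp add: biext_mhs_def)
  show ?thesis
    unfolding polarized_def gr_filt_act
  proof (intro conjI allI ballI impI)
    fix p x y assume "x \<in> (\<lambda>v. M *v v) ` gr_filt (W B) F (- 1) p" "y \<in> (\<lambda>v. M *v v) ` gr_filt (W B) F (- 1) (- p)"
    then show "pol B x y = 0" using pol M_pol ker unfolding polarized_def by auto
  next
    fix p q x
    assume x: "x \<in> (\<lambda>v. M *v v) ` gr_filt (W B) F (-1) p \<inter> vcnj ` (\<lambda>v. M *v v) ` gr_filt (W B) F (-1) q"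
      and pq: "p + q = -1 \<and> x \<notin> W B (-2)"
    then obtain y where y: "x = M *v y" "y \<in> gr_filt (W B) F (-1) p" by blast
    obtain z where z: "x = M *v z" "z \<in> vcnj ` gr_filt (W B) F (-1) q"
      using x unfolding M_vcnj_image by blast
    then have "z = y" using y(1) M_inj[of z y] by simp
    with z have yy: "y \<in> gr_filt (W B) F (-1) p \<inter> vcnj ` gr_filt (W B) F (-1) q" using y by blast
    have "y \<notin> W B (-2)" using pq M_W[of "-2"] y(1) by blast
    then have "\<i> powi (p - q) * pol B y (vcnj y) \<in> \<real> \<and> 0 < Re (\<i> powi (p - q) * pol B y (vcnj y))"
      using pol yy pq unfolding polarized_def by blast
    moreover have "pol B x (vcnj x) = pol B y (vcnj y)"
      using M_pol[of y "vcnj y"] ker[OF y(2)] by (simp add: y(1) M_vcnj)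
    ultimately show "\<i> powi (p - q) * pol B x (vcnj x) \<in> \<real>" "0 < Re (\<i> powi (p - q) * pol B x (vcnj x))"
      by simp_all
  qed
qed

lemma act_biext_mhs: "biext_mhs B (act M F)"
  using hodge act_mhs act_polarized unfolding biext_mhs_def gr_filt_act by (metis M_W)

text \<open>A lattice automorphism is real and fixes \<open>gen B\<close>, so it carries lift to
  lift. Hence \<delta> is a function on the curve, independent of the flat frame.\<close>

lemma act_hdelta: "hdelta (act M F) = hdelta F"
proof -
  interpret F': biext_hodge B "act M F" by unfold_locales (rule act_biext_mhs)
  have e: "M *v hlift F - vcnj (M *v hlift F) = (2 * \<i> * of_real (hdelta F)) *s gen B"
    using arg_cong[OF hdelta, of "\<lambda>v. M *v v"] by (simp add: M_vcnj M_linear)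
  have "hlift (act M F) = M *v hlift F"
    by (rule F'.hlift_eqI[OF _ _ e]) (use hlift in \<open>auto simp: act_def\<close>)
  then show ?thesis using F'.hdelta_eqI e by simp
qed

text \<open>The retraction is composed with the inverse of \<open>M\<close>, which again preserves
  the lattice and \<open>gen B\<close>, while Q is invariant.\<close>

lemma act_self_dual_at:
  assumes "self_dual_at F"
  shows "self_dual_at (act M F)"
  unfolding self_dual_at_def
proof (intro ballI impI)
  fix vF vZ assume v: "vF \<in> act M F 0" "vZ \<in> VZ" "gr0 B vF = 1" "gr0 B vZ = 1"
  obtain uF where uF: "vF = M *v uF" "uF \<in> F 0" using v by (auto simp: act_def)
  obtain uZ where uZ: "vZ = M *v uZ" using M_surj by metis
  have "gr0 B uF = 1" "uZ \<in> VZ" "gr0 B uZ = 1" using v uF uZ M_VZ by auto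
  then obtain r where r: "integral_retraction r" "\<forall>\<beta> \<in> F 0. gr0 B \<beta> = 0 \<longrightarrow> qf \<beta> (uF - uZ) = - r \<beta>"
    using assms uF(2) unfolding self_dual_at_def by blast
  define N where "N = inv (\<lambda>v. M *v v)"
  have MN: "M *v N v = v" and NM: "N (M *v v) = v" for v
    using bij_is_surj[OF M_bij] bij_is_inj[OF M_bij] by (simp_all add: N_def surj_f_inv_f)
  have Nlin: "N (x + y) = N x + N y" "N (c *s x) = c *s N x" for x y c
    using M_inj MN by (metis M_linear)+
  interpret r: Vector_Spaces.linear "(*s)" "(*)" r using r by (simp add: integral_retraction_def)
  have "integral_retraction (\<lambda>x. r (N x))"
    unfolding integral_retraction_def
  proof (intro conjI ballI impI)
    show "clinear (\<lambda>x. r (N x))" by (rule clinearI) (simp_all add: Nlin r.add r.scale)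
    show "r (N (gen B)) = 1" using r NM[of "gen B"] by (simp add: integral_retraction_def)
    fix x assume "x \<in> VZ" "gr0 B x = 0"
    then have "N x \<in> VZ" "gr0 B (N x) = 0" using M_VZ[of "N x"] M_gr0[of "N x"] by (simp_all add: MN)
    then show "r (N x) \<in> \<int>" using r by (simp add: integral_retraction_def)
  qed
  moreover have "qf \<beta> (vF - vZ) = - r (N \<beta>)" if b: "\<beta> \<in> act M F 0" "gr0 B \<beta> = 0" for \<beta>
  proof -
    obtain b where b': "\<beta> = M *v b" "b \<in> F 0" using b by (auto simp: act_def)
    then have "qf \<beta> (vF - vZ) = qf b (uF - uZ)"
      using M_qf[of b "uF - uZ"] b v uF uZ by (simp add: M_linear gr0_diff)
    then show ?thesis using r(2) b' b by (simp add: NM)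
  qed
  ultimately show "\<exists>r. integral_retraction r \<and> (\<forall>\<beta>\<in>act M F 0. gr0 B \<beta> = 0 \<longrightarrow> qf \<beta> (vF - vZ) = - r \<beta>)"
    by blast
qed

end

section \<open>Local variation of the Hodge lift\<close>

context biext_hodge begin

text \<open>The decomposition \<open>V = F\<^sup>0 \<oplus> cnj (F\<^sup>0 \<inter> W\<^sub>-\<^sub>1) \<oplus> W\<^sub>-\<^sub>2\<close>.\<close>

lemma triple_decomposition:
  "\<exists>!(a, b, c). v = a + vcnj b + c *s gen B \<and> a \<in> F 0 \<and> b \<in> F 0 \<and> gr0 B b = 0"
proof -
  obtain v' where v: "v = gr0 B v *s hlift F + v'" and v': "gr0 B v' = 0" using hlift_decompose by metis
  obtain a b c where ab: "a \<in> F 0" "gr0 B a = 0" "b \<in> F 0" "gr0 B b = 0" "v' = a + vcnj b + c *s gen B"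
    using opposed_sum[OF v', of 0] by auto
  have ex: "v = (gr0 B v *s hlift F + a) + vcnj b + c *s gen B"
    using v ab(5) by (simp add: add.assoc)
  have exF: "gr0 B v *s hlift F + a \<in> F 0" using ab hlift by (simp add: F_closed)
  have uniq: "a1 = a2 \<and> b1 = b2 \<and> c1 = c2"
    if 1: "v = a1 + vcnj b1 + c1 *s gen B" "a1 \<in> F 0" "b1 \<in> F 0" "gr0 B b1 = 0"
      and 2: "v = a2 + vcnj b2 + c2 *s gen B" "a2 \<in> F 0" "b2 \<in> F 0" "gr0 B b2 = 0" for a1 b1 c1 a2 b2 c2
  proof -
    have "gr0 B a1 = gr0 B a2"
      using arg_cong[OF trans[OF 1(1)[symmetric] 2(1)], of "gr0 B"] 1 2 by (simp add: gr0_add gr0_scale)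
    then have g: "gr0 B (a1 - a2) = 0" by (simp add: gr0_diff)
    have "(a1 - a2) - vcnj (b2 - b1) = (a1 + vcnj b1) - (a2 + vcnj b2)" by (simp add: algebra_simps)
    also have "a1 + vcnj b1 = v - c1 *s gen B" using 1(1) by simp
    also have "a2 + vcnj b2 = v - c2 *s gen B" using 2(1) by simp
    finally have eq: "(a1 - a2) - vcnj (b2 - b1) = (c2 - c1) *s gen B"
      by (simp add: vec.scale_left_diff_distrib)
    have a: "a1 - a2 = 0"
      by (rule opposed_zero[OF _ g _ _ eq]) (use 1 2 in \<open>auto simp: F_closed gr0_diff\<close>)
    then have "vcnj (b1 - b2) = (c2 - c1) *s gen B" using eq by (simp add: algebra_simps)
    then have b: "b1 - b2 = cnj (c2 - c1) *s gen B" by (metis vcnj_eq_iff vcnj_simps(4) vcnj_gen complex_cnj_cnj)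
    have "cnj (c2 - c1) *s gen B \<in> F 0" unfolding b[symmetric] using 1 2 by (simp add: F_closed)
    then have "cnj (c2 - c1) = 0" by (rule gen_F0[OF order.refl])
    then show ?thesis using a b by auto
  qed
  show ?thesis
  proof (rule ex1I[of _ "(gr0 B v *s hlift F + a, b, c)"])
    show "case (gr0 B v *s hlift F + a, b, c) of
      (a, b, c) \<Rightarrow> v = a + vcnj b + c *s gen B \<and> a \<in> F 0 \<and> b \<in> F 0 \<and> gr0 B b = 0"
      unfolding prod.case using ex exF ab(3,4) by blast
    fix t assume t: "case t of (a, b, c) \<Rightarrow> v = a + vcnj b + c *s gen B \<and> a \<in> F 0 \<and> b \<in> F 0 \<and> gr0 B b = 0"
    obtain a2 b2 c2 where t2: "t = (a2, b2, c2)" by (cases t)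
    from t have "v = a2 + vcnj b2 + c2 *s gen B" "a2 \<in> F 0" "b2 \<in> F 0" "gr0 B b2 = 0"
      unfolding t2 prod.case by blast+
    from uniq[OF this ex exF ab(3,4)] show "t = (gr0 B v *s hlift F + a, b, c)" unfolding t2 by blast
  qed
qed

definition "triple v = (THE (a, b, c). v = a + vcnj b + c *s gen B \<and> a \<in> F 0 \<and> b \<in> F 0 \<and> gr0 B b = 0)"

text \<open>\<open>PB\<close> returns the element of F^0 whose conjugate occurs in the
  decomposition, so it is conjugate-linear. Composed with a linear frame and conjugated it becomes
  complex linear again.\<close>

definition "PA v = fst (triple v)"
definition "PB v = fst (snd (triple v))"
definition "PC v = snd (snd (triple v))"

lemma triple: "v = PA v + vcnj (PB v) + PC v *s gen B" "PA v \<in> F 0" "PB v \<in> F 0" "gr0 B (PB v) = 0"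
  using theI'[OF triple_decomposition[of v]]
  by (auto simp: PA_def PB_def PC_def triple_def[symmetric] split: prod.splits)

lemma triple_eq:
  assumes "v = a + vcnj b + c *s gen B" "a \<in> F 0" "b \<in> F 0" "gr0 B b = 0"
  shows "PA v = a" "PB v = b" "PC v = c"
proof -
  have "triple v = (a, b, c)"
    unfolding triple_def by (rule the1_equality[OF triple_decomposition]) (use assms in simp)
  then show "PA v = a" "PB v = b" "PC v = c" by (simp_all add: PA_def PB_def PC_def)
qed

lemma triple_add: "PA (u + v) = PA u + PA v" "PB (u + v) = PB u + PB v" "PC (u + v) = PC u + PC v"
proof -
  have "u + v = (PA u + PA v) + vcnj (PB u + PB v) + (PC u + PC v) *s gen B"
    by (subst triple(1)[of u], subst triple(1)[of v]) (simp add: vec.scale_left_distrib ac_simps)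
  from triple_eq[OF this] show "PA (u + v) = PA u + PA v" "PB (u + v) = PB u + PB v" "PC (u + v) = PC u + PC v"
    using triple[of u] triple[of v] by (simp_all add: F_closed gr0_add)
qed

lemma triple_scale: "PA (k *s v) = k *s PA v" "PB (k *s v) = cnj k *s PB v" "PC (k *s v) = k * PC v"
proof -
  have "k *s v = k *s PA v + vcnj (cnj k *s PB v) + (k * PC v) *s gen B"
    by (subst triple(1)[of v]) (simp add: vec.scale_right_distrib)
  from triple_eq[OF this] show "PA (k *s v) = k *s PA v" "PB (k *s v) = cnj k *s PB v" "PC (k *s v) = k * PC v"
    using triple[of v] by (simp_all add: F_closed gr0_scale)
qed

lemma PA_gr0: "gr0 B (PA v) = gr0 B v"
  using arg_cong[OF triple(1)[of v], of "gr0 B"] triple(4)[of v] by (simp add: gr0_add gr0_scale)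

lemma PA_id: "x \<in> F 0 \<Longrightarrow> PA x = x"
  by (rule triple_eq[of x x 0 0]) (auto simp: vec.subspace_0[OF subspace_F])

end

text \<open>The coordinates of \<open>P v\<close> in the frame at \<open>z\<close> are kept fixed
  and used with the frame at \<open>w\<close>; this extends \<open>P\<close> to a family of linear
  maps into the moving fibres.\<close>

lemma holomorphic_filtration_frame:
  fixes Fam :: "complex \<Rightarrow> 'n::finite filtration"
  assumes Fam: "holomorphic_filtration \<Omega> Fam" and z: "z \<in> \<Omega>"
    and P: "vlinear P" "\<And>v. P v \<in> Fam z p"
  obtains N A where "open N" "z \<in> N" "N \<subseteq> \<Omega>" "\<And>w. w \<in> N \<Longrightarrow> vlinear (A w)"
    "\<And>w v. w \<in> N \<Longrightarrow> A w v \<in> Fam w p" "\<And>v. vholomorphic_on (\<lambda>w. A w v) N" "\<And>v. A z v = P v"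
proof -
  from Fam[unfolded holomorphic_filtration_def, rule_format, OF z, of p]
  obtain N d b where N: "open N" "z \<in> N" "N \<subseteq> \<Omega>" and hol: "\<forall>i<d. vholomorphic_on (b i) N"
    and b: "\<forall>w \<in> N. inj_on (\<lambda>i. b i w) {..<d} \<and> vec.independent ((\<lambda>i. b i w) ` {..<d::nat}) \<and>
           Fam w p = vec.span ((\<lambda>i. b i w) ` {..<d})" by blast
  let ?b = "(\<lambda>i. b i z) ` {..<d}"
  have inj: "inj_on (\<lambda>i. b i z) {..<d}" and ind: "vec.independent ?b" and span: "Fam z p = vec.span ?b"
    using b N by auto
  define l where "l i v = vec.representation ?b (P v) (b i z)" for i v
  define A where "A w v = (\<Sum>i<d. l i v *s b i w)" for w v
  have Ps: "P v \<in> vec.span ?b" for v using P span by auto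
  interpret P: Vector_Spaces.linear "(*s)" "(*s)" P by fact
  have l: "l i (u + v) = l i u + l i v" "l i (k *s v) = k * l i v" for i u v k
    unfolding l_def P.add P.scale
    by (simp_all add: vec.representation_add[OF ind Ps Ps] vec.representation_scale[OF ind Ps])
  show ?thesis
  proof (rule that[OF N])
    show "vlinear (A w)" for w
      by (rule vlinearI) (simp_all add: A_def l vec.scale_left_distrib sum.distrib vec.scale_sum_right)
    show "A w v \<in> Fam w p" if "w \<in> N" for w v
    proof -
      have "Fam w p = vec.span ((\<lambda>i. b i w) ` {..<d})" using b that by blast
      moreover have "A w v \<in> vec.span ((\<lambda>i. b i w) ` {..<d})"
        unfolding A_def by (rule vec.span_sum, rule vec.span_scale, rule vec.span_base) simp
      ultimately show ?thesis by simp
    qed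
    show "vholomorphic_on (\<lambda>w. A w v) N" for v
      using hol unfolding vholomorphic_on_def A_def by (auto intro!: holomorphic_intros)
    show "A z v = P v" for v
    proof -
      have "A z v = (\<Sum>x\<in>?b. vec.representation ?b (P v) x *s x)"
        unfolding A_def l_def by (simp add: sum.reindex[OF inj])
      then show ?thesis using vec.sum_representation_eq[OF ind Ps] by simp
    qed
  qed
qed

section \<open>Families over a coordinate domain and regularity of the lift\<close>

locale biext_family = biext B for B :: "'n::finite biext_lattice" +
  fixes \<Omega> :: "complex set" and Fam :: "complex \<Rightarrow> 'n filtration"
  assumes open_domain: "open \<Omega>"
    and fibre: "w \<in> \<Omega> \<Longrightarrow> biext_mhs B (Fam w)"
    and holomorphic: "holomorphic_filtration \<Omega> Fam"
    and transversal: "griffiths_transversal \<Omega> Fam"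
    and self_dual_fibre: "w \<in> \<Omega> \<Longrightarrow> self_dual_at (Fam w)"
begin

lemma fibre_hodge: "w \<in> \<Omega> \<Longrightarrow> biext_hodge B (Fam w)"
  using fibre by unfold_locales

text \<open>The extended projection is normalised so that it preserves the class in gr_0; then it
  maps W_-1 into F^0 \<inter> W_-1 at all nearby points.\<close>

lemma adapted_frame:
  assumes z: "z \<in> \<Omega>"
  obtains N A where "open N" "z \<in> N" "N \<subseteq> \<Omega>" "\<And>w. w \<in> N \<Longrightarrow> vlinear (A w)"
    "\<And>w v. w \<in> N \<Longrightarrow> A w v \<in> Fam w 0" "\<And>v. vholomorphic_on (\<lambda>w. A w v) N"
    "\<And>v. A z v = biext_hodge.PA B (Fam z) v" "\<And>w v. w \<in> N \<Longrightarrow> gr0 B (A w v) = gr0 B v"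
proof -
  interpret h: biext_hodge B "Fam z" by (rule fibre_hodge[OF z])
  have "vlinear h.PA" by (rule vlinearI) (simp_all add: h.triple_add h.triple_scale)
  from holomorphic_filtration_frame[OF holomorphic z this h.triple(2)]
  obtain N A where N: "open N" "z \<in> N" "N \<subseteq> \<Omega>" and lin: "\<And>w. w \<in> N \<Longrightarrow> vlinear (A w)"
    and AF: "\<And>w v. w \<in> N \<Longrightarrow> A w v \<in> Fam w 0" and hol: "\<And>v. vholomorphic_on (\<lambda>w. A w v) N"
    and Az: "\<And>v. A z v = h.PA v" by metis
  let ?e = "hlift (Fam z)"
  define s where "s w = gr0 B (A w ?e)" for w
  have gr0_hol: "(\<lambda>w. gr0 B (A w v)) holomorphic_on N" for v
  proof -
    have "(\<lambda>w. \<Sum>i\<in>UNIV. A w v $ i * gr0 B (axis i 1)) holomorphic_on N"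
      using hol[of v] unfolding vholomorphic_on_def by (intro holomorphic_intros) auto
    then show ?thesis by (simp add: clinear_expansion[OF gr0_linear, symmetric])
  qed
  have s_hol: "s holomorphic_on N" unfolding s_def by (rule gr0_hol)
  have sz: "s z = 1" unfolding s_def Az h.PA_gr0 by (rule h.hlift)
  have N': "open {w \<in> N. s w \<noteq> 0}"
    using continuous_open_preimage[OF holomorphic_on_imp_continuous_on[OF s_hol] N(1) open_Compl[OF closed_singleton[of 0]]]
    by (simp add: vimage_def Int_def)
  \<comment> \<open>The error in gr_0 is repaired by a multiple of the section through the lift at
    \<open>z\<close>, whose class \<open>s w\<close> is 1 at \<open>z\<close> and hence invertible
    nearby. At \<open>z\<close> the error vanishes because \<open>PA\<close> preserves
    \<open>gr0 B\<close>.\<close>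
  define A' where "A' w v = A w v + ((gr0 B v - gr0 B (A w v)) / s w) *s A w ?e" for w v
  show ?thesis
  proof (rule that[OF N'])
    show "z \<in> {w \<in> N. s w \<noteq> 0}" "{w \<in> N. s w \<noteq> 0} \<subseteq> \<Omega>" using N sz by auto
    fix w assume w: "w \<in> {w \<in> N. s w \<noteq> 0}"
    then have wO: "w \<in> \<Omega>" using N by auto
    interpret A: Vector_Spaces.linear "(*s)" "(*s)" "A w" using lin w by auto
    interpret hw: biext_hodge B "Fam w" by (rule fibre_hodge[OF wO])
    show "vlinear (A' w)"
    proof (rule vlinearI)
      fix x y c
      have "(gr0 B (x + y) - gr0 B (A w (x + y))) / s w = (gr0 B x - gr0 B (A w x)) / s w + (gr0 B y - gr0 B (A w y)) / s w"
        by (simp add: A.add gr0_add add_divide_distrib[symmetric])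
      then show "A' w (x + y) = A' w x + A' w y"
        unfolding A'_def by (simp only: A.add vec.scale_left_distrib ac_simps)
      have "(gr0 B (c *s x) - gr0 B (A w (c *s x))) / s w = c * ((gr0 B x - gr0 B (A w x)) / s w)"
        by (simp only: A.scale gr0_scale right_diff_distrib times_divide_eq_right)
      then show "A' w (c *s x) = c *s A' w x"
        unfolding A'_def by (simp only: A.scale vec.scale_right_distrib vec.scale_scale)
    qed
    show "A' w v \<in> Fam w 0" for v
      unfolding A'_def using AF w by (simp add: hw.F_closed)
    show "gr0 B (A' w v) = gr0 B v" for v
      using w by (simp add: A'_def gr0_add gr0_scale s_def)
  next
    fix v
    have sub: "{w \<in> N. s w \<noteq> 0} \<subseteq> N" by auto
    note [holomorphic_intros] = holomorphic_on_subset[OF gr0_hol sub] holomorphic_on_subset[OF s_hol sub]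
    have "(\<lambda>w. A w x $ i) holomorphic_on {w \<in> N. s w \<noteq> 0}" for x i
      using holomorphic_on_subset[OF _ sub] hol[of x] by (auto simp: vholomorphic_on_def)
    note [holomorphic_intros] = this
    show "vholomorphic_on (\<lambda>w. A' w v) {w \<in> N. s w \<noteq> 0}"
      unfolding vholomorphic_on_def A'_def vector_add_component vector_smult_component
      by (intro allI holomorphic_intros) auto
    show "A' z v = h.PA v"
      by (simp add: A'_def Az h.PA_gr0)
  qed
qed

text \<open>The decomposition at \<open>z\<close>, with the projection to F^0 replaced by the moving
  frame \<open>A w\<close>, gives linear maps that are the identity at \<open>z\<close>. Solving
  with them decomposes vectors along the fibre at \<open>w\<close>, with dependence on
  \<open>w\<close> inside the class \<open>real_analv\<close>.\<close>

lemma lift_local: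
  assumes z: "z \<in> \<Omega>"
  obtains r A x where "r > 0" "ball z r \<subseteq> \<Omega>" "\<And>w. w \<in> ball z r \<Longrightarrow> vlinear (A w)"
    "\<And>w v. w \<in> ball z r \<Longrightarrow> A w v \<in> Fam w 0" "\<And>v. vholomorphic_on (\<lambda>w. A w v) (ball z r)"
    "\<And>w v. w \<in> ball z r \<Longrightarrow> gr0 B (A w v) = gr0 B v"
    "\<And>b. real_analv (ball z r) b \<Longrightarrow> \<exists>y. real_analv (ball z r) y \<and> (\<forall>w\<in>ball z r. gr0 B (y w) = gr0 B (b w) \<and>
       b w = A w (y w) + vcnj (A w (biext_hodge.PB B (Fam z) (y w))) + biext_hodge.PC B (Fam z) (y w) *s gen B)"
    "real_analv (ball z r) x" "\<And>w. w \<in> ball z r \<Longrightarrow> hlift (Fam w) = A w (x w)"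
proof -
  interpret h: biext_hodge B "Fam z" by (rule fibre_hodge[OF z])
  obtain N A where N: "open N" "z \<in> N" "N \<subseteq> \<Omega>"
    and lin: "\<And>w. w \<in> N \<Longrightarrow> vlinear (A w)"
    and AF: "\<And>w v. w \<in> N \<Longrightarrow> A w v \<in> Fam w 0" and hol: "\<And>v. vholomorphic_on (\<lambda>w. A w v) N"
    and Az: "\<And>v. A z v = h.PA v" and gA: "\<And>w v. w \<in> N \<Longrightarrow> gr0 B (A w v) = gr0 B v"
    by (rule adapted_frame[OF z]) (rule that)
  define T where "T w v = A w v + vcnj (A w (h.PB v)) + h.PC v *s gen B" for w v
  have T_lin: "vlinear (T w)" if "w \<in> N" for w
  proof -
    interpret A: Vector_Spaces.linear "(*s)" "(*s)" "A w" using lin that by auto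
    show ?thesis
    proof (rule vlinearI)
      show "T w (x + y) = T w x + T w y" for x y
        by (simp add: T_def A.add h.triple_add vec.scale_left_distrib ac_simps)
      show "T w (c *s x) = c *s T w x" for x c
        by (simp add: T_def A.scale h.triple_scale vec.scale_right_distrib)
    qed
  qed
  have T_anal: "real_analv N (\<lambda>w. T w v)" for v
    unfolding T_def by (intro real_analv_add real_analv_vcnj real_analv_const real_analv_holomorphic hol)
  have T_z: "T z v = v" for v
    using h.triple[of v] by (simp add: T_def Az h.PA_id)
  have T_gr0: "gr0 B (T w v) = gr0 B v" if "w \<in> N" for w v
    using h.triple(4)[of v] by (simp add: T_def gr0_add gr0_scale gA that)
  obtain r where r: "r > 0" "ball z r \<subseteq> N"
    and solve: "\<And>b. real_analv (ball z r) b \<Longrightarrow> \<exists>y. real_analv (ball z r) y \<and> (\<forall>w\<in>ball z r. T w (y w) = b w)"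
    by (rule real_analv_solve[OF N(1,2) T_lin T_anal T_z], assumption) (rule that)
  have sol: "\<exists>y. real_analv (ball z r) y \<and> (\<forall>w\<in>ball z r. gr0 B (y w) = gr0 B (b w) \<and>
       b w = A w (y w) + vcnj (A w (h.PB (y w))) + h.PC (y w) *s gen B)" if b: "real_analv (ball z r) b" for b
  proof -
    obtain y where y: "real_analv (ball z r) y" "\<forall>w\<in>ball z r. T w (y w) = b w" using solve[OF b] by blast
    have "gr0 B (y w) = gr0 B (b w) \<and> b w = A w (y w) + vcnj (A w (h.PB (y w))) + h.PC (y w) *s gen B"
      if w: "w \<in> ball z r" for w
    proof -
      have "T w (y w) = b w" "w \<in> N" using y w r by auto
      then show ?thesis using T_gr0[of w "y w"] by (metis T_def)
    qed
    then show ?thesis using y by blast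
  qed
  define e0 where "e0 = hlift (Fam z)"
  \<comment> \<open>\<open>A w e0\<close> is a lift of 1 in F^0 but in general not the Hodge lift.
    The F^0-part of its conjugate is the Hodge lift, as shown next.\<close>
  have "real_analv (ball z r) (\<lambda>w. vcnj (A w e0))"
    by (rule real_analv_subset[OF _ r(2)]) (intro real_analv_vcnj real_analv_holomorphic hol)
  from sol[OF this] obtain x where x: "real_analv (ball z r) x"
    and xw: "\<forall>w\<in>ball z r. gr0 B (x w) = gr0 B (vcnj (A w e0)) \<and>
       vcnj (A w e0) = A w (x w) + vcnj (A w (h.PB (x w))) + h.PC (x w) *s gen B" by blast
  have lift: "hlift (Fam w) = A w (x w)" if w: "w \<in> ball z r" for w
  proof -
    have wN: "w \<in> N" and wO: "w \<in> \<Omega>" using w r N by auto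
    interpret hw: biext_hodge B "Fam w" by (rule fibre_hodge[OF wO])
    let ?e = "A w (x w)" and ?e' = "A w e0 - A w (h.PB (x w))"
    define c where "c = h.PC (x w)"
    have e: "?e \<in> Fam w 0" "gr0 B ?e = 1" and e': "?e' \<in> Fam w 0" "gr0 B ?e' = 1"
      using AF[OF wN] gA[OF wN] xw w h.triple(4) h.hlift(2)
      by (simp_all add: hw.F_closed gr0_diff e0_def)
    have "vcnj (A w e0) = ?e + vcnj (A w (h.PB (x w))) + c *s gen B"
      using xw w unfolding c_def by blast
    then have ee: "vcnj ?e' = ?e + c *s gen B" by simp
    then have ee2: "?e' = vcnj ?e + cnj c *s gen B" by (metis vcnj_eq_iff vcnj_simps(1,4) vcnj_gen)
    \<comment> \<open>\<open>?e\<close> and the conjugate of \<open>?e'\<close> agree modulo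
      \<open>gen B\<close>, so \<open>?e - ?e'\<close> equals minus its own conjugate modulo
      \<open>gen B\<close> and is 0 by opposedness. Thus \<open>?e\<close> is real modulo
      \<open>gen B\<close>.\<close>
    have "(?e - ?e') - vcnj (- (?e - ?e')) = (?e - vcnj ?e') + (vcnj ?e - ?e')" by simp
    also have "\<dots> = (- c - cnj c) *s gen B"
      unfolding ee by (subst ee2) (simp add: vec.scale_left_diff_distrib)
    finally have "?e - ?e' = 0"
      by (rule hw.opposed_zero[rotated 4]) (use e e' in \<open>simp_all add: hw.F_closed gr0_diff gr0_neg\<close>)
    then have "?e' = ?e" by simp
    then have "?e = vcnj ?e + cnj c *s gen B" using ee2 by metis
    then have "?e - vcnj ?e = cnj c *s gen B" by (metis add_diff_cancel_left')
    then show ?thesis by (rule hw.hlift_eqI[OF e])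
  qed
  show ?thesis
  proof (rule that[OF r(1)])
    show "ball z r \<subseteq> \<Omega>" using r N by blast
    show "vlinear (A w)" if "w \<in> ball z r" for w using lin r that by blast
    show "A w v \<in> Fam w 0" if "w \<in> ball z r" for w v using AF r that by blast
    show "gr0 B (A w v) = gr0 B v" if "w \<in> ball z r" for w v using gA r that by blast
    show "vholomorphic_on (\<lambda>w. A w v) (ball z r)" for v
      using hol[of v] r(2) unfolding vholomorphic_on_def by (meson holomorphic_on_subset)
  qed (fact sol x lift)+
qed

end

section \<open>Local constancy of integral retractions\<close>

lemma integer_valued_constant:
  fixes f :: "complex \<Rightarrow> complex"
  assumes "connected S" "continuous_on S f" "\<And>x. x \<in> S \<Longrightarrow> f x \<in> \<int>" "x \<in> S" "y \<in> S"
  shows "f x = f y"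
proof -
  have "f constant_on S"
  proof (rule continuous_discrete_range_constant[OF assms(1,2)])
    fix x assume x: "x \<in> S"
    show "\<exists>e>0. \<forall>y. y \<in> S \<and> f y \<noteq> f x \<longrightarrow> e \<le> norm (f y - f x)"
    proof (intro exI[of _ 1] conjI allI impI)
      fix y assume y: "y \<in> S \<and> f y \<noteq> f x"
      then have "f y - f x \<in> \<int>" using assms(3) x by auto
      then obtain k where k: "f y - f x = of_int k" by (elim Ints_cases)
      then have "k \<noteq> 0" using y by auto
      then show "1 \<le> norm (f y - f x)" unfolding k by simp
    qed simp
  qed
  then show ?thesis using assms(4,5) by (auto simp: constant_on_def)
qed

context biext begin

lemma retraction_vcnj: "integral_retraction r \<Longrightarrow> gr0 B x = 0 \<Longrightarrow> r (vcnj x) = cnj (r x)"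
  by (rule functional_vcnj) (auto simp: integral_retraction_def)

lemma retraction_linear:
  assumes "integral_retraction r"
  shows "r (x + y) = r x + r y" "r (x - y) = r x - r y" "r (c *s x) = c * r x" "r (c *s gen B) = c"
proof -
  interpret r: Vector_Spaces.linear "(*s)" "(*)" r using assms by (simp add: integral_retraction_def)
  show "r (x + y) = r x + r y" "r (x - y) = r x - r y" "r (c *s x) = c * r x" "r (c *s gen B) = c"
    using assms by (simp_all add: r.add r.diff r.scale integral_retraction_def)
qed

text \<open>The integral vectors \<open>wbase i\<close> span W_-1.\<close>

lemma retraction_eq:
  assumes r: "integral_retraction r" "integral_retraction r'"
    and eq: "\<And>x. x \<in> VZ \<Longrightarrow> gr0 B x = 0 \<Longrightarrow> r x = r' x" and x: "gr0 B x = 0"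
  shows "r x = r' x"
proof -
  interpret r: Vector_Spaces.linear "(*s)" "(*)" r using r by (simp add: integral_retraction_def)
  interpret r': Vector_Spaces.linear "(*s)" "(*)" r' using r by (simp add: integral_retraction_def)
  have "r (\<Sum>i\<in>UNIV. x $ i *s wbase i) = r' (\<Sum>i\<in>UNIV. x $ i *s wbase i)"
    unfolding r.sum r'.sum r.scale r'.scale using eq wbase by simp
  then show ?thesis using wbase_expansion[OF x] by simp
qed

end

context biext_family begin

text \<open>Regularity of the lift, the position of its two derivatives in the filtration, and
  self-duality with one retraction for the whole ball.\<close>

lemma lift_calculus:
  assumes z: "z \<in> \<Omega>"
  defines "E \<equiv> (\<lambda>w. hlift (Fam w))"
  obtains r \<rho> where "r > 0" "ball z r \<subseteq> \<Omega>" "real_analv (ball z r) E" "integral_retraction \<rho>"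
    "\<And>w. w \<in> ball z r \<Longrightarrow> dzbarv E w \<in> Fam w 0" "\<And>w. w \<in> ball z r \<Longrightarrow> dzv E w \<in> Fam w (-1)"
    "\<And>w \<beta>. w \<in> ball z r \<Longrightarrow> \<beta> \<in> Fam w 0 \<Longrightarrow> gr0 B \<beta> = 0 \<Longrightarrow> qf \<beta> (E w - unit_lift) = - \<rho> \<beta>"
proof -
  interpret h: biext_hodge B "Fam z" by (rule fibre_hodge[OF z])
  obtain r A x where r: "r > 0" and sub: "ball z r \<subseteq> \<Omega>" and lin: "\<And>w. w \<in> ball z r \<Longrightarrow> vlinear (A w)"
    and AF: "\<And>w v. w \<in> ball z r \<Longrightarrow> A w v \<in> Fam w 0" and hol: "\<And>v. vholomorphic_on (\<lambda>w. A w v) (ball z r)"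
    and gA: "\<And>w v. w \<in> ball z r \<Longrightarrow> gr0 B (A w v) = gr0 B v"
    and solve: "\<And>b. real_analv (ball z r) b \<Longrightarrow> \<exists>y. real_analv (ball z r) y \<and> (\<forall>w\<in>ball z r. gr0 B (y w) = gr0 B (b w) \<and>
       b w = A w (y w) + vcnj (A w (h.PB (y w))) + h.PC (y w) *s gen B)"
    and x: "real_analv (ball z r) x" and lift: "\<And>w. w \<in> ball z r \<Longrightarrow> hlift (Fam w) = A w (x w)"
    by (rule lift_local[OF z]) (rule that)
  let ?D = "ball z r"
  have anal_A: "real_analv ?D (\<lambda>w. A w v)" for v by (rule real_analv_holomorphic[OF hol])
  have "real_analv ?D (\<lambda>w. A w (x w))" by (rule real_analv_family_apply[OF lin anal_A x])
  then have E: "real_analv ?D E"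
    unfolding real_analv_def E_def using lift by (metis (mono_tags, lifting) real_anal.cong)
  have derivs: "dzbarv E w \<in> Fam w 0" "dzv E w \<in> Fam w (-1)" if w: "w \<in> ?D" for w
  proof -
    have wO: "w \<in> \<Omega>" using w sub by auto
    interpret hw: biext_hodge B "Fam w" by (rule fibre_hodge[OF wO])
    let ?A = "\<lambda>i u. A u (axis i 1)" and ?x = "\<lambda>i u. x u $ i"
    have xd: "has_wd (?x i) (dz (?x i) w) (dzbar (?x i) w) w" for i
      using has_wd_real_anal[of ?D "?x i" w] x w by (simp add: real_analv_def)
    \<comment> \<open>All dependence on the conjugate variable sits in the scalar coefficients. The
      conjugate-derivative therefore combines sections of F^0, and the other derivative adds
      derivatives of holomorphic sections, which transversality puts into F^-1.\<close>
    have "has_wdv (\<lambda>u. \<Sum>i\<in>UNIV. ?x i u *s ?A i u)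
      (\<Sum>i\<in>UNIV. dz (?x i) w *s ?A i w + ?x i w *s vderiv (?A i) w)
      (\<Sum>i\<in>UNIV. dzbar (?x i) w *s ?A i w + ?x i w *s 0) w"
      by (intro has_wdv_sum has_wdv_scale xd has_wdv_holomorphic[OF hol open_ball w])
    moreover have "(\<Sum>i\<in>UNIV. ?x i u *s ?A i u) = E u" if "u \<in> ?D" for u
      unfolding E_def lift[OF that] using vlinear_expansion[OF lin[OF that], of "x u"] by simp
    ultimately have d: "has_wdv E (\<Sum>i\<in>UNIV. dz (?x i) w *s ?A i w + ?x i w *s vderiv (?A i) w)
      (\<Sum>i\<in>UNIV. dzbar (?x i) w *s ?A i w + ?x i w *s 0) w"
      using has_wdv_cong_open[OF _ open_ball w] by blast
    have d': "has_wdv E (dzv E w) (dzbarv E w) w"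
      by (rule real_analv_dz(3)[OF E open_ball w])
    have "vderiv (?A i) w \<in> Fam w (0 - 1)" for i
    proof -
      have "open ?D \<and> ?D \<subseteq> \<Omega> \<and> vholomorphic_on (?A i) ?D \<and> (\<forall>w\<in>?D. ?A i w \<in> Fam w 0)"
        using sub hol AF by auto
      then show ?thesis using transversal w unfolding griffiths_transversal_def by blast
    qed
    moreover have "?A i w \<in> Fam w (-1)" for i using hw.F_mono[of "-1" 0] AF[OF w] by simp
    ultimately show "dzv E w \<in> Fam w (-1)"
      unfolding has_wdv_unique(1)[OF d' d] by (intro vec.subspace_sum[OF hw.subspace_F] hw.F_closed) auto
    show "dzbarv E w \<in> Fam w 0"
      unfolding has_wdv_unique(2)[OF d' d]
      by (intro vec.subspace_sum[OF hw.subspace_F]) (simp add: hw.F_closed AF[OF w])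
  qed
  have "\<exists>\<rho>. integral_retraction \<rho> \<and> (\<forall>\<beta>\<in>Fam w 0. gr0 B \<beta> = 0 \<longrightarrow> qf \<beta> (E w - unit_lift) = - \<rho> \<beta>)" if w: "w \<in> ?D" for w
  proof -
    have wO: "w \<in> \<Omega>" using w sub by auto
    interpret hw: biext_hodge B "Fam w" by (rule fibre_hodge[OF wO])
    show ?thesis
      using self_dual_fibre[OF wO] hw.hlift unit_lift unfolding self_dual_at_def E_def by blast
  qed
  then obtain \<rho> where \<rho>: "\<And>w. w \<in> ?D \<Longrightarrow> integral_retraction (\<rho> w)"
    and \<rho>q: "\<And>w \<beta>. w \<in> ?D \<Longrightarrow> \<beta> \<in> Fam w 0 \<Longrightarrow> gr0 B \<beta> = 0 \<Longrightarrow> qf \<beta> (E w - unit_lift) = - \<rho> w \<beta>"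
    by metis
  have zD: "z \<in> ?D" using r by simp
  have const: "\<rho> w v = \<rho> z v" if w: "w \<in> ?D" and v: "v \<in> VZ" "gr0 B v = 0" for w v
  proof -
    obtain y where y: "real_analv ?D y" and yw: "\<forall>w\<in>?D. gr0 B (y w) = gr0 B v \<and>
       v = A w (y w) + vcnj (A w (h.PB (y w))) + h.PC (y w) *s gen B"
      using solve[OF real_analv_const[of _ v]] by blast
    \<comment> \<open>The value of the retraction at \<open>v\<close>, computed from the
      decomposition of \<open>v\<close>: self-duality on the F^0-part, its conjugate on the
      conjugate part, and the coefficient itself on \<open>gen B\<close>. No retraction occurs in
      it, so its continuity is visible.\<close>
    let ?f = "\<lambda>u. - qf (A u (y u)) (E u - unit_lift) - qf (vcnj (A u (h.PB (y u)))) (vcnj (E u - unit_lift)) + h.PC (y u)"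
    have f1: "real_analv ?D (\<lambda>u. A u (y u))" by (rule real_analv_family_apply[OF lin anal_A y])
    have f2: "real_analv ?D (\<lambda>u. vcnj (A u (h.PB (y u))))"
    proof (rule real_analv_family_apply[OF _ _ y])
      show "vlinear (\<lambda>v. vcnj (A u (h.PB v)))" if "u \<in> ?D" for u
      proof -
        interpret A: Vector_Spaces.linear "(*s)" "(*s)" "A u" by (rule lin[OF that])
        show ?thesis by (rule vlinearI) (simp_all add: h.triple_add h.triple_scale A.add A.scale)
      qed
      show "real_analv ?D (\<lambda>u. vcnj (A u (h.PB v)))" for v by (intro real_analv_vcnj anal_A)
    qed
    have f3: "real_anal ?D (\<lambda>u. h.PC (y u))"
      by (rule real_anal_clinear[OF _ y]) (rule clinearI, simp_all add: h.triple_add h.triple_scale)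
    have f4: "real_analv ?D (\<lambda>u. E u - unit_lift)" by (intro real_analv_diff E real_analv_const)
    have "real_anal ?D ?f"
      by (rule real_anal.add[OF real_anal_diff[OF real_anal_minus[OF real_anal_qf[OF f1 f4]]
            real_anal_qf[OF f2 real_analv_vcnj[OF f4]]] f3])
    then have cont: "continuous_on ?D ?f" by (rule real_anal_continuous) simp
    have eq: "?f u = \<rho> u v" if u: "u \<in> ?D" for u
    proof -
      have g: "gr0 B (A u (y u)) = 0" "gr0 B (A u (h.PB (y u))) = 0"
        using yw u v h.triple(4) by (simp_all add: gA)
      have "\<rho> u v = \<rho> u (A u (y u) + vcnj (A u (h.PB (y u))) + h.PC (y u) *s gen B)"
        using yw u by simp
      also have "\<dots> = \<rho> u (A u (y u)) + cnj (\<rho> u (A u (h.PB (y u)))) + h.PC (y u)"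
        by (simp only: retraction_linear(1,4)[OF \<rho>[OF u]] retraction_vcnj[OF \<rho>[OF u] g(2)])
      also have "\<rho> u (A u (y u)) = - qf (A u (y u)) (E u - unit_lift)"
        using \<rho>q[OF u AF[OF u] g(1)] by simp
      also have "\<rho> u (A u (h.PB (y u))) = - qf (A u (h.PB (y u))) (E u - unit_lift)"
        using \<rho>q[OF u AF[OF u] g(2)] by simp
      finally show ?thesis by (simp add: qf_vcnj del: vcnj_simps)
    qed
    have int: "?f u \<in> \<int>" if "u \<in> ?D" for u
      using \<rho>[OF that] v eq[OF that] by (simp add: integral_retraction_def)
    have "?f w = ?f z"
      by (rule integer_valued_constant[OF connected_ball cont int w zD])
    then show ?thesis using eq[OF w] eq[OF zD] by simp
  qed
  show ?thesis
  proof (rule that[OF r sub E \<rho>[OF zD] derivs])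
    fix w \<beta> assume w: "w \<in> ?D" and \<beta>: "\<beta> \<in> Fam w 0" "gr0 B \<beta> = 0"
    have "\<rho> w \<beta> = \<rho> z \<beta>" by (rule retraction_eq[OF \<rho>[OF w] \<rho>[OF zD] const[OF w] \<beta>(2)])
    then show "qf \<beta> (E w - unit_lift) = - \<rho> z \<beta>" using \<rho>q[OF w \<beta>] by simp
  qed
qed

text \<open>The vector \<tau> is the conjugate of \<beta>. The derivative of the lift is exposed
  together with \<tau> so that \<tau> can later be matched with the normal form.\<close>

lemma delta_curvature:
  assumes z: "z \<in> \<Omega>"
  defines "D \<equiv> (\<lambda>w. complex_of_real (hdelta (Fam w)))"
  obtains r where "r > 0" "ball z r \<subseteq> \<Omega>" "real_anal (ball z r) D"
    "\<And>w. w \<in> ball z r \<Longrightarrow> \<exists>\<tau> a b c. has_wdv (\<lambda>w. hlift (Fam w)) a b w \<and> a = \<tau> + c *s gen B \<and>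
       \<tau> \<in> Fam w (-1) \<and> gr0 B \<tau> = 0 \<and> vcnj \<tau> \<in> Fam w 0 \<and> dz (dzbar D) w = - \<i> * qf \<tau> (vcnj \<tau>)"
proof -
  obtain r \<rho> where r: "r > 0" and sub: "ball z r \<subseteq> \<Omega>" and lift: "real_analv (ball z r) (\<lambda>w. hlift (Fam w))"
      "integral_retraction \<rho>"
      "\<And>w. w \<in> ball z r \<Longrightarrow> dzbarv (\<lambda>w. hlift (Fam w)) w \<in> Fam w 0"
      "\<And>w. w \<in> ball z r \<Longrightarrow> dzv (\<lambda>w. hlift (Fam w)) w \<in> Fam w (-1)"
      "\<And>w \<beta>. w \<in> ball z r \<Longrightarrow> \<beta> \<in> Fam w 0 \<Longrightarrow> gr0 B \<beta> = 0 \<Longrightarrow> qf \<beta> (hlift (Fam w) - unit_lift) = - \<rho> \<beta>"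
    by (rule lift_calculus[OF z]) (rule that)
  define E where "E = (\<lambda>w. hlift (Fam w))"
  have E_app: "hlift (Fam w) = E w" for w by (simp add: E_def)
  note E = lift(1)[folded E_def] and \<rho> = lift(2) and Eb = lift(3)[folded E_def] and Ez = lift(4)[folded E_def]
    and \<rho>q = lift(5)[unfolded E_app]
  let ?N = "ball z r"
  have hw: "biext_hodge B (Fam w)" if "w \<in> ?N" for w using fibre_hodge sub that by blast
  have E1: "gr0 B (E w) = 1" if "w \<in> ?N" for w
    unfolding E_def by (rule biext_hodge.hlift(2)[OF hw[OF that]])
  have ED: "E w - vcnj (E w) = (2 * \<i> * D w) *s gen B" if "w \<in> ?N" for w
    unfolding E_def D_def by (rule biext_hodge.hdelta[OF hw[OF that]])
  \<comment> \<open>A nonzero coordinate of \<open>gen B\<close> recovers \<delta> from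
    \<open>E w - vcnj (E w)\<close>, so \<delta> inherits the regularity of the lift.\<close>
  obtain i where i: "gen B $ i \<noteq> 0" using gen_component by blast
  have Danal: "real_anal ?N D"
  proof (rule real_anal.cong)
    show "real_anal ?N (\<lambda>w. (E w - vcnj (E w)) $ i / (2 * \<i> * gen B $ i))"
      using real_analv_diff[OF E real_analv_vcnj[OF E]] i
      by (intro real_anal_divide real_anal_const) (auto simp: real_analv_def)
    show "(E w - vcnj (E w)) $ i / (2 * \<i> * gen B $ i) = D w" if "w \<in> ?N" for w
      unfolding ED[OF that] using i by simp
  qed
  note o = open_ball[of z r]
  have dE: "has_wdv E (dzv E w) (dzbarv E w) w" if "w \<in> ?N" for w by (rule real_analv_dz(3)[OF E o that])
  have dD: "has_wd D (dz D w) (dzbar D w) w" if "w \<in> ?N" for w by (rule has_wd_real_anal[OF Danal o that])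
  let ?b = "dzbarv E" and ?a = "dzv E"
  have b_anal: "real_analv ?N ?b" and a_anal: "real_analv ?N ?a" by (rule real_analv_dz[OF E o])+
  have gr0_b: "gr0 B (?b w) = 0" if w: "w \<in> ?N" for w
  proof -
    have 1: "has_wd (\<lambda>w. gr0 B (E w)) 0 0 w"
      by (rule has_wd_cong_open[OF has_wd_const o w]) (rule E1[symmetric])
    have 2: "has_wd (\<lambda>w. gr0 B (E w)) (gr0 B (?a w)) (gr0 B (?b w)) w"
      by (rule has_wd_clinear[OF gr0_linear dE[OF w]])
    show ?thesis using has_wd_unique(2)[OF 1 2] by simp
  qed
  have EDd: "?a w - vcnj (?b w) = (2 * \<i> * dz D w) *s gen B" "?b w - vcnj (?a w) = (2 * \<i> * dzbar D w) *s gen B"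
    if w: "w \<in> ?N" for w
  proof -
    have 1: "has_wdv (\<lambda>w. E w - vcnj (E w)) (?a w - vcnj (?b w)) (?b w - vcnj (?a w)) w"
      by (intro has_wdv_diff has_wdv_vcnj dE w)
    have "has_wdv (\<lambda>w. (2 * \<i> * D w) *s gen B) ((2 * \<i> * dz D w) *s gen B + (2 * \<i> * D w) *s 0)
        ((2 * \<i> * dzbar D w) *s gen B + (2 * \<i> * D w) *s 0) w"
      by (intro has_wdv_scale has_wd_cmult has_wdv_const dD w)
    then have 2: "has_wdv (\<lambda>w. E w - vcnj (E w)) ((2 * \<i> * dz D w) *s gen B + (2 * \<i> * D w) *s 0)
        ((2 * \<i> * dzbar D w) *s gen B + (2 * \<i> * D w) *s 0) w"
      by (rule has_wdv_cong_open[OF _ o w]) (rule ED[symmetric])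
    show "?a w - vcnj (?b w) = (2 * \<i> * dz D w) *s gen B" "?b w - vcnj (?a w) = (2 * \<i> * dzbar D w) *s gen B"
      using has_wdv_unique[OF 1 2] by auto
  qed
  have curv: "dz (dzbar D) w = \<i> * qf (?b w) (vcnj (?b w))" if w: "w \<in> ?N" for w
  proof -
    define m where "m = dzv ?b w"
    \<comment> \<open>By symmetry of the mixed derivatives the same \<open>m\<close> comes from both
      \<open>?a\<close> and \<open>?b\<close>; hence differentiating \<open>?b - vcnj ?a\<close>
      produces \<open>m - vcnj m\<close>.\<close>
    have m': "dzbarv ?a w = m" unfolding m_def by (rule real_analv_dz(4)[OF E o w])
    have db: "has_wdv ?b m (dzbarv ?b w) w" unfolding m_def by (rule real_analv_dz(3)[OF b_anal o w])
    have da: "has_wdv ?a (dzv ?a w) m w" unfolding m'[symmetric] by (rule real_analv_dz(3)[OF a_anal o w])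
    have gm: "gr0 B m = 0"
    proof -
      have 1: "has_wd (\<lambda>w. gr0 B (?b w)) 0 0 w"
        by (rule has_wd_cong_open[OF has_wd_const o w]) (rule gr0_b[symmetric])
      show ?thesis using has_wd_unique(1)[OF 1 has_wd_clinear[OF gr0_linear db]] by simp
    qed
    have mD: "m - vcnj m = (2 * \<i> * dz (dzbar D) w) *s gen B"
    proof -
      have 1: "has_wdv (\<lambda>w. ?b w - vcnj (?a w)) (m - vcnj m) (dzbarv ?b w - vcnj (dzv ?a w)) w"
        by (intro has_wdv_diff has_wdv_vcnj db da)
      have "has_wd (dzbar D) (dz (dzbar D) w) (dzbar (dzbar D) w) w"
        by (rule has_wd_real_anal[OF real_anal_dzbar[OF Danal o] o w])
      then have "has_wdv (\<lambda>w. (2 * \<i> * dzbar D w) *s gen B) ((2 * \<i> * dz (dzbar D) w) *s gen B + (2 * \<i> * dzbar D w) *s 0)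
        ((2 * \<i> * dzbar (dzbar D) w) *s gen B + (2 * \<i> * dzbar D w) *s 0) w"
        by (intro has_wdv_scale has_wd_cmult has_wdv_const)
      then have 2: "has_wdv (\<lambda>w. ?b w - vcnj (?a w)) ((2 * \<i> * dz (dzbar D) w) *s gen B + (2 * \<i> * dzbar D w) *s 0)
        ((2 * \<i> * dzbar (dzbar D) w) *s gen B + (2 * \<i> * dzbar D w) *s 0) w"
        by (rule has_wdv_cong_open[OF _ o w]) (rule EDd(2)[symmetric])
      show ?thesis using has_wdv_unique(1)[OF 1 2] by simp
    qed
    have rho_lin: "clinear \<rho>" using \<rho> by (simp add: integral_retraction_def)
    have q: "qf m (E w - unit_lift) + qf (?b w) (?a w) = - \<rho> m"
    proof -
      have 1: "has_wd (\<lambda>w. qf (?b w) (E w - unit_lift)) (qf m (E w - unit_lift) + qf (?b w) (?a w - 0))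
         (qf (dzbarv ?b w) (E w - unit_lift) + qf (?b w) (?b w - 0)) w"
        by (intro has_wd_qf db has_wdv_diff has_wdv_const dE w)
      have "has_wd (\<lambda>w. (-1) * \<rho> (?b w)) ((-1) * \<rho> m) ((-1) * \<rho> (dzbarv ?b w)) w"
        by (intro has_wd_cmult has_wd_clinear[OF rho_lin] db)
      then have 2: "has_wd (\<lambda>w. qf (?b w) (E w - unit_lift)) ((-1) * \<rho> m) ((-1) * \<rho> (dzbarv ?b w)) w"
        by (rule has_wd_cong_open[OF _ o w]) (simp add: \<rho>q Eb gr0_b)
      show ?thesis using has_wd_unique(1)[OF 1 2] by simp
    qed
    let ?e = "E w - unit_lift"
    have ge: "gr0 B ?e = 0" using E1[OF w] by (simp add: gr0_diff unit_lift)
    have gm': "gr0 B (vcnj m) = 0" using gm by simp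
    \<comment> \<open>The lift is real modulo \<open>gen B\<close> and \<open>unit_lift\<close> is
      integral, so \<open>?e\<close> may replace its conjugate inside Q. The retraction is real as
      well, so the conjugate of \<open>q\<close> has the same shape with \<open>vcnj m\<close> in
      place of \<open>m\<close>.\<close>
    have "vcnj ?e = ?e - (2 * \<i> * D w) *s gen B"
      using ED[OF w] VZ_vcnj[OF unit_lift(1)] by (simp add: algebra_simps flip: ED[OF w])
    then have "qf (vcnj m) (vcnj ?e) = qf (vcnj m) ?e"
      by (simp only: qf_diff(2) qf_scale(2) qf_gen_right[OF gm'] mult_zero_right diff_zero)
    moreover have "qf (vcnj m) (vcnj ?e) + qf (vcnj (?b w)) (vcnj (?a w)) = - \<rho> (vcnj m)"
      unfolding qf_vcnj retraction_vcnj[OF \<rho> gm] using arg_cong[OF q, of cnj] by simp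
    ultimately have q': "qf (vcnj m) ?e + qf (vcnj (?b w)) (vcnj (?a w)) = - \<rho> (vcnj m)" by simp
    have "?a w = vcnj (?b w) + (2 * \<i> * dz D w) *s gen B"
      using EDd(1)[OF w] by (simp add: algebra_simps flip: EDd(1)[OF w])
    then have qa: "qf (?b w) (?a w) = qf (?b w) (vcnj (?b w))"
      by (simp only: qf_add(2) qf_scale(2) qf_gen_right[OF gr0_b[OF w]] mult_zero_right add_0_right)
    have "qf (vcnj (?b w)) (vcnj (?a w)) = cnj (qf (?b w) (vcnj (?b w)))"
      unfolding qf_vcnj qa ..
    also have "\<dots> = qf (vcnj (?b w)) (?b w)" using qf_vcnj[of "?b w" "vcnj (?b w)"] by simp
    also have "\<dots> = - qf (?b w) (vcnj (?b w))" by (rule qf_swap) (simp_all add: gr0_b[OF w])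
    finally have qb: "qf (vcnj (?b w)) (vcnj (?a w)) = - qf (?b w) (vcnj (?b w))" .
    \<comment> \<open>Now the Q-terms with \<open>?e\<close> agree in both equations, and their
      difference relates Q(\<beta>, cnj \<beta>) to the mixed derivative of \<delta> alone.\<close>
    have "qf (m - vcnj m) ?e = 0" unfolding mD qf_scale qf_gen[OF ge] by simp
    then have "qf m ?e = qf (vcnj m) ?e" by (simp only: qf_diff(1) right_minus_eq)
    moreover have "\<rho> m - \<rho> (vcnj m) = 2 * \<i> * dz (dzbar D) w"
      unfolding retraction_linear(2)[OF \<rho>, symmetric] mD by (rule retraction_linear(4)[OF \<rho>])
    moreover have "qf m ?e + qf (?b w) (vcnj (?b w)) = - \<rho> m"
      "qf (vcnj m) ?e + - qf (?b w) (vcnj (?b w)) = - \<rho> (vcnj m)"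
      using q q' unfolding qa qb .
    moreover have "2 * y = - d" if "x = x'" "p - p' = d" "x + y = - p" "x' + - y = - p'" for x x' y p p' d :: complex
    proof -
      have "2 * y = (x + y) - (x' + - y)" using that(1) by simp
      also have "\<dots> = - (p - p')" unfolding that(3,4) by simp
      finally show ?thesis using that(2) by simp
    qed
    ultimately have "2 * qf (?b w) (vcnj (?b w)) = - (2 * \<i> * dz (dzbar D) w)" by blast
    then have "\<i> * (2 * qf (?b w) (vcnj (?b w))) = \<i> * (- (2 * \<i> * dz (dzbar D) w))" by simp
    then show ?thesis by simp
  qed
  show ?thesis
  proof (rule that[OF r sub Danal])
    fix w assume w: "w \<in> ?N"
    interpret hw: biext_hodge B "Fam w" by (rule hw[OF w])
    let ?t = "vcnj (?b w)" and ?c = "2 * \<i> * dz D w"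
    have a: "?a w = ?t + ?c *s gen B"
      using EDd(1)[OF w] by (metis add.commute diff_add_cancel)
    have "?t = ?a w - ?c *s gen B" unfolding a by simp
    also have "\<dots> \<in> Fam w (-1)" using Ez[OF w] hw.gen_F[of "-1" ?c] by (simp add: hw.F_closed)
    finally have t: "?t \<in> Fam w (-1)" .
    have "dz (dzbar D) w = - \<i> * qf ?t (vcnj ?t)"
      unfolding curv[OF w] using qf_swap[of "?b w" ?t] gr0_b[OF w] by simp
    then show "\<exists>\<tau> a b c. has_wdv (\<lambda>w. hlift (Fam w)) a b w \<and> a = \<tau> + c *s gen B \<and>
       \<tau> \<in> Fam w (-1) \<and> gr0 B \<tau> = 0 \<and> vcnj \<tau> \<in> Fam w 0 \<and> dz (dzbar D) w = - \<i> * qf \<tau> (vcnj \<tau>)"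
      using dE[OF w] a t Eb[OF w] gr0_b[OF w] unfolding E_def[symmetric]
      by (intro exI[of _ ?t] exI[of _ "?a w"] exI[of _ "?b w"] exI[of _ ?c]) simp
  qed
qed

end

section \<open>The matrix exponential near zero\<close>

lemma bounded_bilinear_matrix_mult:
  "bounded_bilinear ((**) :: complex ^ 'n ^ 'n \<Rightarrow> complex ^ 'n ^ 'n \<Rightarrow> complex ^ 'n::finite ^ 'n)"
proof (rule bilinear_conv_bounded_bilinear[THEN iffD1])
  show "bilinear ((**) :: complex ^ 'n ^ 'n \<Rightarrow> complex ^ 'n ^ 'n \<Rightarrow> complex ^ 'n ^ 'n)"
    unfolding bilinear_def
    by (auto intro!: linearI simp: vec_eq_iff matrix_matrix_mult_def scaleR_sum_right
        distrib_left distrib_right sum.distrib)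
qed

lemma bounded_bilinear_matrix_vector_mult:
  "bounded_bilinear ((*v) :: complex ^ 'n ^ 'n \<Rightarrow> complex ^ 'n \<Rightarrow> complex ^ 'n::finite)"
proof (rule bilinear_conv_bounded_bilinear[THEN iffD1])
  show "bilinear ((*v) :: complex ^ 'n ^ 'n \<Rightarrow> complex ^ 'n \<Rightarrow> complex ^ 'n)"
    unfolding bilinear_def
    by (auto intro!: linearI simp: vec_eq_iff matrix_vector_mult_def scaleR_sum_right
        distrib_left distrib_right sum.distrib)
qed

lemma mat_exp_second_order:
  "\<exists>C. \<forall>X :: complex ^ 'n::finite ^ 'n. norm X \<le> 1 \<longrightarrow> norm (mat_exp X - mat 1 - X) \<le> C * (norm X)\<^sup>2"
proof -
  from bounded_bilinear.pos_bounded[OF bounded_bilinear_matrix_mult[where 'n = 'n]] obtain K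
    where "K > 0" "\<forall>(X :: complex ^ 'n ^ 'n) (Y :: complex ^ 'n ^ 'n). norm (X ** Y) \<le> norm X * norm Y * K"
    by (elim exE conjE) (rule that)
  then have K: "K > 0" "\<And>(X :: complex ^ 'n ^ 'n) (Y :: complex ^ 'n ^ 'n). norm (X ** Y) \<le> norm X * norm Y * K"
    by simp_all
  define N where "N = norm (mat 1 :: complex ^ 'n ^ 'n)"
  \<comment> \<open>\<open>K\<close> bounds the matrix product and \<open>N\<close> the identity
    matrix. In the tail from degree 2 on, powers of \<open>norm X\<close> beyond the second are at
    most 1 and \<open>fact (k + 2)\<close> is replaced by \<open>fact k\<close>, leaving the
    exponential series of \<open>K\<close>.\<close>
  define C where "C = N * K\<^sup>2 * exp K"
  have "norm (mat_exp X - mat 1 - X) \<le> C * (norm X)\<^sup>2" if X: "norm X \<le> 1" for X :: "complex ^ 'n ^ 'n"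
  proof -
    define p where "p k = ((\<lambda>Y. X ** Y) ^^ k) (mat 1)" for k
    define f where "f k = p k /\<^sub>R fact k" for k
    have p: "norm (p k) \<le> N * (K * norm X) ^ k" for k
    proof (induction k)
      case (Suc k)
      have "norm (p (Suc k)) \<le> norm X * norm (p k) * K" unfolding p_def by (simp add: K(2))
      also have "\<dots> \<le> norm X * (N * (K * norm X) ^ k) * K"
        using Suc K(1) by (intro mult_right_mono mult_left_mono) auto
      finally show ?case by (simp add: ac_simps)
    qed (simp add: p_def N_def)
    have f: "norm (f k) \<le> N * ((K * norm X) ^ k /\<^sub>R fact k)" for k
      unfolding f_def using p[of k] by (simp add: divide_simps mult.commute)
    have sum_f: "summable f"
      by (rule summable_comparison_test'[OF summable_mult[OF summable_exp_generic[of "K * norm X"]], of 0 f N]) (use f in auto)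
    have tail: "norm (f (k + 2)) \<le> N * K\<^sup>2 * (norm X)\<^sup>2 * (K ^ k /\<^sub>R fact k)" for k
    proof -
      have "norm (f (k + 2)) \<le> N * ((K * norm X) ^ (k + 2) / fact (k + 2))"
        using f[of "k + 2"] by (simp add: divide_inverse mult.commute)
      also have "\<dots> \<le> N * ((K ^ (k + 2) * (norm X)\<^sup>2) / fact k)"
      proof (intro mult_left_mono frac_le)
        have "(norm X) ^ (k + 2) \<le> (norm X)\<^sup>2" using X by (intro power_decreasing) auto
        then show "(K * norm X) ^ (k + 2) \<le> K ^ (k + 2) * (norm X)\<^sup>2"
          using K(1) unfolding power_mult_distrib by (intro mult_left_mono) auto
        show "(fact k :: real) \<le> fact (k + 2)" by (rule fact_mono) simp
      qed (use K(1) in \<open>auto simp: N_def\<close>)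
      finally show ?thesis by (simp add: power_add divide_inverse ac_simps power2_eq_square)
    qed
    have sum_t: "summable (\<lambda>k. N * K\<^sup>2 * (norm X)\<^sup>2 * (K ^ k /\<^sub>R fact k))"
      by (rule summable_mult[OF summable_exp_generic])
    have "mat_exp X = (\<Sum>k. f k)" unfolding mat_exp_def f_def p_def ..
    also have "\<dots> = (\<Sum>k. f (k + 2)) + (\<Sum>k<2. f k)" by (rule suminf_split_initial_segment[OF sum_f])
    also have "(\<Sum>k<2. f k) = mat 1 + X" by (simp add: f_def p_def numeral_2_eq_2)
    finally have "mat_exp X - mat 1 - X = (\<Sum>k. f (k + 2))" by simp
    also have "norm \<dots> \<le> (\<Sum>k. N * K\<^sup>2 * (norm X)\<^sup>2 * (K ^ k /\<^sub>R fact k))"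
      by (rule norm_suminf_le[OF tail sum_t])
    also have "\<dots> = N * K\<^sup>2 * (norm X)\<^sup>2 * exp K"
      unfolding exp_def by (rule suminf_mult[OF summable_exp_generic])
    finally show ?thesis by (simp add: C_def ac_simps)
  qed
  then show ?thesis by blast
qed

text \<open>Only real times along a complex direction \<open>h\<close> are used; the directions 1
  and \<open>\<i>\<close> will together recover both Wirtinger derivatives.\<close>

lemma difference_quotient_limit:
  fixes f :: "complex \<Rightarrow> complex"
  assumes "(f has_derivative D) (at 0)"
  shows "((\<lambda>t::real. (f (of_real t * h) - f 0) /\<^sub>R t) \<longlongrightarrow> D h) (at 0)"
proof -
  have "((\<lambda>t::real. of_real t * h) has_derivative (\<lambda>t. of_real t * h)) (at 0)"
    by (auto intro!: derivative_eq_intros)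
  from has_derivative_compose[OF this, of f D]
  have "((\<lambda>t::real. f (of_real t * h)) has_derivative (\<lambda>t. D (of_real t * h))) (at 0)"
    using assms by simp
  moreover have "D (of_real t * h) = t *\<^sub>R D h" for t
    using linear_scale[OF has_derivative_linear[OF assms], of t h] by (simp add: scaleR_conv_of_real)
  ultimately have "((\<lambda>t::real. f (of_real t * h)) has_vector_derivative D h) (at 0)"
    by (simp add: has_vector_derivative_def)
  then have lim: "((\<lambda>t::real. norm (f (of_real t * h) - f 0 - t *\<^sub>R D h) / norm t) \<longlongrightarrow> 0) (at 0)"
    unfolding has_vector_derivative_def has_derivative_at by simp
  have "norm (f (of_real t * h) - f 0 - t *\<^sub>R D h) / norm t = norm ((f (of_real t * h) - f 0) /\<^sub>R t - D h)"
    if "t \<noteq> 0" for t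
  proof -
    have "(f (of_real t * h) - f 0) /\<^sub>R t - D h = (f (of_real t * h) - f 0 - t *\<^sub>R D h) /\<^sub>R t"
      using that by (simp add: scaleR_diff_right)
    then show ?thesis by (simp add: divide_inverse mult.commute)
  qed
  then have "((\<lambda>t. norm ((f (of_real t * h) - f 0) /\<^sub>R t - D h)) \<longlongrightarrow> 0) (at 0)"
    by (intro Lim_transform_eventually[OF lim]) (auto simp: eventually_at_filter)
  then show ?thesis by (rule LIM_zero_cancel[OF tendsto_norm_zero_cancel])
qed

lemma tendsto_of_difference_quotient:
  fixes g :: "real \<Rightarrow> 'b::real_normed_vector"
  assumes "((\<lambda>t::real. (g t - l) /\<^sub>R t) \<longlongrightarrow> g') (at 0)"
  shows "(g \<longlongrightarrow> l) (at 0)"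
proof -
  have "((\<lambda>t::real. t *\<^sub>R ((g t - l) /\<^sub>R t) + l) \<longlongrightarrow> 0 *\<^sub>R g' + l) (at 0)"
    by (intro tendsto_intros assms)
  then have "((\<lambda>t::real. t *\<^sub>R ((g t - l) /\<^sub>R t) + l) \<longlongrightarrow> l) (at 0)" by simp
  then show ?thesis
    by (rule Lim_transform_eventually) (auto simp: eventually_at_filter)
qed

text \<open>As \<Gamma> vanishes at 0 to first order, \<open>mat_exp\<close> differs from
  \<open>mat 1\<close> plus \<Gamma> by a second-order term that disappears from the
  quotient.\<close>

lemma difference_quotient_mat_exp:
  fixes \<Gamma> :: "complex \<Rightarrow> complex ^ 'n::finite ^ 'n"
  assumes \<Gamma>: "\<And>i j. ((\<lambda>w. \<Gamma> w $ i $ j) has_derivative (\<lambda>h. h * \<gamma> $ i $ j)) (at 0)" and 0: "\<Gamma> 0 = 0"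
  shows "((\<lambda>t::real. (mat_exp (\<Gamma> (of_real t * h)) - mat 1) /\<^sub>R t) \<longlongrightarrow> (\<chi> i j. h * \<gamma> $ i $ j)) (at 0)"
proof -
  let ?G = "\<lambda>t::real. \<Gamma> (of_real t * h)" and ?c = "\<chi> i j. h * \<gamma> $ i $ j"
  have lim: "((\<lambda>t. ?G t /\<^sub>R t) \<longlongrightarrow> ?c) (at 0)"
  proof (intro vec_tendstoI)
    fix i j
    show "((\<lambda>t. (?G t /\<^sub>R t) $ i $ j) \<longlongrightarrow> ?c $ i $ j) (at 0)"
      using difference_quotient_limit[OF \<Gamma>[of i j], of h] by (simp add: 0)
  qed
  have G0: "(?G \<longlongrightarrow> 0) (at 0)"
    by (rule tendsto_of_difference_quotient[of _ _ ?c]) (use lim in simp)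
  obtain C where C: "\<And>X :: complex ^ 'n ^ 'n. norm X \<le> 1 \<Longrightarrow> norm (mat_exp X - mat 1 - X) \<le> C * (norm X)\<^sup>2"
    using mat_exp_second_order by blast
  let ?r = "\<lambda>t::real. (mat_exp (?G t) - mat 1 - ?G t) /\<^sub>R t"
  have "\<forall>\<^sub>F t in at 0. norm (?G t) < 1"
    using order_tendstoD(2)[OF tendsto_norm[OF G0], of 1] by simp
  then have bnd: "\<forall>\<^sub>F t in at 0. norm (?r t) \<le> C * norm (?G t) * norm (?G t /\<^sub>R t)"
  proof eventually_elim
    case (elim t)
    have "norm (?r t) = norm (mat_exp (?G t) - mat 1 - ?G t) * inverse \<bar>t\<bar>"
      by (simp only: norm_scaleR abs_inverse mult.commute)
    also have "\<dots> \<le> C * (norm (?G t))\<^sup>2 * inverse \<bar>t\<bar>"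
      using elim by (intro mult_right_mono C) auto
    also have "\<dots> = C * norm (?G t) * norm (?G t /\<^sub>R t)"
      by (simp only: norm_scaleR abs_inverse power2_eq_square ac_simps)
    finally show ?case .
  qed
  have "((\<lambda>t. C * norm (?G t) * norm (?G t /\<^sub>R t)) \<longlongrightarrow> C * norm (0 :: complex ^ 'n ^ 'n) * norm ?c) (at 0)"
    by (intro tendsto_intros lim G0)
  then have "(?r \<longlongrightarrow> 0) (at 0)"
    using Lim_null_comparison[OF bnd] by simp
  then have "((\<lambda>t. ?r t + ?G t /\<^sub>R t) \<longlongrightarrow> 0 + ?c) (at 0)"
    by (intro tendsto_add lim)
  then show ?thesis by (simp flip: scaleR_add_right)
qed

context biext_hodge begin

text \<open>
  With \<open>S t = m t a(t) + c(t) gen\<close>, \<open>a(t) \<in> F\<^sup>0\<close>, the projection \<open>PA\<close> shows that \<open>a(t)\<close> tends to \<open>e\<close>;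
  applying \<open>PB\<close>, which kills \<open>F\<^sup>0 + W\<^sub>-\<^sub>2\<close>, to the difference quotients gives the claim.
\<close>

lemma moving_subspace_derivative:
  assumes e: "e \<in> F 0"
    and S: "((\<lambda>t::real. (S t - e) /\<^sub>R t) \<longlongrightarrow> s') (at 0)"
    and m: "((\<lambda>t::real. (m t - mat 1) /\<^sub>R t) \<longlongrightarrow> m') (at 0)"
    and ev: "\<forall>\<^sub>F t in at 0. \<exists>a\<in>F 0. \<exists>c. S t = m t *v a + c *s gen B"
  shows "\<exists>a\<in>F 0. \<exists>c. s' - m' *v e = a + c *s gen B"
proof -
  have scaleR: "t *\<^sub>R v = of_real t *s v" for t and v :: "complex ^ 'n"
    by (simp add: vec_eq_iff scaleR_conv_of_real[where 'a = complex])
  have "linear PA" "linear PB"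
    by (auto intro!: linearI simp: triple_add triple_scale scaleR)
  then have bl: "bounded_linear PA" "bounded_linear PB" by (simp_all add: linear_conv_bounded_linear)
  interpret PA: bounded_linear PA by fact
  interpret PB: bounded_linear PB by fact
  interpret mv: bounded_bilinear "(*v) :: complex ^ 'n ^ 'n \<Rightarrow> complex ^ 'n \<Rightarrow> complex ^ 'n"
    by (rule bounded_bilinear_matrix_vector_mult)
  obtain KA where KA: "KA > 0" "\<And>v. norm (PA v) \<le> norm v * KA" using PA.pos_bounded by metis
  from mv.pos_bounded obtain K
    where "K > 0" "\<forall>X v. norm ((X :: complex ^ 'n ^ 'n) *v (v :: complex ^ 'n)) \<le> norm X * norm v * K"
    by (elim exE conjE) (rule that)
  then have K: "K > 0" "\<And>X v. norm ((X :: complex ^ 'n ^ 'n) *v (v :: complex ^ 'n)) \<le> norm X * norm v * K"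
    by simp_all
  have kill: "PA (a + c *s gen B) = a" "PB (a + c *s gen B) = 0" if "a \<in> F 0" for a c
    by (rule triple_eq[of _ a 0 c]; use that vec.subspace_0[OF subspace_F] in simp)+
  define P where "P t a c \<longleftrightarrow> a \<in> F 0 \<and> S t = m t *v a + c *s gen B" for t a c
  \<comment> \<open>The choice carries no continuity; the convergence of \<open>a\<close> to
    \<open>e\<close> is derived from \<open>eqs\<close>.\<close>
  define a where "a t = (SOME a. \<exists>c. P t a c)" for t
  define c where "c t = (SOME c. P t (a t) c)" for t
  have ac: "P t (a t) (c t)" if "\<exists>a c. P t a c" for t
  proof -
    have "\<exists>c. P t (a t) c" unfolding a_def by (rule someI_ex[OF that])
    then show ?thesis unfolding c_def by (rule someI_ex)
  qed
  have evP: "\<forall>\<^sub>F t in at 0. P t (a t) (c t)"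
    using ev by eventually_elim (use ac in \<open>auto simp: P_def\<close>)
  define n where "n t = m t - mat 1" for t
  have eqs: "PA (S t) = a t + PA (n t *v a t)" "PB (S t) = PB (n t *v a t)" if "P t (a t) (c t)" for t
  proof -
    have "S t = n t *v a t + (a t + c t *s gen B)"
      using that by (simp add: P_def n_def matrix_vector_mult_diff_rdistrib)
    then show "PA (S t) = a t + PA (n t *v a t)" "PB (S t) = PB (n t *v a t)"
      using that kill[of "a t" "c t"] by (simp_all add: P_def PA.add PB.add)
  qed
  have n0: "(n \<longlongrightarrow> 0) (at 0)"
    using tendsto_of_difference_quotient[OF m] unfolding n_def by (rule LIM_zero)
  have S0: "((\<lambda>t. PA (S t)) \<longlongrightarrow> e) (at 0)"
    using PA.tendsto[OF tendsto_of_difference_quotient[OF S]] kill[OF e, of 0] by simp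
  have "\<forall>\<^sub>F t in at 0. norm (n t) * K * KA < 1 / 2"
    by (rule order_tendstoD(2)[of _ 0]) (auto intro!: tendsto_eq_intros n0)
  then have bnd: "\<forall>\<^sub>F t in at 0. norm (PA (n t *v a t)) \<le> norm (n t) * K * KA * (2 * norm (PA (S t)))"
    using evP
  proof eventually_elim
    case (elim t)
    have 1: "norm (PA (n t *v a t)) \<le> norm (n t) * K * KA * norm (a t)"
    proof -
      have "norm (PA (n t *v a t)) \<le> norm (n t *v a t) * KA" by (rule KA)
      also have "\<dots> \<le> (norm (n t) * norm (a t) * K) * KA"
        using KA(1) by (intro mult_right_mono K) simp
      finally show ?thesis by (simp add: ac_simps)
    qed
    also have "\<dots> \<le> 1 / 2 * norm (a t)" using elim(1) by (intro mult_right_mono) auto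
    finally have half: "norm (PA (n t *v a t)) \<le> 1 / 2 * norm (a t)" .
    \<comment> \<open>The error is at most half of \<open>a t\<close>, so it can be absorbed:
      \<open>a t\<close> is bounded by twice \<open>PA (S t)\<close>, and then the error tends to 0
      together with \<open>n t\<close>.\<close>
    have "a t = PA (S t) - PA (n t *v a t)" using eqs[OF elim(2)] by simp
    then have "norm (a t) \<le> norm (PA (S t)) + norm (PA (n t *v a t))" by (metis norm_triangle_ineq4)
    then have "norm (a t) \<le> 2 * norm (PA (S t))" using half by simp
    then have "norm (n t) * K * KA * norm (a t) \<le> norm (n t) * K * KA * (2 * norm (PA (S t)))"
      using K(1) KA(1) by (intro mult_left_mono) auto
    then show ?case using 1 by linarith
  qed
  have "((\<lambda>t. norm (n t) * K * KA * (2 * norm (PA (S t)))) \<longlongrightarrow> 0) (at 0)"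
    by (auto intro!: tendsto_eq_intros n0 S0)
  then have "((\<lambda>t. PA (n t *v a t)) \<longlongrightarrow> 0) (at 0)"
    by (rule Lim_null_comparison[OF bnd])
  then have "((\<lambda>t. PA (S t) - PA (n t *v a t)) \<longlongrightarrow> e - 0) (at 0)"
    by (intro tendsto_diff S0)
  then have a0: "(a \<longlongrightarrow> e) (at 0)"
    by (simp only: diff_0_right, elim Lim_transform_eventually)
      (use evP in \<open>auto elim!: eventually_mono simp: eqs\<close>)
  have "((\<lambda>t. PB ((n t /\<^sub>R t) *v a t)) \<longlongrightarrow> PB (m' *v e)) (at 0)"
    unfolding n_def by (intro PB.tendsto mv.tendsto m a0)
  moreover have "\<forall>\<^sub>F t in at 0. PB ((n t /\<^sub>R t) *v a t) = PB ((S t - e) /\<^sub>R t)"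
    using evP
  proof eventually_elim
    case (elim t)
    have "PB e = 0" using kill(2)[OF e, of 0] by simp
    then show ?case using eqs(2)[OF elim] by (simp add: mv.scaleR_left PB.scaleR PB.diff)
  qed
  ultimately have "((\<lambda>t. PB ((S t - e) /\<^sub>R t)) \<longlongrightarrow> PB (m' *v e)) (at 0)"
    by (rule Lim_transform_eventually)
  moreover have "((\<lambda>t. PB ((S t - e) /\<^sub>R t)) \<longlongrightarrow> PB s') (at 0)"
    by (intro PB.tendsto S)
  ultimately have "PB s' = PB (m' *v e)" using tendsto_unique trivial_limit_at by blast
  then have "PB (s' - m' *v e) = 0" by (simp add: PB.diff)
  then show ?thesis
    using triple[of "s' - m' *v e"] by (metis vcnj_simps(6) add_0_right)
qed

end

section \<open>Infinitesimal invariant and Hodge metric\<close>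

context biext_hodge begin

lemma hproj_kills:
  assumes "a \<in> F 0"
  shows "hproj (ibig F) (-1) 0 (x + (a + c *s gen B)) = hproj (ibig F) (-1) 0 x"
proof -
  note [simp] = hproj_add[OF ibig_subspace ibig_ex1]
  have "hproj (ibig F) (-1) 0 a = 0"
    by (rule hproj_bspan_zero[OF ibig_subspace ibig_ex1, of _ "\<lambda>a b. 0 \<le> a"])
      (use assms ibig_span_F[of 0] in auto)
  moreover have "c *s gen B \<in> ibig F (-1) (-1)" by (simp add: ibig_simps)
  from hproj_single[OF ibig_subspace ibig_ex1 this, of "-1" 0]
  have "hproj (ibig F) (-1) 0 (c *s gen B) = 0" by simp
  ultimately show ?thesis by simp
qed

lemma hproj_self: "x \<in> ibig F p q \<Longrightarrow> hproj (ibig F) p' q' x = (if p' = p \<and> q' = q then x else 0)"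
  by (rule hproj_single[OF ibig_subspace ibig_ex1])

text \<open>Sums over infinite index sets are 0 by convention, so the sums in \<open>weil_op\<close>
  and \<open>hodge_component\<close> can be evaluated only with this. Both entries of a type are
  bounded above by a level where F vanishes, and their sum is -1.\<close>

lemma finite_types: "finite {(p, q). p + q = -1 \<and> ibig F p q \<noteq> {0}}"
proof -
  obtain p0 where p0: "F p0 = {0}" using F_bounds by blast
  have "{(p, q). p + q = -1 \<and> ibig F p q \<noteq> {0}} \<subseteq> (\<lambda>p. (p, -1 - p)) ` {-1 - p0..p0}"
  proof
    fix z assume "z \<in> {(p, q). p + q = -1 \<and> ibig F p q \<noteq> {0}}"
    then obtain p q where z: "z = (p, q)" "p + q = -1" and ne: "ibig F p q \<noteq> {0}" by auto
    have "p < p0"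
    proof (rule ccontr)
      assume "\<not> p < p0"
      then have "ibig F p q \<subseteq> {0}" using F_mono[of p0 p] p0 z by (auto simp: ibig_simps)
      then show False using ne vec.subspace_0[OF ibig_subspace] by blast
    qed
    moreover have "q < p0"
    proof (rule ccontr)
      assume "\<not> q < p0"
      then have "vcnj x = 0" if "x \<in> ibig F p q" for x using that F_mono[of p0 q] p0 z by (auto simp: ibig_simps)
      then have "ibig F p q \<subseteq> {0}" by (auto simp: vcnj_eq_iff)
      then show False using ne vec.subspace_0[OF ibig_subspace] by blast
    qed
    ultimately show "z \<in> (\<lambda>p. (p, -1 - p)) ` {-1 - p0..p0}" using z by (intro image_eqI[of _ _ p]) auto
  qed
  then show ?thesis by (rule finite_subset) simp
qed

text \<open>On type (-1,0) the Weil factor is \<open>\<i> powi (-1)\<close>, that is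
  \<open>- \<i>\<close>.\<close>

lemma weil_op_eq:
  assumes t: "t \<in> ibig F (-1) 0"
  shows "weil_op (ibig F) t = - \<i> *s t"
proof (cases "t = 0")
  case True
  have "hproj (ibig F) p q 0 = 0" for p q
    using hproj_self[of 0 0 0 p q] vec.subspace_0[OF ibig_subspace] by simp
  then show ?thesis using True by (simp add: weil_op_def split_def)
next
  case False
  let ?S = "{(p, q). p + q = -1 \<and> ibig F p q \<noteq> {0}}"
  have "weil_op (ibig F) t = (\<Sum>z\<in>?S. if z = (-1, 0) then - \<i> *s t else 0)"
    unfolding weil_op_def
    by (rule sum.cong) (auto simp: hproj_self[OF t] power_int_minus split: if_splits)
  also have "\<dots> = (if (-1, 0) \<in> ?S then - \<i> *s t else 0)"
    by (rule sum.delta[OF finite_types])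
  also have "\<dots> = - \<i> *s t" using t False by auto
  finally show ?thesis .
qed

lemma hodge_metric_eq:
  assumes t: "t \<in> ibig F (-1) 0"
  shows "hodge_metric B F t t = - \<i> * qf t (vcnj t)"
proof -
  have "gr0 B t = 0" using t by (simp add: ibig_simps)
  then have "pol B (- \<i> *s t) (vcnj t) = qf (- \<i> *s t) (vcnj t)"
    by (intro pol_eq_qf) (simp_all only: gr0_scale gr0_vcnj mult_zero_right complex_cnj_zero)
  then show ?thesis
    unfolding hodge_metric_def deligne_bigrading_eq weil_op_eq[OF t] qf_scale .
qed

lemma hodge_component_eq:
  assumes e: "e \<in> ibig F 0 0" "e \<noteq> 0"
  shows "hodge_component (ibig F) (-1) 0 X e = hproj (ibig F) (-1) 0 (X *v e)"
proof -
  let ?S = "{(p, q). ibig F p q \<noteq> {0}}"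
  have h0: "hproj (ibig F) p q 0 = 0" for p q
    using hproj_self[of 0 0 0 p q] vec.subspace_0[OF ibig_subspace] by simp
  have "?S \<subseteq> {(0, 0), (-1, -1)} \<union> {(p, q). p + q = -1 \<and> ibig F p q \<noteq> {0}}"
  proof
    fix z assume "z \<in> ?S"
    then obtain p q where "z = (p, q)" "ibig F p q \<noteq> {0}" by auto
    then show "z \<in> {(0, 0), (-1, -1)} \<union> {(p, q). p + q = -1 \<and> ibig F p q \<noteq> {0}}"
      by (cases "p + q = -1") (auto simp: ibig_def split: if_splits)
  qed
  then have fin: "finite ?S" using finite_types by (auto intro: finite_subset)
  have "hodge_component (ibig F) (-1) 0 X e
      = (\<Sum>z\<in>?S. if z = (0, 0) then hproj (ibig F) (-1) 0 (X *v e) else 0)"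
    unfolding hodge_component_def
    by (rule sum.cong) (auto simp: hproj_self[OF e(1)] h0 split: if_splits)
  also have "\<dots> = (if (0, 0) \<in> ?S then hproj (ibig F) (-1) 0 (X *v e) else 0)"
    by (rule sum.delta[OF fin])
  also have "\<dots> = hproj (ibig F) (-1) 0 (X *v e)" using e by auto
  finally show ?thesis .
qed

end

section \<open>Local period maps of a variation\<close>

text \<open>A flat frame near a point may cover only part of a coordinate domain; local period maps
  are formed on the overlap.\<close>

lemma holo_coord_restrict:
  assumes "holo_coord A U \<psi>" "open V"
  shows "holo_coord A (U \<inter> V) \<psi>"
proof -
  obtain \<eta> where U: "open U" "open (\<psi> ` U)" and hom: "homeomorphism U (\<psi> ` U) \<psi> \<eta>"
    and tr: "\<forall>(U', \<phi>') \<in> A. (\<psi> \<circ> inv_into U' \<phi>') holomorphic_on \<phi>' ` (U \<inter> U')"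
    using assms(1) unfolding holo_coord_def by blast
  have "openin (top_of_set U) (U \<inter> V)" using assms(2) by auto
  then have "openin (top_of_set (\<psi> ` U)) (\<psi> ` (U \<inter> V))"
    using homeomorphism_imp_open_map[OF hom] by blast
  then have op: "open (\<psi> ` (U \<inter> V))" using U(2) openin_open_trans by blast
  have "homeomorphism (U \<inter> V) (\<psi> ` (U \<inter> V)) \<psi> \<eta>"
    by (rule homeomorphism_of_subsets[OF hom]) auto
  moreover have "(\<psi> \<circ> inv_into U' \<phi>') holomorphic_on \<phi>' ` (U \<inter> V \<inter> U')" if "(U', \<phi>') \<in> A" for U' \<phi>'
    by (rule holomorphic_on_subset[of _ "\<phi>' ` (U \<inter> U')"]) (use tr that in auto)
  ultimately show ?thesis
    unfolding holo_coord_def using U(1) assms(2) op by auto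
qed

lemma holo_coord_inj: "holo_coord A U \<psi> \<Longrightarrow> inj_on \<psi> U"
  unfolding holo_coord_def homeomorphism_def by (metis inj_on_inverseI)

lemma flat_frame_restrict:
  assumes "flat_frame B \<Phi> U g" "open V"
  shows "flat_frame B \<Phi> (U \<inter> V) g"
  unfolding flat_frame_def
proof (intro conjI ballI, goal_cases)
  case 1
  then show ?case using assms by (auto simp: flat_frame_def)
next
  case (2 s)
  then show ?case using assms by (auto simp: flat_frame_def)
next
  case (3 z)
  obtain U' g' where z: "z = (U', g')" by (cases z)
  show ?case
    unfolding z split
  proof
    fix s assume s: "s \<in> U \<inter> V \<inter> U'"
    then obtain N M where N: "open N" "s \<in> N" "N \<subseteq> U \<inter> U'" "\<forall>x\<in>N. g x = M ** g' x"
      using assms(1) 3 z unfolding flat_frame_def by blast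
    show "\<exists>N M. open N \<and> s \<in> N \<and> N \<subseteq> U \<inter> V \<inter> U' \<and> (\<forall>x\<in>N. g x = M ** g' x)"
      by (rule exI[of _ "N \<inter> V"], rule exI[of _ M]) (use N s assms(2) in auto)
  qed
qed

context biext begin

lemma local_period_family:
  assumes var: "biext_variation A B \<Phi> F" and sd: "self_dual B F"
    and U: "holo_coord A U \<psi>" and g: "flat_frame B \<Phi> U g"
  shows "biext_family B (\<psi> ` U) (local_period F U g \<psi>)"
    and "w \<in> \<psi> ` U \<Longrightarrow> hdelta (local_period F U g \<psi> w) = hdelta (F (inv_into U \<psi> w))"
proof -
  have aut: "biext_aut_hodge B (g (inv_into U \<psi> w)) (F (inv_into U \<psi> w))" if "w \<in> \<psi> ` U" for w
  proof unfold_locales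
    show "g (inv_into U \<psi> w) \<in> lattice_aut B" using g inv_into_into[OF that] by (simp add: flat_frame_def)
    show "biext_mhs B (F (inv_into U \<psi> w))" using var by (simp add: biext_variation_def)
  qed
  show "biext_family B (\<psi> ` U) (local_period F U g \<psi>)"
  proof unfold_locales
    show "open (\<psi> ` U)" using U by (simp add: holo_coord_def)
    show "holomorphic_filtration (\<psi> ` U) (local_period F U g \<psi>)"
      "griffiths_transversal (\<psi> ` U) (local_period F U g \<psi>)"
      using var U g by (auto simp: biext_variation_def)
    show "biext_mhs B (local_period F U g \<psi> w)" if "w \<in> \<psi> ` U" for w
      unfolding local_period_def by (rule biext_aut_hodge.act_biext_mhs[OF aut[OF that]])
    show "self_dual_at (local_period F U g \<psi> w)" if "w \<in> \<psi> ` U" for w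
      unfolding local_period_def
      by (rule biext_aut_hodge.act_self_dual_at[OF aut[OF that] self_dual_imp_at[OF sd]])
  qed
  show "hdelta (local_period F U g \<psi> w) = hdelta (F (inv_into U \<psi> w))" if "w \<in> \<psi> ` U"
    unfolding local_period_def by (rule biext_aut_hodge.act_hdelta[OF aut[OF that]])
qed

end

lemma dz_dzbar_cmult:
  assumes N: "open N" "w \<in> N" and D: "real_anal N D" and f: "\<And>x. x \<in> N \<Longrightarrow> f x = c * D x"
  shows "dz (dzbar f) w = c * dz (dzbar D) w"
    and "f differentiable (at w)" "dz f differentiable (at w)" "dzbar f differentiable (at w)"
proof -
  have f': "real_anal N f"
    by (rule real_anal.cong[OF real_anal.mult[OF real_anal_const[of N c] D]]) (simp add: f)
  show "f differentiable (at w)" "dz f differentiable (at w)" "dzbar f differentiable (at w)"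
    using real_anal_twice_differentiable[OF f' N] by auto
  have db: "dzbar f x = c * dzbar D x" if x: "x \<in> N" for x
  proof -
    have "has_wd f (c * dz D x) (c * dzbar D x) x"
      by (rule has_wd_cong_open[OF has_wd_cmult[OF has_wd_real_anal[OF D N(1) x]] N(1) x]) (simp add: f)
    then show ?thesis by (rule has_wd_dzbar)
  qed
  have "has_wd (dzbar f) (c * dz (dzbar D) w) (c * dzbar (dzbar D) w) w"
    by (rule has_wd_cong_open[OF has_wd_cmult[OF has_wd_real_anal[OF real_anal_dzbar[OF D N(1)] N]] N])
      (simp add: db)
  then show "dz (dzbar f) w = c * dz (dzbar D) w" by (rule has_wd_dz)
qed

lemma twice_real_differentiable_onI:
  "(\<And>w. w \<in> S \<Longrightarrow> f differentiable (at w) \<and> dz f differentiable (at w) \<and> dzbar f differentiable (at w)) \<Longrightarrow>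
    twice_real_differentiable_on f S"
  by (simp add: twice_real_differentiable_on_def differentiable_on_def differentiable_at_withinI)

context biext begin

text \<open>The claim is local, and \<delta> does not depend on the flat frame. Near each point any
  flat frame can be combined with the given coordinate, and log of the metric is -2\<pi> times
  \<delta>, whose mixed derivative is nonnegative by \<open>delta_curvature\<close> and the Riemann
  relation.\<close>

lemma biextension_metric_semi_positive:
  assumes var: "biext_variation A B \<Phi> F" and sd: "self_dual B F" and U: "holo_coord A U \<psi>"
  shows "twice_real_differentiable_on (\<lambda>w. of_real (ln (h_biext B (F (inv_into U \<psi> w))))) (\<psi> ` U)"
    and "\<And>w. w \<in> \<psi> ` U \<Longrightarrow> semi_positive (chern_form (\<lambda>x. h_biext B (F (inv_into U \<psi> x))) w)"
proof -
  define f where "f w = complex_of_real (ln (h_biext B (F (inv_into U \<psi> w))))" for w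
  have loc: "\<exists>\<kappa>\<in>\<real>\<^sub>\<ge>\<^sub>0. dz (dzbar f) w = - 2 * of_real pi * \<kappa> \<and>
     f differentiable (at w) \<and> dz f differentiable (at w) \<and> dzbar f differentiable (at w)" if w: "w \<in> \<psi> ` U" for w
  proof -
    define s where "s = inv_into U \<psi> w"
    have s: "s \<in> U" "\<psi> s = w" using w by (simp_all add: s_def inv_into_into f_inv_into_f)
    have ls: "local_system B \<Phi>" using var by (simp add: biext_variation_def)
    then have "s \<in> \<Union>(fst ` \<Phi>)" by (simp add: local_system_def)
    then obtain V g where Vg: "(V, g) \<in> \<Phi>" "s \<in> V" by auto
    then have V: "flat_frame B \<Phi> V g" using ls by (auto simp: local_system_def)
    then have oV: "open V" by (simp add: flat_frame_def)
    have oU: "open U" using U by (simp add: holo_coord_def)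
    let ?U = "U \<inter> V"
    have coord: "holo_coord A ?U \<psi>" by (rule holo_coord_restrict[OF U oV])
    have frame: "flat_frame B \<Phi> ?U g" using flat_frame_restrict[OF V oU] by (simp add: Int_commute)
    interpret fam: biext_family B "\<psi> ` ?U" "local_period F ?U g \<psi>"
      by (rule local_period_family(1)[OF var sd coord frame])
    have w': "w \<in> \<psi> ` ?U" using s Vg by auto
    let ?L = "local_period F ?U g \<psi>"
    let ?D = "\<lambda>x. complex_of_real (hdelta (?L x))"
    obtain r where r: "r > 0" "ball w r \<subseteq> \<psi> ` ?U" "real_anal (ball w r) ?D"
      and curv: "\<And>x. x \<in> ball w r \<Longrightarrow> \<exists>\<tau> a b c. has_wdv (\<lambda>w. hlift (?L w)) a b x \<and> a = \<tau> + c *s gen B \<and>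
       \<tau> \<in> ?L x (-1) \<and> gr0 B \<tau> = 0 \<and> vcnj \<tau> \<in> ?L x 0 \<and> dz (dzbar ?D) x = - \<i> * qf \<tau> (vcnj \<tau>)"
      by (rule fam.delta_curvature[OF w']) (rule that)
    have fD: "f x = (- 2 * of_real pi) * ?D x" if x: "x \<in> ball w r" for x
    proof -
      obtain y where y: "y \<in> ?U" "x = \<psi> y" using r(2) x by auto
      have eq: "inv_into U \<psi> x = inv_into ?U \<psi> x"
        using inv_into_f_f[OF holo_coord_inj[OF U]] inv_into_f_f[OF holo_coord_inj[OF coord]] y by auto
      have "biext_hodge B (F (inv_into U \<psi> x))"
        using var by unfold_locales (simp add: biext_variation_def)
      then have "delta_num B (F (inv_into U \<psi> x)) = hdelta (F (inv_into U \<psi> x))"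
        by (rule biext_hodge.delta_num_eq)
      also have "\<dots> = hdelta (?L x)"
        unfolding eq using local_period_family(2)[OF var sd coord frame, of x] y by simp
      finally show ?thesis by (simp add: f_def h_biext_def)
    qed
    have wr: "w \<in> ball w r" using r(1) by simp
    from curv[OF wr] obtain \<tau> where \<tau>: "\<tau> \<in> ?L w (-1)" "gr0 B \<tau> = 0"
      "vcnj \<tau> \<in> ?L w 0" "dz (dzbar ?D) w = - \<i> * qf \<tau> (vcnj \<tau>)" by blast
    have "dz (dzbar ?D) w \<in> \<real>\<^sub>\<ge>\<^sub>0"
      unfolding \<tau>(4) by (rule biext_hodge.qf_positive[OF fam.fibre_hodge[OF w'] \<tau>(1-3)])
    then show ?thesis
      using dz_dzbar_cmult[OF open_ball wr r(3) fD] by blast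
  qed
  show "twice_real_differentiable_on (\<lambda>w. of_real (ln (h_biext B (F (inv_into U \<psi> w))))) (\<psi> ` U)"
    unfolding f_def[symmetric] by (rule twice_real_differentiable_onI) (use loc in blast)
  fix w assume "w \<in> \<psi> ` U"
  from loc[OF this] obtain \<kappa> where \<kappa>: "\<kappa> \<in> \<real>\<^sub>\<ge>\<^sub>0" "dz (dzbar f) w = - 2 * of_real pi * \<kappa>" by blast
  show "semi_positive (chern_form (\<lambda>x. h_biext B (F (inv_into U \<psi> x))) w)"
    unfolding semi_positive_def
  proof
    fix u :: complex
    \<comment> \<open>The two signs cancel: the prefactors give \<open>\<i> * \<kappa>\<close>, and
      the alternating form on \<open>u\<close> and \<open>\<i> * u\<close> is
      \<open>- 2 * \<i>\<close> times the squared norm of \<open>u\<close>.\<close>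
    have "chern_form (\<lambda>x. h_biext B (F (inv_into U \<psi> x))) w u (\<i> * u) =
      1 / (2 * of_real pi * \<i>) * (- 2 * of_real pi * \<kappa>) * (u * cnj (\<i> * u) - \<i> * u * cnj u)"
      unfolding chern_form_def f_def[symmetric] f_def[abs_def, symmetric] \<kappa>(2) ..
    also have "\<dots> = 2 * \<kappa> * (u * cnj u)"
      by (simp add: field_simps)
    also have "u * cnj u = of_real ((norm u)\<^sup>2)" by (rule complex_norm_square[symmetric])
    also have "2 * \<kappa> * of_real ((norm u)\<^sup>2) \<in> \<real>\<^sub>\<ge>\<^sub>0"
      using \<kappa>(1) by (intro nonneg_Reals_mult_I) (auto simp: complex_nonneg_Reals_iff)
    finally show "chern_form (\<lambda>x. h_biext B (F (inv_into U \<psi> x))) w u (\<i> * u) \<in> \<real>\<^sub>\<ge>\<^sub>0" .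
  qed
qed

end

theorem theorem8p2:
  fixes A :: "('s::t2_space set \<times> ('s \<Rightarrow> complex)) set"
    and B :: "'n::finite biext_lattice"
    and \<Phi> :: "('s set \<times> ('s \<Rightarrow> complex ^ 'n ^ 'n)) set"
    and F :: "'s \<Rightarrow> 'n filtration"
    and \<Delta> :: "'s set" and \<phi> :: "'s \<Rightarrow> complex" and s0 :: 's and R :: real
    and g :: "'s \<Rightarrow> complex ^ 'n ^ 'n"
    and Fd :: "complex \<Rightarrow> 'n filtration" and F0 :: "'n filtration"
    and \<Gamma> :: "complex \<Rightarrow> complex ^ 'n ^ 'n" and \<gamma> :: "complex ^ 'n ^ 'n"
    and e0 t :: "complex ^ 'n"
  assumes variation: "biext_variation A B \<Phi> F"
    and self_dual: "self_dual B F"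
    and disk: "holo_coord A \<Delta> \<phi>" "s0 \<in> \<Delta>" "\<phi> s0 = 0" "\<phi> ` \<Delta> = ball 0 R"
    and frame: "flat_frame B \<Phi> \<Delta> g"
    and Fd: "Fd = local_period F \<Delta> g \<phi>"
    and F0: "F0 = Fd 0"
    and \<Gamma>_holomorphic: "\<And>i j. (\<lambda>w. \<Gamma> w $ i $ j) holomorphic_on ball 0 R"
    and \<Gamma>_values: "\<And>w. w \<in> ball 0 R \<Longrightarrow> \<Gamma> w \<in> q_alg B F0"
    and \<Gamma>_0: "\<Gamma> 0 = 0"
    and normal_form: "\<And>w. w \<in> ball 0 R \<Longrightarrow> Fd w = act (mat_exp (\<Gamma> w)) F0"
    and e0: "e0 \<in> deligne_bigrading (W B) F0 0 0" "gr0 B e0 = 1"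
    and \<gamma>: "\<gamma> = (\<chi> i j. deriv (\<lambda>w. \<Gamma> w $ i $ j) 0)"
    and t: "t = hodge_component (deligne_bigrading (W B) F0) (-1) 0 \<gamma> e0"
  shows "(t \<in> deligne_bigrading (W B) F0 (-1) 0 \<and> inf_invariant B (ball 0 R) Fd 0 e0 = t) \<and>
    ((\<forall>i j. twice_real_differentiable_on (\<lambda>w. deligne_delta B (Fd w) $ i $ j) (ball 0 R)) \<and>
     (\<chi> i j. dz (dzbar (\<lambda>w. deligne_delta B (Fd w) $ i $ j)) 0) *v e0 = hodge_metric B F0 t t *s gen B \<and>
     hodge_metric B F0 t t \<in> \<real>\<^sub>\<ge>\<^sub>0) \<and>
    (\<forall>U \<psi>. holo_coord A U \<psi> \<longrightarrow>
       twice_real_differentiable_on (\<lambda>w. of_real (ln (h_biext B (F (inv_into U \<psi> w))))) (\<psi> ` U) \<and>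
       (\<forall>w \<in> \<psi> ` U. semi_positive (chern_form (\<lambda>x. h_biext B (F (inv_into U \<psi> x))) w)))"
proof -
  have lat: "biext_lattice B" using variation by (simp add: biext_variation_def)
  interpret biext B by unfold_locales (rule lat)
  interpret fam: biext_family B "ball 0 R" Fd
    using local_period_family(1)[OF variation self_dual disk(1) frame] unfolding disk(4) Fd .
  have R: "0 \<in> ball (0::complex) R" using disk(2-4) by (metis image_eqI)
  interpret h: biext_hodge B F0 unfolding F0 by (rule fam.fibre_hodge[OF R])
  have I: "deligne_bigrading (W B) F0 = ibig F0" by (rule h.deligne_bigrading_eq)
  obtain k where k: "e0 = k *s hlift F0" using e0(1) unfolding I h.ibig_simps by blast
  then have e0_lift: "e0 = hlift F0" using e0(2) h.hlift by (simp add: gr0_scale)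
  then have e0F: "e0 \<in> F0 0" using h.hlift by simp
  let ?M = "\<lambda>w. mat_exp (\<Gamma> w)"
  have G': "((\<lambda>w. \<Gamma> w $ i $ j) has_derivative (\<lambda>h. h * \<gamma> $ i $ j)) (at 0)" for i j
    using has_wd_holomorphic[OF \<Gamma>_holomorphic[of i j] open_ball R] by (simp add: has_wd_def \<gamma>)
  \<comment> \<open>Formulated for sections of F^0 + W_-2 that need not be holomorphic, so that it
    applies both to the Hodge lift and to the holomorphic sections defining the infinitesimal
    invariant.\<close>
  have section_derivative: "\<exists>f\<in>F0 0. \<exists>c. (h *s a + cnj h *s b) - h *s (\<gamma> *v e0) = f + c *s gen B"
    if \<sigma>: "has_wdv \<sigma> a b 0" "\<sigma> 0 = e0" and N: "open N" "0 \<in> N" "N \<subseteq> ball 0 R"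
      and mem: "\<And>w. w \<in> N \<Longrightarrow> \<exists>f\<in>Fd w 0. \<exists>c. \<sigma> w = f + c *s gen B" for \<sigma> a b N h
  proof -
    have 1: "((\<lambda>t::real. (\<sigma> (of_real t * h) - e0) /\<^sub>R t) \<longlongrightarrow> h *s a + cnj h *s b) (at 0)"
    proof (rule vec_tendstoI)
      fix i
      have "((\<lambda>w. \<sigma> w $ i) has_derivative (\<lambda>h. h * a $ i + cnj h * b $ i)) (at 0)"
        using \<sigma>(1) by (simp add: has_wdv_def has_wd_def)
      from difference_quotient_limit[OF this, of h] \<sigma>(2)
      show "((\<lambda>t. ((\<sigma> (of_real t * h) - e0) /\<^sub>R t) $ i) \<longlongrightarrow> (h *s a + cnj h *s b) $ i) (at 0)" by simp
    qed
    have 2: "((\<lambda>t::real. (?M (of_real t * h) - mat 1) /\<^sub>R t) \<longlongrightarrow> (\<chi> i j. h * \<gamma> $ i $ j)) (at 0)"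
      by (rule difference_quotient_mat_exp[OF G' \<Gamma>_0])
    have "((\<lambda>t::real. of_real t * h) \<longlongrightarrow> 0) (at 0)" by (auto intro!: tendsto_eq_intros)
    from topological_tendstoD[OF this N(1,2)]
    have 3: "\<forall>\<^sub>F t in at 0. \<exists>f\<in>F0 0. \<exists>c. \<sigma> (of_real t * h) = ?M (of_real t * h) *v f + c *s gen B"
    proof eventually_elim
      case (elim t)
      have "Fd (of_real t * h) 0 = (\<lambda>v. ?M (of_real t * h) *v v) ` F0 0"
        using normal_form elim N(3) by (auto simp: act_def)
      then show ?case using mem[OF elim] by auto
    qed
    have "(\<chi> i j. h * \<gamma> $ i $ j) *v e0 = h *s (\<gamma> *v e0)"
      by (simp add: vec_eq_iff matrix_vector_mult_def sum_distrib_left mult.assoc)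
    then show ?thesis using h.moving_subspace_derivative[OF e0F 1 2 3] by simp
  qed
  let ?D = "\<lambda>w. complex_of_real (hdelta (Fd w))"
  obtain r \<tau> a b c where r: "r > 0" "ball (0::complex) r \<subseteq> ball 0 R" and E: "has_wdv (\<lambda>w. hlift (Fd w)) a b 0"
    and a: "a = \<tau> + c *s gen B" and \<tau>: "\<tau> \<in> F0 (-1)" "gr0 B \<tau> = 0" "vcnj \<tau> \<in> F0 0"
    and curv: "dz (dzbar ?D) 0 = - \<i> * qf \<tau> (vcnj \<tau>)"
  proof -
    obtain r where r: "r > 0" "ball (0::complex) r \<subseteq> ball 0 R" "real_anal (ball 0 r) ?D"
      and *: "\<And>w. w \<in> ball 0 r \<Longrightarrow> \<exists>\<tau> a b c.
       has_wdv (\<lambda>w. hlift (Fd w)) a b w \<and> a = \<tau> + c *s gen B \<and>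
       \<tau> \<in> Fd w (-1) \<and> gr0 B \<tau> = 0 \<and> vcnj \<tau> \<in> Fd w 0 \<and> dz (dzbar ?D) w = - \<i> * qf \<tau> (vcnj \<tau>)"
      by (rule fam.delta_curvature[OF R]) (rule that)
    have "0 \<in> ball (0::complex) r" using r by simp
    from *[OF this] show ?thesis using that r(1,2) unfolding F0[symmetric] by blast
  qed
  have \<tau>I: "\<tau> \<in> ibig F0 (-1) 0" using \<tau> by (simp add: h.ibig_simps)
  have Emem: "\<exists>f\<in>Fd w 0. \<exists>c. hlift (Fd w) = f + c *s gen B" if "w \<in> ball 0 R" for w
    by (rule bexI[of _ "hlift (Fd w)"], rule exI[of _ 0]) (use biext_hodge.hlift[OF fam.fibre_hodge[OF that]] in auto)
  have E0: "hlift (Fd 0) = e0" by (simp add: e0_lift F0)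
  \<comment> \<open>The directions 1 and \<open>\<i>\<close> separate the two Wirtinger derivatives:
    subtracting \<open>\<i>\<close> times the second relation from the first eliminates
    \<open>b\<close> and leaves \<open>2 *s (a - \<gamma> *v e0)\<close>.\<close>
  have "\<exists>f\<in>F0 0. \<exists>c. (1 *s a + cnj 1 *s b) - 1 *s (\<gamma> *v e0) = f + c *s gen B"
    by (rule section_derivative[OF E E0 open_ball R order.refl Emem])
  then obtain f1 c1 where f1: "f1 \<in> F0 0" "a + b - \<gamma> *v e0 = f1 + c1 *s gen B" by auto
  have "\<exists>f\<in>F0 0. \<exists>c. (\<i> *s a + cnj \<i> *s b) - \<i> *s (\<gamma> *v e0) = f + c *s gen B"
    by (rule section_derivative[OF E E0 open_ball R order.refl Emem])
  then obtain f2 c2 where f2: "f2 \<in> F0 0" "\<i> *s a - \<i> *s b - \<i> *s (\<gamma> *v e0) = f2 + c2 *s gen B" by auto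
  let ?f = "(-1/2) *s (f1 - \<i> *s f2)"
  have f: "?f \<in> F0 0" using f1 f2 by (simp add: h.F_closed)
  have "2 *s (a - \<gamma> *v e0) = (a + b - \<gamma> *v e0) - \<i> *s (\<i> *s a - \<i> *s b - \<i> *s (\<gamma> *v e0))"
    by (simp add: vec_eq_iff algebra_simps)
  also have "\<dots> = (f1 - \<i> *s f2) + (c1 - \<i> * c2) *s gen B"
    unfolding f1 f2 by (simp add: vec_eq_iff algebra_simps)
  finally have d: "2 *s (a - \<gamma> *v e0) = (f1 - \<i> *s f2) + (c1 - \<i> * c2) *s gen B" .
  have "\<gamma> *v e0 = a - (1/2) *s (2 *s (a - \<gamma> *v e0))" by simp
  also have "\<dots> = a + ?f + ((-1/2) * (c1 - \<i> * c2)) *s gen B"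
    unfolding d by (simp add: vec_eq_iff algebra_simps diff_divide_distrib add_divide_distrib)
  finally have \<gamma>e0: "\<gamma> *v e0 = \<tau> + (?f + (c + (-1/2) * (c1 - \<i> * c2)) *s gen B)"
    \<comment> \<open>Hence \<gamma> applied to \<open>e0\<close> is \<tau> modulo F^0 + W_-2, which
      the projection to type (-1,0) kills.\<close>
    unfolding a by (simp add: vec_eq_iff algebra_simps)
  have proj: "hproj (ibig F0) (-1) 0 (\<gamma> *v e0) = \<tau>"
    unfolding \<gamma>e0 h.hproj_kills[OF f] using h.hproj_self[OF \<tau>I, of "-1" 0] by simp
  have e0_ne: "e0 \<noteq> 0" using e0(2) by auto
  have t_eq: "t = \<tau>"
    using h.hodge_component_eq[OF _ e0_ne, of \<gamma>] e0(1) unfolding t I proj by simp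
  have tI: "t \<in> ibig F0 (-1) 0" using \<tau>I t_eq by simp
  have metric: "hodge_metric B F0 t t = dz (dzbar ?D) 0"
    using h.hodge_metric_eq[OF \<tau>I] curv t_eq by simp
  have nonneg: "hodge_metric B F0 t t \<in> \<real>\<^sub>\<ge>\<^sub>0"
    unfolding metric curv by (rule h.qf_positive[OF \<tau>])

  have "inf_invariant B (ball 0 R) Fd 0 e0 = t"
  proof -
    let ?P = "period_derivative (ball 0 R) (nu_filt B Fd) 0 0 e0"
    have nu: "nu_filt B Fd w 0 = {f + c *s gen B | f c. f \<in> Fd w 0}" for w
      by (auto simp: nu_filt_def set_plus_def)
    have sub: "hproj (ibig F0) (-1) 0 x = t" if x: "x \<in> ?P" for x
    proof -
      obtain \<sigma> N y where N: "open N" "0 \<in> N" "N \<subseteq> ball 0 R" and \<sigma>: "vholomorphic_on \<sigma> N" "\<forall>w\<in>N. \<sigma> w \<in> nu_filt B Fd w 0"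
        "\<sigma> 0 = e0" and y: "y \<in> nu_filt B Fd 0 0" "x = vderiv \<sigma> 0 + y"
        using x unfolding period_derivative_def by (auto elim!: set_plus_elim)
      have "\<exists>f\<in>Fd w 0. \<exists>c. \<sigma> w = f + c *s gen B" if "w \<in> N" for w
        using \<sigma>(2) that unfolding nu by blast
      from section_derivative[OF has_wdv_holomorphic[OF \<sigma>(1) N(1,2)] \<sigma>(3) N this, of 1]
      obtain f c where fc: "f \<in> F0 0" "vderiv \<sigma> 0 - \<gamma> *v e0 = f + c *s gen B" by auto
      obtain f' c' where y': "f' \<in> F0 0" "y = f' + c' *s gen B" using y(1) unfolding nu F0 by blast
      have "x = \<gamma> *v e0 + (f + c *s gen B) + y" unfolding y(2) fc(2)[symmetric] by simp
      also have "\<dots> = \<gamma> *v e0 + ((f + f') + (c + c') *s gen B)"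
        unfolding y'(2) by (simp add: vec_eq_iff algebra_simps)
      finally have x': "x = \<gamma> *v e0 + ((f + f') + (c + c') *s gen B)" .
      have "f + f' \<in> F0 0" using fc y' by (simp add: h.F_closed)
      then show ?thesis unfolding x' by (subst h.hproj_kills) (simp_all add: proj t_eq)
    qed
    \<comment> \<open>For the image to be the singleton of \<open>t\<close>, the coset must be
      nonempty: some holomorphic section has to pass through \<open>e0\<close>, and the adapted
      frame supplies one because \<open>PA\<close> fixes \<open>e0\<close>.\<close>
    obtain N A where N: "open N" "0 \<in> N" "N \<subseteq> ball 0 R" and AF: "\<And>w v. w \<in> N \<Longrightarrow> A w v \<in> Fd w 0"
      and hol: "\<And>v. vholomorphic_on (\<lambda>w. A w v) N" and A0: "\<And>v. A 0 v = biext_hodge.PA B (Fd 0) v"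
      by (rule fam.adapted_frame[OF R]) (rule that)
    have A0e: "A 0 e0 = e0" unfolding A0 F0[symmetric] by (rule h.PA_id[OF e0F])
    have in_nu: "x \<in> nu_filt B Fd w 0" if "x \<in> Fd w 0" for x w
      unfolding nu using that by (intro CollectI exI[of _ x] exI[of _ 0]) simp
    have "vderiv (\<lambda>w. A w e0) 0 + 0 \<in> ?P"
      unfolding period_derivative_def
    proof (rule set_plus_intro)
      show "vderiv (\<lambda>w. A w e0) 0 \<in> {vderiv \<sigma> 0 | \<sigma> N. open N \<and> 0 \<in> N \<and> N \<subseteq> ball 0 R \<and>
         vholomorphic_on \<sigma> N \<and> (\<forall>w \<in> N. \<sigma> w \<in> nu_filt B Fd w 0) \<and> \<sigma> 0 = e0}"
        using N hol[of e0] AF in_nu A0e by blast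
      show "0 \<in> nu_filt B Fd 0 0"
        by (rule in_nu) (use vec.subspace_0[OF h.subspace_F] in \<open>simp add: F0\<close>)
    qed
    then have "hproj (ibig F0) (-1) 0 ` ?P = {t}" using sub by blast
    then show ?thesis unfolding inf_invariant_def F0[symmetric] I by simp
  qed
  moreover have entries: "deligne_delta B (Fd w) $ i $ j = (gen B $ i * gr0 B (axis j 1)) * ?D w"
    if "w \<in> ball 0 R" for w i j
    unfolding biext_hodge.deligne_delta_eq[OF fam.fibre_hodge[OF that]] by (simp add: dmat_def)
  have loc: "dz (dzbar (\<lambda>w. deligne_delta B (Fd w) $ i $ j)) w = (gen B $ i * gr0 B (axis j 1)) * dz (dzbar ?D) w \<and>
     (\<lambda>w. deligne_delta B (Fd w) $ i $ j) differentiable (at w) \<and>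
     dz (\<lambda>w. deligne_delta B (Fd w) $ i $ j) differentiable (at w) \<and>
     dzbar (\<lambda>w. deligne_delta B (Fd w) $ i $ j) differentiable (at w)" if w: "w \<in> ball 0 R" for w i j
  proof -
    obtain r where r: "r > 0" "ball w r \<subseteq> ball 0 R" "real_anal (ball w r) ?D"
      by (rule fam.delta_curvature[OF w]) (rule that)
    have wr: "w \<in> ball w r" using r(1) by simp
    have "deligne_delta B (Fd x) $ i $ j = (gen B $ i * gr0 B (axis j 1)) * ?D x" if "x \<in> ball w r" for x
      using entries r(2) that by blast
    from dz_dzbar_cmult[OF open_ball wr r(3) this] show ?thesis by blast
  qed
  have "(\<chi> i j. dz (dzbar (\<lambda>w. deligne_delta B (Fd w) $ i $ j)) 0) = dmat (dz (dzbar ?D) 0)"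
    using loc[OF R] by (simp add: dmat_def vec_eq_iff)
  then have "(\<chi> i j. dz (dzbar (\<lambda>w. deligne_delta B (Fd w) $ i $ j)) 0) *v e0 = hodge_metric B F0 t t *s gen B"
    by (simp add: metric e0(2))
  moreover have "twice_real_differentiable_on (\<lambda>w. deligne_delta B (Fd w) $ i $ j) (ball 0 R)" for i j
    by (rule twice_real_differentiable_onI) (use loc in blast)
  moreover have "t \<in> deligne_bigrading (W B) F0 (-1) 0" using tI I by simp
  ultimately show ?thesis
    using nonneg biextension_metric_semi_positive[OF variation self_dual] by blast
qed

end
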